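(* For any integer $n>1$ there exists a nonsingular holomorphic foliation $\mathscr{F}$ of the open unit ball $\mathbb{B}^n$ of $\mathbb{C}^n$ all of whose leaves are complete properly embedded holomorphic discs in $\mathbb{B}^n$.
   Context: $\mathbb{B}^n=\{z\in\mathbb{C}^n: |z|<1\}$ is the open unit ball, where $|\cdot|$ is the Euclidean norm, and $\mathbb{D}=\{z\in\mathbb{C}:|z|<1\}$ is the open unit disc. A properly embedded holomorphic disc in $\mathbb{B}^n$ is the image of a proper holomorphic embedding $\mathbb{D}\to\mathbb{B}^n$, that is, a closed complex submanifold of $\mathbb{B}^n$ which is biholomorphic to $\mathbb{D}$. A nonsingular holomorphic foliation of $\mathbb{B}^n$ (here with leaves of complex dimension one) is a partition of $\mathbb{B}^n$ into connected immersed complex submanifolds of dimension one (the leaves) such that every point of $\mathbb{B}^n$ has an open neighbourhood $U$ and a biholomorphic map $U\to V\times W$, with $V\subset\mathbb{C}^{n-1}$ and $W\subset\mathbb{C}$ open and connected, under which the connected components (in the leaf topology) of the intersections of leaves with $U$ correspond exactly to the sets $\{c\}\times W$, $c\in V$. An open connected submanifold $M$ of a Euclidean space is complete if every divergent path in $M$ has infinite Euclidean length (equivalently, the restriction of the Euclidean metric to $M$ is a complete Riemannian metric on $M$); a path $\gamma:[0,1)\to M$ is divergent if $\gamma(t)$ leaves any compact subset of $M$ as $t\to 1$. *)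

theory Defs
  imports "HOL-Analysis.Analysis"
begin

section \<open>Holomorphic maps between finite-dimensional complex spaces\<close>

text \<open>
  Types such as \<open>complex ^ 'n\<close> carry no type class for multiplication by complex scalars, so the
  scalar multiplications \<open>s1\<close>, \<open>s2\<close> of source and target are parameters: \<open>(*)\<close> for \<open>complex\<close>,
  \<open>(*s)\<close> for \<open>complex ^ 'n\<close>, and \<open>module_prod.scale (*s) (*)\<close> for \<open>(complex ^ 'm) \<times> complex\<close>.
  The domain \<open>S\<close> is meant to be open.
\<close>

definition holomorphic_map ::
  "(complex \<Rightarrow> 'a::real_normed_vector \<Rightarrow> 'a) \<Rightarrow> (complex \<Rightarrow> 'b::real_normed_vector \<Rightarrow> 'b) \<Rightarrow>
   ('a \<Rightarrow> 'b) \<Rightarrow> 'a set \<Rightarrow> bool" where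
  "holomorphic_map s1 s2 f S \<longleftrightarrow>
     (\<forall>z\<in>S. \<exists>f'. Vector_Spaces.linear s1 s2 f' \<and> (f has_derivative f') (at z))"

definition holomorphic_immersion ::
  "(complex \<Rightarrow> 'a::real_normed_vector \<Rightarrow> 'a) \<Rightarrow> (complex \<Rightarrow> 'b::real_normed_vector \<Rightarrow> 'b) \<Rightarrow>
   ('a \<Rightarrow> 'b) \<Rightarrow> 'a set \<Rightarrow> bool" where
  "holomorphic_immersion s1 s2 f S \<longleftrightarrow>
     (\<forall>z\<in>S. \<exists>f'. Vector_Spaces.linear s1 s2 f' \<and> inj f' \<and> (f has_derivative f') (at z))"

definition biholomorphic_map ::
  "(complex \<Rightarrow> 'a::real_normed_vector \<Rightarrow> 'a) \<Rightarrow> (complex \<Rightarrow> 'b::real_normed_vector \<Rightarrow> 'b) \<Rightarrow>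
   ('a \<Rightarrow> 'b) \<Rightarrow> 'a set \<Rightarrow> 'b set \<Rightarrow> bool" where
  "biholomorphic_map s1 s2 f S T \<longleftrightarrow>
     bij_betw f S T \<and> holomorphic_map s1 s2 f S \<and> holomorphic_map s2 s1 (inv_into S f) T"

lemma holomorphic_map_complex_iff:
  assumes "open S"
  shows "holomorphic_map (*) (*) f S \<longleftrightarrow> f holomorphic_on S"
proof -
  have lin: "Vector_Spaces.linear (*) (*) f' \<longleftrightarrow> (\<exists>c. f' = (*) c)" for f' :: "complex \<Rightarrow> complex"
  proof
    assume "Vector_Spaces.linear (*) (*) f'"
    then interpret Vector_Spaces.linear "(*)" "(*)" f' .
    have "f' x = f' 1 * x" for x
      using scale[of x 1] by (simp add: mult.commute)
    then show "\<exists>c. f' = (*) c" by blast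
  next
    assume "\<exists>c. f' = (*) c"
    then show "Vector_Spaces.linear (*) (*) f'"
      by unfold_locales (auto simp: algebra_simps)
  qed
  show ?thesis
    unfolding holomorphic_map_def holomorphic_on_open[OF assms] lin has_field_derivative_def
    by metis
qed


section \<open>Holomorphic foliations by curves\<close>

text \<open>
  An immersed submanifold is a subset of \<open>complex ^ 'n\<close> with its own topology, in general finer
  than the subspace topology; both are recorded in a single abstract topology \<open>X\<close>.  The complex
  structure is the one for which the local parametrisations \<open>g\<close> are charts: since each \<open>g\<close> is an
  immersion into \<open>complex ^ 'n\<close> and a homeomorphism onto an open subset of \<open>X\<close>, the transition
  maps are automatically biholomorphic.  In the same way, \<open>X\<close> is automatically Hausdorff.
\<close>

definition connected_immersed_curve :: "(complex ^ 'n) topology \<Rightarrow> bool" where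
  "connected_immersed_curve X \<longleftrightarrow>
     topspace X \<noteq> {} \<and> connected_space X \<and> second_countable X \<and>
     (\<forall>p\<in>topspace X. \<exists>N W g.
        openin X N \<and> p \<in> N \<and> open W \<and>
        holomorphic_immersion (*) (*s) g W \<and>
        homeomorphic_map (top_of_set W) (subtopology X N) g)"

text \<open>
  \<open>\<F>\<close> is the set of leaves and \<open>\<tau> L\<close> the leaf topology of the leaf \<open>L\<close>.  The type \<open>'m\<close> indexes the
  coordinates of the transverse factor, so that \<open>complex ^ 'm\<close> is \<open>(n - 1)\<close>-dimensional complex space
  when \<open>CARD('n) = CARD('m) + 1\<close>.
\<close>

definition nonsingular_holomorphic_foliation ::
  "'m::finite itself \<Rightarrow> (complex ^ 'n) set \<Rightarrow> (complex ^ 'n) set set \<Rightarrow> bool" where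
  "nonsingular_holomorphic_foliation (_ :: 'm::finite itself) \<Omega> \<F> \<longleftrightarrow>
     partition_on \<Omega> \<F> \<and>
     (\<exists>\<tau>. (\<forall>L\<in>\<F>. topspace (\<tau> L) = L \<and> connected_immersed_curve (\<tau> L)) \<and>
       (\<forall>p\<in>\<Omega>. \<exists>U V W \<phi>.
          open U \<and> p \<in> U \<and> U \<subseteq> \<Omega> \<and>
          open V \<and> connected V \<and> open W \<and> connected W \<and>
          biholomorphic_map (*s) (module_prod.scale (*s) (*)) \<phi> U
            ((V :: (complex ^ 'm) set) \<times> (W :: complex set)) \<and>
          {\<phi> ` C | C L. L \<in> \<F> \<and> C \<in> connected_components_of (subtopology (\<tau> L) U)} =
          {{c} \<times> W | c. c \<in> V}))"


section \<open>Properly embedded holomorphic discs\<close>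

definition proper_holomorphic_embedding_of_disc ::
  "(complex ^ 'n) set \<Rightarrow> (complex \<Rightarrow> complex ^ 'n) \<Rightarrow> bool" where
  "proper_holomorphic_embedding_of_disc \<Omega> f \<longleftrightarrow>
     f ` ball 0 1 \<subseteq> \<Omega> \<and>
     holomorphic_immersion (*) (*s) f (ball 0 1) \<and>
     homeomorphic_map (top_of_set (ball 0 1)) (top_of_set (f ` ball 0 1)) f \<and>
     (\<forall>K. compact K \<and> K \<subseteq> \<Omega> \<longrightarrow> compact {z \<in> ball 0 1. f z \<in> K})"

definition properly_embedded_holomorphic_disc ::
  "(complex ^ 'n) set \<Rightarrow> (complex ^ 'n) set \<Rightarrow> bool" where
  "properly_embedded_holomorphic_disc \<Omega> L \<longleftrightarrow>
     (\<exists>f. proper_holomorphic_embedding_of_disc \<Omega> f \<and> L = f ` ball 0 1)"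


section \<open>Completeness\<close>

text \<open>
  The Euclidean length of a path on \<open>[0,1)\<close> is the supremum of the lengths of its inscribed polygons;
  it may be infinite.
\<close>

definition half_open_path_length :: "(real \<Rightarrow> 'a::metric_space) \<Rightarrow> ennreal" where
  "half_open_path_length \<gamma> =
     (SUP ts \<in> {ts. sorted ts \<and> set ts \<subseteq> {0..<1}}.
        \<Sum>i<length ts - 1. ennreal (dist (\<gamma> (ts ! i)) (\<gamma> (ts ! Suc i))))"

definition divergent_path :: "'a::topological_space set \<Rightarrow> (real \<Rightarrow> 'a) \<Rightarrow> bool" where
  "divergent_path M \<gamma> \<longleftrightarrow>
     continuous_on {0..<1} \<gamma> \<and> \<gamma> ` {0..<1} \<subseteq> M \<and>
     (\<forall>K. compact K \<and> K \<subseteq> M \<longrightarrow> (\<forall>\<^sub>F t in at_left 1. \<gamma> t \<notin> K))"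

text \<open>Here \<open>M\<close> carries the subspace topology, as is appropriate for embedded submanifolds.\<close>

definition complete_submanifold :: "'a::euclidean_space set \<Rightarrow> bool" where
  "complete_submanifold M \<longleftrightarrow> (\<forall>\<gamma>. divergent_path M \<gamma> \<longrightarrow> half_open_path_length \<gamma> = \<infinity>)"

end

theory Submission
  imports Defs "HOL-Complex_Analysis.Riemann_Mapping"
begin

text \<open>
  We construct a holomorphic embedding \<open>\<Phi>\<close> of the ball into \<open>\<complex>\<^sup>n\<close> one of whose coordinates is unbounded
  along every path of finite length ending on the sphere.  The leaves are the connected components
  of the preimages of parallel complex lines on which this coordinate is constant.

  \<open>\<Phi>\<close> is a limit of polynomial automorphisms \<open>S\<^sub>1 \<circ> \<dots> \<circ> S\<^sub>k\<close>, where each \<open>S\<^sub>k\<close> is a shear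
  \<open>z \<mapsto> z + g (\<langle>z, w\<rangle>) v\<close> with \<open>v \<bottom> w\<close>.  The polynomial \<open>g\<close> is small on a half-plane and large
  beyond it, so that \<open>S\<^sub>k\<close> hardly moves a large ball but pushes a cap far away in the direction
  \<open>v\<close>.  A polynomial map whose leading form does not vanish at \<open>v\<close> is large there, and the leading
  form of the new map is a multiple of a power of \<open>\<langle>\<cdot>, w\<rangle>\<close>, so the step can be iterated.
  The caps form a labyrinth: every path to the sphere which avoids all but finitely many of them
  has infinite length.

  Since \<open>\<Phi>\<close> is a limit of automorphisms, the maximum principle shows that \<open>\<Phi> (ball 0 1)\<close> contains
  a domain in a complex line as soon as it contains its boundary.  Hence the leaves are simply
  connected, and the Riemann mapping theorem (with Liouville's theorem excluding the plane) makes
  them discs.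
\<close>

section \<open>A labyrinth of spherical caps\<close>

text \<open>On a leaf the unbounded coordinate is constant, so the crossings of a divergent path
  with the layer spheres avoid the caps of all but finitely many layers; this makes all leaves
  complete at once. A single holomorphic function that is large on the caps would not suffice: its
  level sets could be singular and of uncontrolled topology. As a coordinate of an injective map
  with Runge image it has neither defect.

  Two obstacles shape the construction. A direction \<open>v\<close> orthogonal to the cap axis
  \<open>w\<close> at which the leading form does not vanish is available only if the current
  leading vector is not a multiple of \<open>w\<close>; otherwise an auxiliary shear, close to the
  identity on the unit ball, changes that vector first. Moreover, a limit of automorphisms may lose
  injectivity. Hence each correction is small compared with a lower Lipschitz constant of the
  preceding automorphism, even after division by the gap between consecutive spheres, which is the
  loss in Cauchy's estimate. All later corrections together cost at most half of such a constant;
  the surviving half gives injectivity, injective derivatives and the uniform control behind the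
  maximum principle argument.\<close>

lemma bounded_separated_card:
  fixes r \<beta> :: real
  assumes "\<beta> > 0"
  shows "\<exists>M. \<forall>S :: 'a::euclidean_space set. S \<subseteq> cball 0 r \<and>
    (\<forall>x\<in>S. \<forall>y\<in>S. x \<noteq> y \<longrightarrow> \<beta> \<le> dist x y) \<longrightarrow> finite S \<and> card S < M"
proof -
  \<comment> \<open>The finite cover is chosen before \<open>S\<close>, so one bound serves every
    \<open>S\<close>; each of its balls holds at most one point of a separated set.\<close>
  have "cball (0::'a) r \<subseteq> (\<Union>x\<in>cball 0 r. ball x (\<beta>/2))" using assms by auto
  then obtain k where k: "finite k" "cball (0::'a) r \<subseteq> (\<Union>x\<in>k. ball x (\<beta>/2))"
    using compactE_image[OF compact_cball, of "cball 0 r" "\<lambda>x. ball x (\<beta>/2)"] by (metis open_ball)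
  show ?thesis
  proof (intro exI[of _ "Suc (card k)"] allI impI, elim conjE)
    fix S :: "'a set"
    assume S: "S \<subseteq> cball 0 r" and sep: "\<forall>x\<in>S. \<forall>y\<in>S. x \<noteq> y \<longrightarrow> \<beta> \<le> dist x y"
    have "\<forall>x\<in>S. \<exists>c\<in>k. dist c x < \<beta>/2" using S k(2) unfolding subset_iff UN_iff mem_ball by blast
    then obtain c where c: "\<And>x. x \<in> S \<Longrightarrow> c x \<in> k \<and> dist (c x) x < \<beta>/2" by metis
    have "inj_on c S"
    proof (rule inj_onI, rule ccontr)
      fix x y assume "x \<in> S" "y \<in> S" "c x = c y" "x \<noteq> y"
      then show False using c[of x] c[of y] sep[rule_format, of x y] dist_triangle[of x y "c x"]
        by (auto simp: dist_commute)
    qed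
    moreover have "c ` S \<subseteq> k" using c by auto
    ultimately show "finite S \<and> card S < Suc (card k)"
      using k(1) by (meson card_inj_on_le inj_on_finite le_imp_less_Suc)
  qed
qed

lemma maximal_separated_subset:
  fixes T :: "'a::euclidean_space set"
  assumes "T \<subseteq> cball 0 r" "\<beta> > 0"
  shows "\<exists>Y. finite Y \<and> Y \<subseteq> T \<and> (\<forall>x\<in>Y. \<forall>y\<in>Y. x \<noteq> y \<longrightarrow> \<beta> \<le> dist x y) \<and>
    (\<forall>t\<in>T. \<exists>y\<in>Y. dist t y < \<beta>)"
proof -
  obtain M where M: "\<forall>S :: 'a set. S \<subseteq> cball 0 r \<and>
    (\<forall>x\<in>S. \<forall>y\<in>S. x \<noteq> y \<longrightarrow> \<beta> \<le> dist x y) \<longrightarrow> finite S \<and> card S < M"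
    using bounded_separated_card[of \<beta> r, where 'a='a] assms(2) by auto
  let ?P = "\<lambda>Y. Y \<subseteq> T \<and> (\<forall>x\<in>Y. \<forall>y\<in>Y. x \<noteq> y \<longrightarrow> \<beta> \<le> dist x y)"
  have fin: "finite Y \<and> card Y < M" if "?P Y" for Y
    using M[rule_format, of Y] that assms(1) by (meson subset_trans)
  have "?P {}" by simp
  moreover have "\<forall>Y. ?P Y \<longrightarrow> card Y < M" using fin by blast
  ultimately obtain Y where Y: "?P Y" and "\<forall>Z. ?P Z \<longrightarrow> card Z \<le> card Y"
    using ex_has_greatest_nat[of ?P "{}" card M] by blast
  then have Ymax: "card Z \<le> card Y" if "?P Z" for Z using that by blast
  have "\<exists>y\<in>Y. dist t y < \<beta>" if t: "t \<in> T" for t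
  proof (rule ccontr)
    assume "\<not> ?thesis"
    then have far: "\<forall>y\<in>Y. \<beta> \<le> dist t y" by (simp add: not_less)
    then have "t \<notin> Y" using assms(2) by force
    moreover have "?P (insert t Y)" using Y t far by (auto simp: dist_commute)
    ultimately show False using Ymax[of "insert t Y"] fin[OF Y] by simp
  qed
  then show ?thesis using Y fin[OF Y] by blast
qed

text \<open>A point missed by all \<open>M\<close> families would, by maximality of each family, be close to one
  member of each of them; the \<open>M\<close> points obtained are too many to be separated.\<close>

lemma spherical_net_families:
  "\<exists>M>0. \<forall>\<alpha>>0. \<exists>X :: nat \<Rightarrow> 'a::euclidean_space set.
     (\<forall>i. finite (X i) \<and> X i \<subseteq> sphere 0 1 \<and> (\<forall>x\<in>X i. \<forall>y\<in>X i. x \<noteq> y \<longrightarrow> 3 * \<alpha> \<le> dist x y)) \<and>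
     (\<forall>x\<in>sphere 0 1. \<exists>i<M. \<exists>y\<in>X i. dist x y < \<alpha> / 2)"
proof -
  \<comment> \<open>Magnified by 1/\<alpha> around a point, the distances 3\<alpha> and \<alpha>/2
    become 3 and 1/2. This is why \<open>M\<close> can be chosen before \<alpha>.\<close>
  obtain M where M: "\<forall>S :: 'a set. S \<subseteq> cball 0 3 \<and>
    (\<forall>x\<in>S. \<forall>y\<in>S. x \<noteq> y \<longrightarrow> 1/2 \<le> dist x y) \<longrightarrow> finite S \<and> card S < M"
    using bounded_separated_card[of "1/2" 3, where 'a='a]  by auto
  have M0: "M > 0" using M[rule_format, of "{}"] by simp
  show ?thesis
  proof (intro exI[of _ M] conjI M0 allI impI)
    fix \<alpha> :: real assume \<alpha>: "\<alpha> > 0"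
    \<comment> \<open>\<open>T U\<close> is the part of the sphere not within \<alpha>/2 of
      \<open>U\<close>. Each family is a maximal 3\<alpha>-separated subset of what its
      predecessors, collected in \<open>A i\<close>, leave uncovered.\<close>
    define T where "T U = {x \<in> sphere 0 1. \<forall>y\<in>U. \<alpha>/2 \<le> dist x y}" for U :: "'a set"
    define P where "P U Y \<longleftrightarrow> finite Y \<and> Y \<subseteq> T U \<and> (\<forall>x\<in>Y. \<forall>y\<in>Y. x \<noteq> y \<longrightarrow> 3 * \<alpha> \<le> dist x y) \<and>
       (\<forall>t\<in>T U. \<exists>y\<in>Y. dist t y < 3 * \<alpha>)" for U Y
    have "T U \<subseteq> cball 0 1" for U by (auto simp: T_def)
    then have "\<forall>U. \<exists>Y. P U Y"
      using maximal_separated_subset[of "T _" 1 "3 * \<alpha>"] \<alpha> by (simp add: P_def)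
    then obtain Y where "\<And>U. P U (Y U)" using choice[of P] by blast
    then have Y: "\<And>U. finite (Y U)" "\<And>U. Y U \<subseteq> T U"
       "\<And>U x y. x \<in> Y U \<Longrightarrow> y \<in> Y U \<Longrightarrow> x \<noteq> y \<Longrightarrow> 3 * \<alpha> \<le> dist x y"
       "\<And>U t. t \<in> T U \<Longrightarrow> \<exists>y\<in>Y U. dist t y < 3 * \<alpha>"
      by (simp_all add: P_def)
    define A where "A = rec_nat {} (\<lambda>_ U. U \<union> Y U)"
    have A: "A 0 = {}" "A (Suc i) = A i \<union> Y (A i)" for i by (simp_all add: A_def)
    have Amono: "A i \<subseteq> A j" if "i \<le> j" for i j
      by (rule lift_Suc_mono_le[OF _ that]) (auto simp: A)
    have YA: "Y (A i) \<subseteq> A j" if "i < j" for i j using Amono[of "Suc i" j] that A(2)[of i] by auto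
    have cover: "\<exists>i<M. \<exists>y\<in>Y (A i). dist x y < \<alpha>/2" if x: "x \<in> sphere 0 1" for x
    proof (rule ccontr)
      assume non: "\<not> ?thesis"
      have "x \<in> T (A i)" if "i \<le> M" for i using that
      proof (induction i)
        case (Suc i)
        then have "\<forall>y\<in>Y (A i). \<alpha>/2 \<le> dist x y" using non by (meson Suc_le_eq not_less)
        with Suc show ?case by (auto simp: T_def A)
      qed (use x in \<open>auto simp: T_def A\<close>)
      then have "\<forall>i<M. \<exists>y\<in>Y (A i). dist x y < 3*\<alpha>" using Y(4) by simp
      then obtain y where y: "\<And>i. i < M \<Longrightarrow> y i \<in> Y (A i) \<and> dist x (y i) < 3*\<alpha>" by metis
      \<comment> \<open>The later point was chosen in the uncovered set, so it keeps distance
        \<alpha>/2 from all earlier families.\<close>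
      have sep0: "\<alpha>/2 \<le> dist (y j) (y i)" if "i < j" "j < M" for i j
      proof -
        have "y i \<in> A j" using y[of i] that YA by auto
        moreover have "y j \<in> T (A j)" using y[of j] that Y(2) by auto
        ultimately show ?thesis by (auto simp: T_def)
      qed
      have sep: "\<alpha>/2 \<le> dist (y i) (y j)" if "i \<noteq> j" "i < M" "j < M" for i j
        using sep0[of i j] sep0[of j i] that by (cases "i < j") (auto simp: dist_commute)
      have inj: "inj_on y {..<M}" by (rule inj_onI) (use sep \<alpha> in fastforce)
      define h where "h p = (1/\<alpha>) *\<^sub>R (p - x)" for p
      have dh: "dist (h p) (h q) = dist p q / \<alpha>" for p q
        using \<alpha> by (simp add: h_def dist_norm flip: scaleR_diff_right)
      have injh: "inj h" using \<alpha> by (auto simp: h_def inj_def)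
      have sub: "h ` y ` {..<M} \<subseteq> cball 0 3"
      proof -
        have "norm (h (y i)) \<le> 3" if "i < M" for i
          using y[OF that] \<alpha> by (simp add: h_def dist_norm norm_minus_commute divide_simps)
        then show ?thesis by auto
      qed
      have s: "1/2 \<le> dist a b" if "a \<in> h ` y ` {..<M}" "b \<in> h ` y ` {..<M}" "a \<noteq> b" for a b
      proof -
        from that obtain i j where "i < M" "j < M" "a = h (y i)" "b = h (y j)" "i \<noteq> j" by auto
        with sep[of i j] \<alpha> show ?thesis by (simp add: dh pos_le_divide_eq)
      qed
      have "card (h ` y ` {..<M}) = M"
        using card_image[OF inj] card_image[OF inj_on_subset[OF injh subset_UNIV]] by simp
      then show False using M[rule_format, OF conjI[OF sub]] s by simp
    qed
    show "\<exists>X :: nat \<Rightarrow> 'a set. (\<forall>i. finite (X i) \<and> X i \<subseteq> sphere 0 1 \<and>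
         (\<forall>x\<in>X i. \<forall>y\<in>X i. x \<noteq> y \<longrightarrow> 3 * \<alpha> \<le> dist x y)) \<and>
       (\<forall>x\<in>sphere 0 1. \<exists>i<M. \<exists>y\<in>X i. dist x y < \<alpha> / 2)"
    proof (intro exI[of _ "\<lambda>i. Y (A i)"] conjI allI)
      fix i
      show "Y (A i) \<subseteq> sphere 0 1" using Y(2)[of "A i"] by (auto simp: T_def)
    qed (use Y(1,3) cover in auto)
  qed
qed

text \<open>Consecutive radii differ by \<open>1 / ((k + 2) * (k + 3))\<close>. A cap of angular
  radius \<alpha> has relative height \<open>\<alpha>\<^sup>2 / 2\<close>, so caps with \<alpha> of
  order 1/k fit between neighbouring spheres. Starting at radius 1/2 keeps away from the origin,
  where directions are unstable.\<close>

definition layer_radius :: "nat \<Rightarrow> real" where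
  "layer_radius k = 1 - 1 / (real k + 2)"

lemma layer_radius_bounds: "1/2 \<le> layer_radius k" "layer_radius k < 1"
  by (auto simp: layer_radius_def divide_simps)

lemma layer_radius_less_iff: "layer_radius k < layer_radius l \<longleftrightarrow> k < l"
  by (simp add: layer_radius_def divide_simps) (auto simp: algebra_simps)

lemma layer_radius_le_iff: "layer_radius k \<le> layer_radius l \<longleftrightarrow> k \<le> l"
  by (simp add: layer_radius_def divide_simps) (auto simp: algebra_simps)

lemma layer_radius_eventually_greater: "r < 1 \<Longrightarrow> \<exists>k. r < layer_radius k"
proof -
  assume "r < 1"
  then obtain k where "1 / (1 - r) < real k" using reals_Archimedean2 by blast
  with \<open>r < 1\<close> have "r < layer_radius k" by (simp add: layer_radius_def field_simps)
  then show ?thesis ..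
qed

text \<open>By this identity, the cap of height at least \<open>r * (1 - \<alpha>\<^sup>2/2)\<close>
  on the sphere of radius \<open>r\<close> consists of the points within \<open>r * \<alpha>\<close>
  of the pole \<open>r *\<^sub>R x\<close>.\<close>

lemma norm_sub_sq_cap:
  fixes x z :: "'a::real_inner"
  assumes "norm x = 1"
  shows "(norm (z - r *\<^sub>R x))\<^sup>2 = (norm z)\<^sup>2 + r\<^sup>2 - 2 * r * (z \<bullet> x)"
proof -
  have "x \<bullet> x = 1" using assms by (simp add: norm_eq_1)
  then show ?thesis
    unfolding power2_norm_eq_inner
    by (simp add: inner_diff_left inner_diff_right inner_commute[of x z] power2_eq_square algebra_simps)
qed

text \<open>A point in the cap at \<open>y\<close> is within \<open>r * \<alpha>\<close> of that
  pole, and the poles are at least \<open>3 * r * \<alpha>\<close> apart. So it is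
  \<open>2 * r * \<alpha>\<close> away from the other pole, which puts it strictly below the other
  cap. The margin allows the caps of a layer to be pushed one after another.\<close>

lemma cap_separation:
  fixes x y z :: "'a::real_inner"
  assumes x: "norm x = 1" and y: "norm y = 1" and r: "r > 0" and a: "\<alpha> > 0"
    and d: "3 * \<alpha> \<le> dist x y" and z: "norm z \<le> r" and zy: "r * (1 - \<alpha>\<^sup>2/2) \<le> z \<bullet> y"
  shows "z \<bullet> x \<le> r * (1 - \<alpha>\<^sup>2/2) - r * \<alpha>\<^sup>2"
proof -
  have z2: "(norm z)\<^sup>2 \<le> r\<^sup>2" using z by (simp add: power_mono)
  have "2 * r * (r * (1 - \<alpha>\<^sup>2/2)) \<le> 2 * r * (z \<bullet> y)" using zy r by simp
  then have "(norm (z - r *\<^sub>R y))\<^sup>2 \<le> (r * \<alpha>)\<^sup>2"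
    unfolding norm_sub_sq_cap[OF y] using z2 by (simp add: power2_eq_square algebra_simps)
  then have 1: "norm (z - r *\<^sub>R y) \<le> r * \<alpha>" by (rule power2_le_imp_le) (use r a in simp)
  have "norm (r *\<^sub>R x - r *\<^sub>R y) = r * dist x y"
    using r by (simp add: dist_norm flip: scaleR_diff_right)
  then have "3 * (r * \<alpha>) \<le> norm (r *\<^sub>R x - r *\<^sub>R y)" using d r by simp
  also have "\<dots> \<le> norm (z - r *\<^sub>R y) + norm (z - r *\<^sub>R x)"
    using norm_triangle_ineq4[of "z - r *\<^sub>R y" "z - r *\<^sub>R x"] by simp
  finally have "2 * (r * \<alpha>) \<le> norm (z - r *\<^sub>R x)" using 1 by simp
  then have "(2 * (r * \<alpha>))\<^sup>2 \<le> (norm (z - r *\<^sub>R x))\<^sup>2" by (rule power_mono) (use r a in simp)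
  then have "2 * r * (z \<bullet> x) \<le> 2 * r * (r * (1 - 2 * \<alpha>\<^sup>2))"
    unfolding norm_sub_sq_cap[OF x] using z2 by (simp add: power2_eq_square algebra_simps)
  then have "z \<bullet> x \<le> r * (1 - 2 * \<alpha>\<^sup>2)" using r by simp
  moreover have "0 \<le> r * \<alpha>\<^sup>2" using r by simp
  ultimately show ?thesis by (simp add: algebra_simps)
qed

text \<open>The caps force a change of direction; the lower bound 1/2 on the norms converts it into
  Euclidean length at a fixed rate.\<close>

lemma dist_sgn_le:
  fixes p q :: "'a::real_normed_vector"
  assumes "1/2 \<le> norm p" "1/2 \<le> norm q"
  shows "dist (sgn p) (sgn q) \<le> 4 * dist p q"
proof -
  have nz: "norm p \<noteq> 0" "norm q \<noteq> 0" using assms by linarith+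
  have "norm p *\<^sub>R (sgn p - sgn q) = (p - q) + (norm q - norm p) *\<^sub>R sgn q"
    using nz by (simp add: sgn_div_norm algebra_simps)
  then have "norm p * norm (sgn p - sgn q) = norm ((p - q) + (norm q - norm p) *\<^sub>R sgn q)"
    by (metis norm_scaleR abs_norm_cancel)
  also have "\<dots> \<le> norm (p - q) + \<bar>norm q - norm p\<bar> * norm (sgn q)"
    using norm_triangle_ineq by (metis norm_scaleR)
  also have "\<dots> \<le> 2 * norm (p - q)"
    using norm_triangle_ineq3[of q p] nz by (simp add: norm_sgn norm_minus_commute)
  finally have "norm p * norm (sgn p - sgn q) \<le> 2 * norm (p - q)" .
  moreover have "1/2 * norm (sgn p - sgn q) \<le> norm p * norm (sgn p - sgn q)"
    using assms by (intro mult_right_mono) auto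
  ultimately show ?thesis by (simp add: dist_norm)
qed

text \<open>Layers are grouped in cycles of \<open>M\<close>.  The caps of cycle \<open>c\<close> have angular size
  \<open>\<alpha> c\<close>, which is of order \<open>1 / (c + 1)\<close>, and thickness of order \<open>(\<alpha> c)\<^sup>2\<close>.  Avoiding the
  caps of cycle \<open>c\<close> costs length of order \<open>\<alpha> c\<close>: the thicknesses are summable,
  the lengths are not.\<close>

lemma labyrinth:
  "\<exists>(X :: nat \<Rightarrow> 'a::euclidean_space set) s \<epsilon>.
    (\<forall>k. finite (X k) \<and> X k \<subseteq> sphere 0 1 \<and> layer_radius k < s k \<and> 0 < \<epsilon> k \<and>
       (\<forall>x\<in>X k. \<forall>y\<in>X k. \<forall>z. x \<noteq> y \<and> norm z \<le> layer_radius (Suc k) \<and> s k \<le> z \<bullet> y \<longrightarrow>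
          z \<bullet> x \<le> s k - \<epsilon> k)) \<and>
    (\<forall>K z. (\<forall>k\<ge>K. norm (z k) = layer_radius k \<and> (\<forall>x\<in>X k. z (Suc k) \<bullet> x < s k)) \<longrightarrow>
       \<not> summable (\<lambda>k. dist (z k) (z (Suc k))))"
proof -
  obtain M where M0: "M > 0" and M: "\<And>\<alpha>. \<alpha> > 0 \<Longrightarrow> \<exists>X :: nat \<Rightarrow> 'a::euclidean_space set.
     (\<forall>i. finite (X i) \<and> X i \<subseteq> sphere 0 1 \<and> (\<forall>x\<in>X i. \<forall>y\<in>X i. x \<noteq> y \<longrightarrow> 3 * \<alpha> \<le> dist x y)) \<and>
     (\<forall>x\<in>sphere 0 1. \<exists>i<M. \<exists>y\<in>X i. dist x y < \<alpha> / 2)"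
    using spherical_net_families[where 'a='a] by (elim exE conjE) simp
  \<comment> \<open>The factor \<open>M + 2\<close> pays for the \<open>M\<close> layers in a cycle:
    it gives \<open>\<beta> k \<le> 1 / (k + 3)\<close>, small enough for a cap to fit into its
    layer, while the series over \<open>c\<close> remains a multiple of the harmonic one.\<close>
  define \<alpha> where "\<alpha> c = 1 / ((real M + 2) * (real c + 1))" for c :: nat
  have \<alpha>0: "\<alpha> c > 0" for c by (simp add: \<alpha>_def)
  define P where "P c Y \<longleftrightarrow> (\<forall>i. finite (Y i) \<and> Y i \<subseteq> sphere 0 1 \<and>
       (\<forall>x\<in>Y i. \<forall>y\<in>Y i. x \<noteq> y \<longrightarrow> 3 * \<alpha> c \<le> dist x y)) \<and>
     (\<forall>x\<in>sphere 0 1. \<exists>i<M. \<exists>y\<in>Y i. dist x y < \<alpha> c / 2)" for c and Y :: "nat \<Rightarrow> 'a set"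
  have "\<forall>c. \<exists>Y. P c Y" using M[OF \<alpha>0] by (simp add: P_def)
  then obtain Y where "\<And>c. P c (Y c)" using choice[of P] by blast
  then have Y0: "\<And>c i. finite (Y c i) \<and> Y c i \<subseteq> sphere 0 1 \<and>
       (\<forall>x\<in>Y c i. \<forall>y\<in>Y c i. x \<noteq> y \<longrightarrow> 3 * \<alpha> c \<le> dist x y)"
     "\<And>c. \<forall>x\<in>sphere 0 1. \<exists>i<M. \<exists>y\<in>Y c i. dist x y < \<alpha> c / 2"
    by (simp_all add: P_def)
  have Y: "\<And>c i. finite (Y c i)" "\<And>c i x. x \<in> Y c i \<Longrightarrow> norm (x::'a) = 1"
     "\<And>c i x y. x \<in> Y c i \<Longrightarrow> y \<in> Y c i \<Longrightarrow> x \<noteq> y \<Longrightarrow> 3 * \<alpha> c \<le> dist x y"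
     "\<And>c x. norm x = 1 \<Longrightarrow> \<exists>i<M. \<exists>y\<in>Y c i. dist x y < \<alpha> c / 2"
    using Y0 by (simp_all add: subset_iff)
  define \<beta> where "\<beta> k = \<alpha> (k div M)" for k
  \<comment> \<open>The caps of layer \<open>k\<close> are cut from the ball of radius
    \<open>layer_radius (Suc k)\<close> and lie outside the ball of radius
    \<open>layer_radius k\<close>.\<close>
  define s where "s k = layer_radius (Suc k) * (1 - (\<beta> k)\<^sup>2/2)" for k
  define X where "X k = Y (k div M) (k mod M)" for k
  have lr0: "layer_radius k > 0" for k using layer_radius_bounds(1)[of k] by linarith
  show ?thesis
  proof (rule exI[of _ X], rule exI[of _ s], rule exI[of _ "\<lambda>k. layer_radius (Suc k) * (\<beta> k)\<^sup>2"],
      intro conjI allI ballI impI; (elim conjE)?)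
    fix k
    show "finite (X k)" by (simp add: X_def Y)
    show "layer_radius (Suc k) * (\<beta> k)\<^sup>2 > 0" using \<alpha>0[of "k div M"] lr0[of "Suc k"] by (auto simp: \<beta>_def intro!: mult_pos_pos)
    show "layer_radius k < s k"
    proof -
      let ?c = "k div M"
      have "k < (?c + 1) * M" using dividend_less_div_times[OF M0, of k] by simp
      then have "k + 3 \<le> (?c + 1) * M + 2" by linarith
      also have "\<dots> \<le> (M + 2) * (?c + 1)" by (simp add: algebra_simps)
      finally have "real (k + 3) \<le> real ((M+2) * (?c+1))" by (simp only: of_nat_le_iff)
      then have a: "real k + 3 \<le> (real M + 2) * (real ?c + 1)" by (simp add: algebra_simps)
      then have "\<beta> k \<le> 1 / (real k + 3)" unfolding \<beta>_def \<alpha>_def by (intro divide_left_mono) auto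
      then have "(\<beta> k)\<^sup>2 \<le> (1 / (real k + 3))\<^sup>2" using \<alpha>0 by (intro power_mono) (auto simp: \<beta>_def less_imp_le)
      then have "layer_radius (Suc k) * ((\<beta> k)\<^sup>2/2) \<le> 1 * ((1 / (real k + 3))\<^sup>2 / 2)"
        using layer_radius_bounds(2)[of "Suc k"] by (intro mult_mono) auto
      also have "\<dots> < 1 / ((real k + 2) * (real k + 3))"
        by (simp add: power2_eq_square divide_simps)
      also have "\<dots> = layer_radius (Suc k) - layer_radius k"
        by (simp add: layer_radius_def field_simps)
      finally show ?thesis by (simp add: s_def algebra_simps)
    qed
  next
    fix k show "X k \<subseteq> sphere 0 1" using Y(2) by (auto simp: X_def)
  next
    fix k x y z
    assume "x \<in> X k" "y \<in> X k" "x \<noteq> y" "norm z \<le> layer_radius (Suc k)" "s k \<le> z \<bullet> y"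
    moreover from this have "norm x = 1" "norm y = 1" "3 * \<beta> k \<le> dist x y"
      using Y(2,3) by (simp_all add: X_def \<beta>_def)
    moreover have "\<beta> k > 0" by (simp add: \<beta>_def \<alpha>0)
    ultimately show "z \<bullet> x \<le> s k - layer_radius (Suc k) * (\<beta> k)\<^sup>2"
      unfolding s_def by (intro cap_separation[OF _ _ lr0])
  next
    fix K :: nat and z :: "nat \<Rightarrow> 'a"
    assume "\<forall>k\<ge>K. norm (z k) = layer_radius k \<and> (\<forall>x\<in>X k. z (Suc k) \<bullet> x < s k)"
    then have zn: "\<And>k. k \<ge> K \<Longrightarrow> norm (z k) = layer_radius k"
      and av: "\<And>k x. k \<ge> K \<Longrightarrow> x \<in> X k \<Longrightarrow> z (Suc k) \<bullet> x < s k" by blast+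
    let ?d = "\<lambda>k. dist (z k) (z (Suc k))"
    have telescope: "dist (z a) (z b) \<le> (\<Sum>k=a..<b. ?d k)" if "a \<le> b" for a b
      using that
    proof (induction b rule: dec_induct)
      case (step n)
      then show ?case using dist_triangle[of "z a" "z (Suc n)" "z n"] by simp
    qed simp
    have far: "\<beta> k < dist (sgn (z (Suc k))) x" if "k \<ge> K" "x \<in> X k" for k x
    proof -
      let ?r = "layer_radius (Suc k)"
      have x1: "norm x = 1" using that by (simp add: X_def Y)
      have zn': "norm (z (Suc k)) = ?r" using zn that by simp
      then have sg: "sgn (z (Suc k)) = (1 / ?r) *\<^sub>R z (Suc k)" by (simp add: sgn_div_norm divide_inverse)
      have "(norm (sgn (z (Suc k)) - 1 *\<^sub>R x))\<^sup>2 = (norm (sgn (z (Suc k))))\<^sup>2 + 1\<^sup>2 - 2 * 1 * (sgn (z (Suc k)) \<bullet> x)"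
        by (rule norm_sub_sq_cap[OF x1])
      also have "norm (sgn (z (Suc k))) = 1" using zn' lr0[of "Suc k"] by (auto simp: norm_sgn)
      also have "sgn (z (Suc k)) \<bullet> x = (z (Suc k) \<bullet> x) / ?r" by (simp add: sg)
      finally have eq: "(norm (sgn (z (Suc k)) - x))\<^sup>2 = 2 - 2 * ((z (Suc k) \<bullet> x) / ?r)" by simp
      have "(z (Suc k) \<bullet> x) / ?r < 1 - (\<beta> k)\<^sup>2/2"
        using av[OF that] lr0[of "Suc k"] by (simp add: s_def pos_divide_less_eq mult.commute)
      with eq have "(\<beta> k)\<^sup>2 < (norm (sgn (z (Suc k)) - x))\<^sup>2" by simp
      then have "\<beta> k < norm (sgn (z (Suc k)) - x)" by (rule power2_less_imp_less) simp
      then show ?thesis by (simp add: dist_norm)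
    qed
    \<comment> \<open>The initial direction of a cycle is within \<alpha>/2 of some net point
      \<open>y\<close>; when the layer of \<open>y\<close> has been crossed, the direction is more
      than \<alpha> from \<open>y\<close>. The window starts at \<open>c * M + 1\<close> because
      layer \<open>k\<close> constrains the point with index \<open>Suc k\<close>; consecutive
      windows abut.\<close>
    have cyc: "\<alpha> c / 8 \<le> (\<Sum>k = c*M+1..<(c+1)*M+1. ?d k)" if c: "c \<ge> K" for c
    proof -
      have cM: "c * M \<ge> K" using c mult_le_mono[of K c 1 M] M0 by simp
      let ?p = "z (c*M+1)"
      have np: "norm ?p = layer_radius (c*M+1)" using zn cM by simp
      then have "norm (sgn ?p) = 1" using lr0[of "c*M+1"] by (auto simp: norm_sgn)
      then obtain i y where i: "i < M" "y \<in> Y c i" "dist (sgn ?p) y < \<alpha> c / 2" using Y(4) by blast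
      let ?k = "c*M+i"
      have k: "?k div M = c" "?k mod M = i" using i(1) by auto
      have yX: "y \<in> X ?k" using i by (simp add: X_def k)
      have "\<alpha> c < dist (sgn (z (Suc ?k))) y" using far[OF _ yX] cM by (simp add: \<beta>_def k)
      then have "\<alpha> c / 2 < dist (sgn ?p) (sgn (z (Suc ?k)))"
        using i(3) dist_triangle[of "sgn (z (Suc ?k))" y "sgn ?p"] by (simp add: dist_commute)
      also have "\<dots> \<le> 4 * dist ?p (z (Suc ?k))"
        using zn cM layer_radius_bounds by (intro dist_sgn_le) auto
      also have "dist ?p (z (Suc ?k)) \<le> (\<Sum>k = c*M+1..<Suc ?k. ?d k)" by (rule telescope) simp
      also have "\<dots> \<le> (\<Sum>k = c*M+1..<(c+1)*M+1. ?d k)" using i(1) by (intro sum_mono2) auto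
      finally show ?thesis by simp
    qed
    show "\<not> summable ?d"
    proof
      assume "summable ?d"
      have tot: "(\<Sum>c<n. \<alpha> (c + K) / 8) \<le> suminf ?d" for n
      proof -
        have "(\<Sum>c<n. \<alpha> (c + K) / 8) \<le> (\<Sum>c<n. \<Sum>k = (c+K)*M+1..<(c+K+1)*M+1. ?d k)"
          by (intro sum_mono cyc) simp
        also have "\<dots> = (\<Sum>k = K*M+1..<(n+K)*M+1. ?d k)"
        proof (induction n)
          case (Suc n)
          have "(\<Sum>k = K*M+1..<(n+K)*M+1. ?d k) + (\<Sum>k = (n+K)*M+1..<(n+K+1)*M+1. ?d k) =
             (\<Sum>k = K*M+1..<(n+K+1)*M+1. ?d k)"
            by (rule sum.atLeastLessThan_concat) (auto intro: mult_le_mono1)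
          then show ?case unfolding sum.lessThan_Suc Suc by (simp only: add_Suc Suc_eq_plus1 ac_simps)
        next
          case 0
          show ?case by simp
        qed
        also have "\<dots> \<le> suminf ?d" by (rule sum_le_suminf[OF \<open>summable ?d\<close>]) simp_all
        finally show ?thesis .
      qed
      have "summable (\<lambda>c. \<alpha> (c + K) / 8)"
        by (rule summableI_nonneg_bounded[OF _ tot]) (simp add: \<alpha>0 less_imp_le)
      then have "summable (\<lambda>c. \<alpha> (c + K))" by simp
      then have "summable (\<lambda>c. \<alpha> (c + K) * (real M + 2))" by (rule summable_mult2)
      moreover have "\<alpha> (c + K) * (real M + 2) = inverse (of_nat (Suc (c + K)))" for c
      proof -
        have "real M + 2 \<noteq> 0" by linarith
        then have "1 / ((real M + 2) * (real (c + K) + 1)) * (real M + 2) = 1 / (real (c + K) + 1)"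
          by (simp add: divide_simps)
        then show ?thesis by (simp add: \<alpha>_def inverse_eq_divide add_ac)
      qed
      ultimately have "summable (\<lambda>c. inverse (of_nat (Suc (c + K))) :: real)" by simp
      then have "summable (\<lambda>c. inverse (of_nat (Suc c)) :: real)"
        using summable_iff_shift[of "\<lambda>c. inverse (of_nat (Suc c)) :: real" K] by simp
      then show False
        using not_summable_harmonic[where 'a=real] summable_Suc_iff[of "\<lambda>c. inverse (of_nat c) :: real"] by simp
    qed
  qed
qed

section \<open>Holomorphic maps of complex Euclidean space\<close>

abbreviation holo :: "((complex ^ 'n::finite) \<Rightarrow> (complex ^ 'n)) \<Rightarrow> (complex ^ 'n) set \<Rightarrow> bool" where
  "holo \<equiv> holomorphic_map (*s) (*s)"

text \<open>The Hermitian form, linear in its first argument, so that pairing with a fixed vector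
  preserves holomorphy. Its real part is the real inner product: a cap is cut off by a condition on
  \<open>Re (hdot z w)\<close>, which a polynomial in \<open>hdot z w\<close> can approximately
  detect.\<close>

definition hdot :: "complex ^ 'n \<Rightarrow> complex ^ 'n \<Rightarrow> complex" where
  "hdot z w = (\<Sum>i\<in>UNIV. z $ i * cnj (w $ i))"

lemma hdot_add: "hdot (x + y) w = hdot x w + hdot y w"
  by (simp add: hdot_def sum.distrib algebra_simps)

lemma hdot_diff: "hdot (x - y) w = hdot x w - hdot y w"
  by (simp add: hdot_def sum_subtractf algebra_simps)

lemma hdot_zero [simp]: "hdot 0 w = 0" "hdot z 0 = 0"
  by (simp_all add: hdot_def)

lemma hdot_scale: "hdot (c *s x) w = c * hdot x w"
  by (simp add: hdot_def sum_distrib_left algebra_simps)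

lemma hdot_axis: "hdot z (axis i 1) = z $ i"
proof -
  have "z $ j * cnj (axis i 1 $ j) = (if j = i then z $ i else 0)" for j by (simp add: axis_def)
  then show ?thesis by (simp add: hdot_def)
qed

lemma Re_hdot: "Re (hdot z w) = z \<bullet> w"
  by (simp add: hdot_def inner_vec_def inner_complex_def)

lemma scaleR_eq_scale: "r *\<^sub>R (z :: complex ^ 'n) = of_real r *s z"
  by (simp add: vec_eq_iff) (simp add: scaleR_conv_of_real)

lemma norm_scale: "norm (c *s (z :: complex ^ 'n)) = norm c * norm z"
  by (simp add: norm_vec_def norm_mult L2_set_right_distrib)

lemma hdot_self: "hdot z z = of_real ((norm z)\<^sup>2)"
proof -
  have "hdot z z = (\<Sum>i\<in>UNIV. of_real ((cmod (z $ i))\<^sup>2))"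
    by (simp only: hdot_def complex_norm_square)
  then show ?thesis by (simp add: norm_vec_def L2_set_def sum_nonneg)
qed

text \<open>A unimodular factor on \<open>z\<close> makes the product real and nonnegative, where
  the real Cauchy-Schwarz inequality applies.\<close>

lemma norm_hdot_le: "norm (hdot z w) \<le> norm z * norm w"
proof (cases "hdot z w = 0")
  case False
  define c where "c = cnj (sgn (hdot z w))"
  have "norm c = 1" using False by (simp add: c_def norm_sgn)
  have "c * hdot z w = hdot z w * cnj (hdot z w) / of_real (norm (hdot z w))"
    by (simp add: c_def sgn_eq)
  also have "\<dots> = of_real (norm (hdot z w))"
    using False by (simp flip: complex_norm_square add: power2_eq_square)
  finally have "hdot (c *s z) w = of_real (norm (hdot z w))" by (simp add: hdot_scale)
  then have "norm (hdot z w) = (c *s z) \<bullet> w" by (simp flip: Re_hdot)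
  also have "\<dots> \<le> norm (c *s z) * norm w" by (rule norm_cauchy_schwarz)
  finally show ?thesis by (simp add: norm_scale \<open>norm c = 1\<close>)
qed simp

lemma clinear_iff:
  "Vector_Spaces.linear (*s) (*s) (f :: complex ^ 'n \<Rightarrow> complex ^ 'k) \<longleftrightarrow>
     (\<forall>x y. f (x + y) = f x + f y) \<and> (\<forall>c x. f (c *s x) = c *s f x)"
  by (simp add: Vector_Spaces.linear_iff vec.vector_space_axioms)

lemma bounded_linear_hdot: "bounded_linear (\<lambda>z. hdot z w)"
  by (rule bounded_linear_intro[of _ "norm w"])
    (simp_all add: hdot_add scaleR_eq_scale hdot_scale scaleR_conv_of_real norm_hdot_le)

lemma bounded_linear_scale_left: "bounded_linear (\<lambda>c. c *s (v :: complex ^ 'n))"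
proof (rule bounded_linear_intro[of _ "norm v"])
  show "(x + y) *s v = x *s v + y *s v" for x y by (rule vec.scale_left_distrib)
  show "(r *\<^sub>R x) *s v = r *\<^sub>R (x *s v)" for r x
    by (simp add: scaleR_eq_scale scaleR_conv_of_real)
qed (simp add: norm_scale)

section \<open>Holomorphic maps: Cauchy estimates and inverses\<close>

lemma holomorphic_map_comp:
  assumes f: "holomorphic_map s1 s2 f S" and g: "holomorphic_map s2 s3 g T" and "f ` S \<subseteq> T"
  shows "holomorphic_map s1 s3 (g \<circ> f) S"
  unfolding holomorphic_map_def
proof
  fix z assume z: "z \<in> S"
  obtain f' where f': "Vector_Spaces.linear s1 s2 f'" "(f has_derivative f') (at z)"
    using f z unfolding holomorphic_map_def by blast
  obtain g' where g': "Vector_Spaces.linear s2 s3 g'" "(g has_derivative g') (at (f z))"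
    using g z assms(3) unfolding holomorphic_map_def by blast
  show "\<exists>h. Vector_Spaces.linear s1 s3 h \<and> ((g \<circ> f) has_derivative h) (at z)"
    using Vector_Spaces.linear_compose[OF f'(1) g'(1)] diff_chain_at[OF f'(2) g'(2)] by blast
qed

lemma holomorphic_map_subset: "holomorphic_map s1 s2 f S \<Longrightarrow> T \<subseteq> S \<Longrightarrow> holomorphic_map s1 s2 f T"
  unfolding holomorphic_map_def by blast

lemma holomorphic_map_continuous: "holomorphic_map s1 s2 f S \<Longrightarrow> continuous_on S f"
  unfolding holomorphic_map_def
  by (meson continuous_at_imp_continuous_on has_derivative_continuous)

lemma holo_diff:
  assumes "holo f S" "holo g S" shows "holo (\<lambda>z. f z - g z) S"
  unfolding holomorphic_map_def
proof
  fix z assume z: "z \<in> S"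
  obtain f' where f': "Vector_Spaces.linear (*s) (*s) f'" "(f has_derivative f') (at z)"
    using assms z unfolding holomorphic_map_def by blast
  obtain g' where g': "Vector_Spaces.linear (*s) (*s) g'" "(g has_derivative g') (at z)"
    using assms z unfolding holomorphic_map_def by blast
  have "((\<lambda>z. f z - g z) has_derivative (\<lambda>h. f' h - g' h)) (at z)"
    by (rule has_derivative_diff[OF f'(2) g'(2)])
  moreover have "Vector_Spaces.linear (*s) (*s) (\<lambda>h. f' h - g' h)"
    using f'(1) g'(1) unfolding clinear_iff by (simp add: vec.scale_right_diff_distrib)
  ultimately show "\<exists>h. Vector_Spaces.linear (*s) (*s) h \<and> ((\<lambda>z. f z - g z) has_derivative h) (at z)" by blast
qed

text \<open>Restricting to a complex line and pairing with \<open>e\<close> reduces vector-valued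
  maps of several variables to scalar functions of one variable. Taking \<open>e\<close> to be the
  vector under estimation recovers its full norm.\<close>

lemma holo_line_derivative:
  assumes F: "(F has_derivative F') (at (z + t *s v))" and lin: "Vector_Spaces.linear (*s) (*s) F'"
  shows "((\<lambda>t. hdot (F (z + t *s v)) e) has_field_derivative hdot (F' v) e) (at t)"
proof -
  have "((\<lambda>t. z + t *s v) has_derivative (\<lambda>h. h *s v)) (at t)"
    by (auto intro!: derivative_eq_intros bounded_linear.has_derivative[OF bounded_linear_scale_left])
  from diff_chain_at[OF this F]
  have "((\<lambda>t. F (z + t *s v)) has_derivative (\<lambda>h. F' (h *s v))) (at t)" by (simp add: o_def)
  then have "((\<lambda>t. hdot (F (z + t *s v)) e) has_derivative (\<lambda>h. hdot (F' (h *s v)) e)) (at t)"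
    by (rule bounded_linear.has_derivative[OF bounded_linear_hdot])
  moreover have "F' (h *s v) = h *s F' v" for h using lin unfolding clinear_iff by blast
  moreover have "(\<lambda>h. h * hdot (F' v) e) = (*) (hdot (F' v) e)" by (simp add: fun_eq_iff mult.commute)
  ultimately show ?thesis by (simp add: has_field_derivative_def hdot_scale)
qed

lemma holo_line_holomorphic:
  assumes "holo F S" "\<And>t. t \<in> T \<Longrightarrow> z + t *s v \<in> S"
  shows "(\<lambda>t. hdot (F (z + t *s v)) e) holomorphic_on T"
proof -
  have "\<exists>D. ((\<lambda>t. hdot (F (z + t *s v)) e) has_field_derivative D) (at t)" if "t \<in> T" for t
    using assms(1) assms(2)[OF that] holo_line_derivative unfolding holomorphic_map_def by blast
  then show ?thesis
    unfolding holomorphic_on_def field_differentiable_def by (meson has_field_derivative_at_within)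
qed

text \<open>On the line \<open>z + t *s h\<close> the circle of radius \<open>r / norm h\<close>
  stays in the ball. Cauchy's inequality there, paired with \<open>e = F' h\<close>, bounds
  \<open>(norm e)\<^sup>2\<close>; cancelling one factor \<open>norm e\<close> leaves the claim with
  constant 1.\<close>

lemma holo_derivative_bound:
  assumes F: "holo F S" and ball: "cball z r \<subseteq> S" and r: "r > 0"
    and M: "\<And>x. x \<in> cball z r \<Longrightarrow> norm (F x) \<le> M"
    and F': "(F has_derivative F') (at z)"
  shows "norm (F' h) \<le> M / r * norm h"
proof (cases "h = 0 \<or> F' h = 0")
  case True
  have "M \<ge> 0" using M[of z] r by (auto intro: order_trans[OF norm_ge_zero])
  then show ?thesis using True r linear_0[OF has_derivative_linear[OF F']] by auto
next
  case False
  have zS: "z \<in> S" using ball r by auto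
  obtain F'' where lin: "Vector_Spaces.linear (*s) (*s) F''" and "(F has_derivative F'') (at z)"
    using F zS unfolding holomorphic_map_def by blast
  then have lin: "Vector_Spaces.linear (*s) (*s) F'" using has_derivative_unique[OF F'] by simp
  define e where "e = F' h"
  define \<rho> where "\<rho> = r / norm h"
  have \<rho>: "\<rho> > 0" using r False by (simp add: \<rho>_def)
  let ?\<phi> = "\<lambda>t. hdot (F (z + t *s h)) e"
  have inb: "z + t *s h \<in> cball z r" if "norm t \<le> \<rho>" for t :: complex
    using that False by (simp add: dist_norm norm_scale \<rho>_def field_simps)
  have hol: "?\<phi> holomorphic_on cball 0 \<rho>"
    by (rule holo_line_holomorphic[OF F]) (use inb ball in auto)
  have "norm ((deriv ^^ 1) ?\<phi> 0) \<le> fact 1 * (M * norm e) / \<rho> ^ 1"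
  proof (rule Cauchy_inequality)
    show "?\<phi> holomorphic_on ball 0 \<rho>" using hol holomorphic_on_subset by fastforce
    show "continuous_on (cball 0 \<rho>) ?\<phi>" using hol by (rule holomorphic_on_imp_continuous_on)
    fix t :: complex assume "norm (0 - t) = \<rho>"
    then have "norm (F (z + t *s h)) \<le> M" using inb[of t] M by simp
    then show "norm (?\<phi> t) \<le> M * norm e" by (meson norm_hdot_le mult_right_mono norm_ge_zero order_trans)
  qed (rule \<rho>)
  moreover have "(?\<phi> has_field_derivative hdot (F' h) e) (at 0)"
    by (rule holo_line_derivative[OF _ lin]) (use F' in simp)
  then have "deriv ?\<phi> 0 = hdot e e" unfolding e_def by (rule DERIV_imp_deriv)
  ultimately have "(norm e)\<^sup>2 \<le> M * norm e / \<rho>" by (simp add: hdot_self norm_power)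
  then have "norm e * norm e \<le> M / \<rho> * norm e" by (simp add: power2_eq_square)
  moreover have "norm e > 0" using False by (simp add: e_def)
  ultimately have "norm e \<le> M / \<rho>" by (rule mult_right_le_imp_le)
  then show ?thesis by (simp add: e_def \<rho>_def)
qed

text \<open>Cauchy's estimate on balls of radius \<open>R' - R\<close>, followed by the mean value
  inequality. It turns sup-norm bounds into bounds on increments, both for successive differences
  and for inverses of automorphisms.\<close>

lemma holo_Lipschitz:
  fixes F :: "complex ^ 'n \<Rightarrow> complex ^ 'n"
  assumes F: "holo F S" and sub: "cball 0 R' \<subseteq> S" and R: "R < R'"
    and M: "\<And>x. x \<in> cball 0 R' \<Longrightarrow> norm (F x) \<le> M"
    and xy: "x \<in> cball 0 R" "y \<in> cball 0 R"
  shows "norm (F x - F y) \<le> M / (R' - R) * norm (x - y)"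
proof -
  have "\<forall>z\<in>S. \<exists>F'. Vector_Spaces.linear (*s) (*s) F' \<and> (F has_derivative F') (at z)"
    using F unfolding holomorphic_map_def by blast
  then obtain F' where F': "\<And>z. z \<in> S \<Longrightarrow> (F has_derivative F' z) (at z)" by metis
  have sub2: "cball z (R' - R) \<subseteq> cball 0 R'" if "z \<in> cball 0 R" for z :: "complex ^ 'n"
  proof
    fix w assume "w \<in> cball z (R' - R)"
    then show "w \<in> cball 0 R'" using that norm_triangle_ineq2[of w z] by (simp add: dist_norm norm_minus_commute)
  qed
  show ?thesis
  proof (rule differentiable_bound[OF convex_cball])
    fix z assume z: "z \<in> cball (0 :: complex ^ 'n) R"
    then have "z \<in> S" using sub R by auto
    then show "(F has_derivative F' z) (at z within cball 0 R)" using F' has_derivative_at_withinI by blast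
    show "onorm (F' z) \<le> M / (R' - R)"
      using holo_derivative_bound[OF F _ _ _ F'[OF \<open>z \<in> S\<close>], of "R' - R" M] sub2[OF z] sub R M
      by (intro onorm_le) (auto simp: subset_iff)
  qed (use xy in auto)
qed

lemma clinear_inj_inverse:
  fixes f :: "complex ^ 'n \<Rightarrow> complex ^ 'n"
  assumes lin: "Vector_Spaces.linear (*s) (*s) f" and "inj f"
  shows "Vector_Spaces.linear (*s) (*s) (inv f)" "inv f \<circ> f = id" "bounded_linear (inv f)"
proof -
  have l: "f (x + y) = f x + f y" "f (c *s x) = c *s f x" for x y c
    using lin unfolding clinear_iff by blast+
  have "linear f" by (rule linearI) (simp_all add: l scaleR_eq_scale)
  then have "surj f" using \<open>inj f\<close> linear_injective_imp_surjective by blast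
  then have s: "f (inv f x) = x" for x by (rule surj_f_inv_f)
  have "inv f (x + y) = inv f x + inv f y" "inv f (c *s x) = c *s inv f x" for x y c
    by (rule injD[OF \<open>inj f\<close>], simp add: s l)+
  then show lin': "Vector_Spaces.linear (*s) (*s) (inv f)" unfolding clinear_iff by blast
  show "inv f \<circ> f = id" using \<open>inj f\<close> by simp
  have "linear (inv f)" using lin' unfolding clinear_iff by (intro linearI) (simp_all add: scaleR_eq_scale)
  then show "bounded_linear (inv f)" by (simp add: linear_conv_bounded_linear)
qed

text \<open>Invariance of domain makes the image open and the inverse continuous; a continuous
  inverse is differentiable where the derivative is invertible. The hypothesis \<open>imm\<close>
  will come from a lower Lipschitz bound.\<close>

lemma holo_injective_biholomorphic:
  assumes F: "holo F S" and S: "open S" and inj: "inj_on F S"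
    and imm: "\<And>z F'. z \<in> S \<Longrightarrow> (F has_derivative F') (at z) \<Longrightarrow> inj F'"
  shows "open (F ` S)" "biholomorphic_map (*s) (*s) F S (F ` S)"
proof -
  have cont: "continuous_on S F" by (rule holomorphic_map_continuous[OF F])
  show op: "open (F ` S)" by (rule invariance_of_domain[OF cont S inj])
  have cinv: "continuous_on (F ` S) (inv_into S F)"
  proof -
    obtain g where g: "homeomorphism S (F ` S) F g"
      by (rule invariance_of_domain_homeomorphism[OF S cont order_refl inj])
    have "inv_into S F y = g y" if "y \<in> F ` S" for y
    proof -
      from that obtain x where x: "x \<in> S" "y = F x" by blast
      then show ?thesis using homeomorphism_apply1[OF g x(1)] inv_into_f_f[OF inj x(1)] by simp
    qed
    then show ?thesis using continuous_on_eq[OF homeomorphism_cont2[OF g]] by metis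
  qed
  have "holo (inv_into S F) (F ` S)"
    unfolding holomorphic_map_def
  proof
    fix y assume "y \<in> F ` S"
    then obtain x where x: "x \<in> S" "y = F x" by blast
    obtain F' where F': "Vector_Spaces.linear (*s) (*s) F'" "(F has_derivative F') (at x)"
      using F x unfolding holomorphic_map_def by blast
    note iv = clinear_inj_inverse[OF F'(1) imm[OF x(1) F'(2)]]
    have "(inv_into S F has_derivative inv F') (at (F x))"
      by (rule has_derivative_inverse_dieudonne[OF S op cont cinv _ x(1) F'(2) iv(3,2)])
        (simp add: inj)
    then show "\<exists>f'. Vector_Spaces.linear (*s) (*s) f' \<and> (inv_into S F has_derivative f') (at y)"
      using iv(1) x(2) by blast
  qed
  then show "biholomorphic_map (*s) (*s) F S (F ` S)"
    using F inj by (simp add: biholomorphic_map_def inj_on_imp_bij_betw)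
qed

section \<open>Pushing caps by polynomial shears\<close>

abbreviation automorphism :: "((complex ^ 'n::finite) \<Rightarrow> (complex ^ 'n)) \<Rightarrow> bool" where
  "automorphism F \<equiv> biholomorphic_map (*s) (*s) F UNIV UNIV"

lemma automorphism_comp:
  assumes "automorphism F" "automorphism G" shows "automorphism (F \<circ> G)"
proof -
  have b: "bij F" "bij G" using assms by (auto simp: biholomorphic_map_def)
  have "inv (F \<circ> G) = inv G \<circ> inv F" using b by (rule o_inv_distrib)
  then show ?thesis
    using assms bij_comp[OF b(2,1)] holomorphic_map_comp[of "(*s)" "(*s)" _ UNIV "(*s)" _ UNIV]
    unfolding biholomorphic_map_def by (metis subset_UNIV)
qed

definition shear :: "(complex \<Rightarrow> complex) \<Rightarrow> complex ^ 'n \<Rightarrow> complex ^ 'n \<Rightarrow> complex ^ 'n \<Rightarrow> complex ^ 'n" where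
  "shear g w v z = z + g (hdot z w) *s v"

lemma holo_shear:
  assumes "\<And>t. \<exists>D. (g has_field_derivative D) (at t)"
  shows "holo (shear g w v) UNIV"
  unfolding holomorphic_map_def
proof
  fix z
  obtain D where D: "(g has_field_derivative D) (at (hdot z w))" using assms by blast
  have "((\<lambda>z. hdot z w) has_derivative (\<lambda>h. hdot h w)) (at z)"
    by (rule bounded_linear_imp_has_derivative[OF bounded_linear_hdot])
  from diff_chain_at[OF this D[unfolded has_field_derivative_def]]
  have "((\<lambda>z. g (hdot z w)) has_derivative (\<lambda>h. D * hdot h w)) (at z)" by (simp add: o_def)
  then have "((\<lambda>z. g (hdot z w) *s v) has_derivative (\<lambda>h. (D * hdot h w) *s v)) (at z)"
    by (rule bounded_linear.has_derivative[OF bounded_linear_scale_left])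
  then have "(shear g w v has_derivative (\<lambda>h. h + (D * hdot h w) *s v)) (at z)"
    unfolding shear_def[abs_def] by (intro has_derivative_add has_derivative_ident)
  moreover have "Vector_Spaces.linear (*s) (*s) (\<lambda>h. h + (D * hdot h w) *s v)"
    unfolding clinear_iff by (simp add: hdot_add hdot_scale vec_eq_iff algebra_simps)
  ultimately show "\<exists>f'. Vector_Spaces.linear (*s) (*s) f' \<and> (shear g w v has_derivative f') (at z)"
    by blast
qed

text \<open>As \<open>v\<close> is orthogonal to \<open>w\<close>, the shear preserves
  \<open>hdot z w\<close>, so the shear with \<open>- g\<close> undoes it.\<close>

lemma automorphism_shear:
  assumes g: "\<And>t. \<exists>D. (g has_field_derivative D) (at t)" and vw: "hdot v w = 0"
  shows "automorphism (shear g w v)"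
proof -
  have 1: "shear (\<lambda>t. - g t) w v (shear g w v z) = z" "shear g w v (shear (\<lambda>t. - g t) w v z) = z" for z
    by (simp_all add: shear_def hdot_add hdot_diff hdot_scale vw)
  have "inv (shear g w v) = shear (\<lambda>t. - g t) w v" by (rule inv_equality) (simp_all add: 1)
  moreover have "\<exists>D. ((\<lambda>t. - g t) has_field_derivative D) (at t)" for t
    using g[of t] DERIV_minus by blast
  moreover have "bij (shear g w v)" using 1 by (metis bijI')
  ultimately show ?thesis
    using holo_shear g unfolding biholomorphic_map_def by metis
qed

text \<open>For a polynomial \<open>f\<close>, the following says that the leading form of \<open>f\<close> vanishes at most on the
  hyperplane orthogonal to \<open>u\<close>.\<close>

definition grows_off :: "complex ^ 'n \<Rightarrow> (complex ^ 'n \<Rightarrow> complex) \<Rightarrow> bool" where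
  "grows_off u f \<longleftrightarrow> (\<forall>\<kappa>>0. \<forall>N. \<exists>T. \<forall>x. T \<le> norm x \<and> \<kappa> * norm x \<le> norm (hdot x u) \<longrightarrow> N < norm (f x))"

lemma grows_off_coordinate: "grows_off (axis (i::'n::finite) 1) (\<lambda>z. z $ i)"
  unfolding grows_off_def hdot_axis
proof (intro allI impI)
  fix \<kappa> N :: real assume \<kappa>: "\<kappa> > 0"
  show "\<exists>T. \<forall>x :: complex ^ 'n. T \<le> norm x \<and> \<kappa> * norm x \<le> norm (x $ i) \<longrightarrow> N < norm (x $ i)"
  proof (intro exI[of _ "(\<bar>N\<bar> + 1) / \<kappa>"] allI impI, elim conjE)
    fix x :: "complex ^ 'n" assume "(\<bar>N\<bar> + 1) / \<kappa> \<le> norm x" and x: "\<kappa> * norm x \<le> norm (x $ i)"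
    then have "\<bar>N\<bar> + 1 \<le> \<kappa> * norm x" using \<kappa> by (simp add: pos_divide_le_eq mult.commute)
    with x show "N < norm (x $ i)" by linarith
  qed
qed

text \<open>Once \<open>t *s v\<close> dominates \<open>x\<close>, the sum has norm at most
  \<open>2 * norm t * norm v\<close> and pairing with \<open>u\<close> at least
  \<open>norm t * norm (hdot v u) / 2\<close>. It therefore lies in a fixed cone off the hyperplane
  orthogonal to \<open>u\<close>, and far out, which are the two requirements of
  \<open>grows_off\<close>.\<close>

lemma far_in_direction:
  assumes u: "hdot v u \<noteq> 0" and x1: "norm x \<le> norm t * norm v"
    and x2: "norm x * norm u \<le> norm t * norm (hdot v u) / 2"
  shows "norm (hdot v u) / (4 * norm v) * norm (x + t *s v) \<le> norm (hdot (x + t *s v) u)"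
    "norm t * norm (hdot v u) / 2 \<le> norm (x + t *s v) * norm u"
proof -
  let ?y = "x + t *s v" and ?B = "norm (hdot v u)"
  have v: "norm v > 0" using u by auto
  have "norm (hdot x u) \<le> norm t * ?B / 2" using norm_hdot_le[of x u] x2 by linarith
  moreover have "norm t * ?B \<le> norm (hdot ?y u) + norm (hdot x u)"
    using norm_triangle_ineq4[of "hdot ?y u" "hdot x u"] by (simp add: hdot_add hdot_scale norm_mult)
  ultimately have lower: "norm t * ?B / 2 \<le> norm (hdot ?y u)" by linarith
  then show "norm t * ?B / 2 \<le> norm ?y * norm u" using norm_hdot_le[of ?y u] by linarith
  have "norm ?y \<le> 2 * (norm t * norm v)"
    using norm_triangle_ineq[of x "t *s v"] x1 by (simp add: norm_scale)
  then have "?B / (4 * norm v) * norm ?y \<le> ?B / (4 * norm v) * (2 * (norm t * norm v))"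
    by (intro mult_left_mono) auto
  also have "\<dots> = norm t * ?B / 2" using v by simp
  finally show "?B / (4 * norm v) * norm ?y \<le> norm (hdot ?y u)" using lower by linarith
qed

lemma grows_off_translates:
  assumes f: "grows_off u f" and u: "hdot v u \<noteq> 0"
  shows "\<exists>A. \<forall>z t. norm z \<le> 1 \<and> A \<le> norm t \<longrightarrow> N < norm (f (z + t *s v))"
proof -
  let ?B = "norm (hdot v u)"
  have B: "?B > 0" and v: "norm v > 0" and u0: "norm u > 0"
    using u by auto
  obtain T where T: "\<And>x. T \<le> norm x \<Longrightarrow> ?B / (4 * norm v) * norm x \<le> norm (hdot x u) \<Longrightarrow> N < norm (f x)"
    using f B v unfolding grows_off_def by (metis divide_pos_pos mult_pos_pos zero_less_numeral)
  \<comment> \<open>The three bounds make \<open>t *s v\<close> dominate \<open>z\<close> in norm,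
    dominate it after pairing with \<open>u\<close>, and carry the sum beyond norm
    \<open>T\<close>.\<close>
  define A where "A = max (1 / norm v) (max (2 * norm u / ?B) (2 * T * norm u / ?B))"
  have "N < norm (f (z + t *s v))" if z: "norm z \<le> 1" and t: "A \<le> norm t" for z t
  proof -
    have t1: "1 \<le> norm t * norm v" and t2: "norm u \<le> norm t * ?B / 2" and t3: "T * norm u \<le> norm t * ?B / 2"
      using t v B by (auto simp: A_def pos_divide_le_eq)
    have "norm z * norm u \<le> 1 * norm u" using z by (intro mult_right_mono) auto
    then have x2: "norm z * norm u \<le> norm t * ?B / 2" using t2 by linarith
    have x1: "norm z \<le> norm t * norm v" using z t1 by linarith
    have "T * norm u \<le> norm (z + t *s v) * norm u" using far_in_direction(2)[OF u x1 x2] t3 by linarith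
    then have "T \<le> norm (z + t *s v)" using u0 by simp
    then show ?thesis using T far_in_direction(1)[OF u x1 x2] by blast
  qed
  then show ?thesis by blast
qed

text \<open>In the cone where \<open>hdot x w\<close> is comparable to \<open>norm x\<close>, the
  displacement grows at least quadratically and swamps \<open>x\<close>, so the image of
  \<open>x\<close> lies in the good cone around \<open>v\<close>. The exceptional hyperplane is now
  the one orthogonal to \<open>w\<close>.\<close>

lemma grows_off_shear:
  assumes f: "grows_off u f" and u: "hdot v u \<noteq> 0"
    and c: "c > 0" and g: "\<And>t. T0 \<le> norm t \<Longrightarrow> c * (norm t)\<^sup>2 \<le> norm (g t)"
  shows "grows_off w (\<lambda>z. f (shear g w v z))"
  unfolding grows_off_def
proof (intro allI impI)
  fix \<kappa> N :: real assume \<kappa>: "\<kappa> > 0"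
  let ?B = "norm (hdot v u)"
  have B: "?B > 0" and v: "norm v > 0" and u0: "norm u > 0"
    using u by auto
  obtain T where T: "\<And>x. T \<le> norm x \<Longrightarrow> ?B / (4 * norm v) * norm x \<le> norm (hdot x u) \<Longrightarrow> N < norm (f x)"
    using f B v unfolding grows_off_def by (metis divide_pos_pos mult_pos_pos zero_less_numeral)
  let ?d = "c * \<kappa>\<^sup>2"
  have d: "?d > 0" using c \<kappa> by simp
  define S where "S = max T (max (T0 / \<kappa>) (max (1 / (?d * norm v)) (2 * norm u / (?d * ?B))))"
  show "\<exists>T. \<forall>x. T \<le> norm x \<and> \<kappa> * norm x \<le> norm (hdot x w) \<longrightarrow> N < norm (f (shear g w v x))"
  proof (intro exI[of _ S] allI impI, elim conjE)
    fix x assume x: "S \<le> norm x" and xw: "\<kappa> * norm x \<le> norm (hdot x w)"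
    let ?t = "g (hdot x w)"
    have s: "T \<le> norm x" "T0 \<le> \<kappa> * norm x" "1 \<le> norm x * (?d * norm v)" "2 * norm u \<le> norm x * (?d * ?B)"
      using x \<kappa> d v B by (auto simp: S_def pos_divide_le_eq mult.commute)
    have "(\<kappa> * norm x)\<^sup>2 \<le> (norm (hdot x w))\<^sup>2" using xw \<kappa> by (intro power_mono) auto
    then have "?d * (norm x)\<^sup>2 \<le> c * (norm (hdot x w))\<^sup>2" using c by (simp add: power_mult_distrib)
    also have "\<dots> \<le> norm ?t" using g[of "hdot x w"] s(2) xw by simp
    finally have t: "?d * (norm x)\<^sup>2 \<le> norm ?t" .
    have "norm x * 1 \<le> norm x * (norm x * (?d * norm v))" using s(3) by (intro mult_left_mono) auto
    also have "\<dots> = ?d * (norm x)\<^sup>2 * norm v" by (simp add: power2_eq_square)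
    also have "\<dots> \<le> norm ?t * norm v" using t by (intro mult_right_mono) auto
    finally have x1: "norm x \<le> norm ?t * norm v" by simp
    have "norm x * (2 * norm u) \<le> norm x * (norm x * (?d * ?B))" using s(4) by (intro mult_left_mono) auto
    also have "\<dots> = ?d * (norm x)\<^sup>2 * ?B" by (simp add: power2_eq_square)
    also have "\<dots> \<le> norm ?t * ?B" using t by (intro mult_right_mono) auto
    finally have x2: "norm x * norm u \<le> norm ?t * ?B / 2" by simp
    have "norm x * norm u \<le> norm (shear g w v x) * norm u"
      using far_in_direction(2)[OF u x1 x2] x2 by (simp add: shear_def)
    then have "T \<le> norm (shear g w v x)" using u0 s(1) by simp
    then show "N < norm (f (shear g w v x))"
      using T far_in_direction(1)[OF u x1 x2] by (simp add: shear_def)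
  qed
qed

text \<open>The polynomial is \<open>A ((t + a) / (s + a))\<^sup>m\<close> with \<open>a\<close> and then \<open>m\<close> large: a disc of
  radius \<open>s + a\<close> around \<open>- a\<close> approximates the half-plane \<open>Re t \<le> s\<close>.\<close>

lemma half_plane_peak_polynomial:
  fixes s \<epsilon> A \<delta> :: real
  assumes s: "s > 0" and \<epsilon>: "\<epsilon> > 0" and A: "A > 0" and \<delta>: "\<delta> > 0"
  shows "\<exists>g :: complex \<Rightarrow> complex. (\<forall>t. \<exists>D. (g has_field_derivative D) (at t)) \<and>
    (\<exists>c>0. \<exists>T. \<forall>t. T \<le> norm t \<longrightarrow> c * (norm t)\<^sup>2 \<le> norm (g t)) \<and>
    (\<forall>t. s \<le> Re t \<longrightarrow> A \<le> norm (g t)) \<and>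
    (\<forall>t. norm t \<le> 1 \<and> Re t \<le> s - \<epsilon> \<longrightarrow> norm (g t) < \<delta>)"
proof -
  \<comment> \<open>The term 1/\<epsilon> makes the circle flat enough that points with
    \<open>Re t \<le> s - \<epsilon>\<close> and \<open>\<bar>Im t\<bar> \<le> 1\<close> stay
    strictly inside; the term 1 keeps \<open>Re t + a\<close> nonnegative on the unit disc. The
    ratio \<open>q\<close> is that of the extreme corner.\<close>
  define a where "a = 1 + \<epsilon> + 1 / \<epsilon>"
  have "1 / \<epsilon> > 0" using \<epsilon> by simp
  then have a: "a > 1" "a > \<epsilon>" using \<epsilon> unfolding a_def by linarith+
  define q where "q = sqrt (1 + (a + s - \<epsilon>)\<^sup>2) / (a + s)"
  have sa: "a + s > 0" using a s by linarith
  have "\<epsilon> * (2 * (a + s) - \<epsilon>) > \<epsilon> * (1 / \<epsilon>)"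
    using \<epsilon> s a by (intro mult_strict_left_mono) (auto simp: a_def)
  then have "1 + (a + s - \<epsilon>)\<^sup>2 < (a + s)\<^sup>2" using \<epsilon> by (simp add: power2_eq_square algebra_simps)
  then have "sqrt (1 + (a + s - \<epsilon>)\<^sup>2) < sqrt ((a + s)\<^sup>2)" by (rule real_sqrt_less_mono)
  then have q1: "q < 1" and q0: "q \<ge> 0" using sa by (simp_all add: q_def)
  have "(\<lambda>m. q ^ m) \<longlonglongrightarrow> 0" using q0 q1 by (simp add: LIMSEQ_power_zero)
  then have "\<forall>\<^sub>F m in sequentially. q ^ m < \<delta> / A"
    using \<delta> A by (intro order_tendstoD) auto
  \<comment> \<open>Degree at least 2 provides the quadratic growth needed by
    \<open>grows_off_shear\<close>.\<close>
  then have "\<forall>\<^sub>F m in sequentially. q ^ m < \<delta> / A \<and> 2 \<le> m"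
    by (rule eventually_conj) (rule eventually_ge_at_top)
  then obtain m where m: "q ^ m < \<delta> / A" "2 \<le> m" using eventually_happens'[OF sequentially_bot] by blast
  define C :: complex where "C = of_real (a + s)"
  have C: "norm C = a + s" "C \<noteq> 0" using sa unfolding C_def by (simp_all del: of_real_add)
  define b where "b t = (t + of_real a) / C" for t :: complex
  define g where "g t = of_real A * b t ^ m" for t
  have nb: "norm (b t) = norm (t + of_real a) / (a + s)" for t
    by (simp add: b_def norm_divide C)
  have ng: "norm (g t) = A * norm (b t) ^ m" for t using A by (simp add: g_def norm_mult norm_power)
  have "g holomorphic_on UNIV" unfolding g_def b_def by (intro holomorphic_intros) (rule C(2))
  then have g1: "\<exists>D. (g has_field_derivative D) (at t)" for t
    by (simp add: holomorphic_on_imp_differentiable_at flip: field_differentiable_def)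
  have g2: "A \<le> norm (g t)" if t: "s \<le> Re t" for t
  proof -
    have "Re t + a \<le> norm (t + of_real a)" using complex_Re_le_cmod[of "t + of_real a"] by simp
    then have "a + s \<le> norm (t + of_real a)" using t by linarith
    then have "1 \<le> norm (b t)" using sa by (simp add: nb)
    then have "1 \<le> norm (b t) ^ m" by (rule one_le_power)
    then show ?thesis using A by (simp add: ng)
  qed
  have g3: "norm (g t) < \<delta>" if t: "norm t \<le> 1" "Re t \<le> s - \<epsilon>" for t
  proof -
    have "\<bar>Re t\<bar> \<le> 1" and im: "\<bar>Im t\<bar> \<le> 1"
      using t(1) abs_Re_le_cmod[of t] abs_Im_le_cmod[of t] by linarith+
    then have "0 \<le> Re t + a" "Re t + a \<le> a + s - \<epsilon>" using t a by linarith+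
    then have "(Re t + a)\<^sup>2 \<le> (a + s - \<epsilon>)\<^sup>2" by (intro power_mono)
    moreover have "(Im t)\<^sup>2 \<le> 1" using im by (simp only: abs_square_le_1)
    ultimately have "(Re t + a)\<^sup>2 + (Im t)\<^sup>2 \<le> 1 + (a + s - \<epsilon>)\<^sup>2" by linarith
    then have "norm (t + of_real a) \<le> sqrt (1 + (a + s - \<epsilon>)\<^sup>2)"
      by (simp only: cmod_def plus_complex.sel Re_complex_of_real Im_complex_of_real add_0_right real_sqrt_le_iff)
    then have "norm (b t) \<le> q" unfolding nb q_def using sa by (intro divide_right_mono) auto
    then have "norm (b t) ^ m \<le> q ^ m" by (intro power_mono) auto
    then have "norm (b t) ^ m < \<delta> / A" using m(1) by linarith
    then show "norm (g t) < \<delta>" using A by (simp add: ng pos_less_divide_eq mult.commute)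
  qed
  define c where "c = A * (1 / (2 * (a + s)))\<^sup>2"
  have c: "c > 0" using A sa by (simp add: c_def)
  have g4: "c * (norm t)\<^sup>2 \<le> norm (g t)" if t: "2 * a + s \<le> norm t" for t
  proof -
    have 1: "norm t - a \<le> norm (t + of_real a)"
      using norm_triangle_ineq4[of "t + of_real a" "of_real a"] a by simp
    then have "a + s \<le> norm (t + of_real a)" using t by linarith
    then have "1 \<le> norm (b t)" using sa by (simp add: nb)
    then have 2: "norm (b t) ^ 2 \<le> norm (b t) ^ m" using m(2) by (intro power_increasing) auto
    have "norm t / 2 \<le> norm (t + of_real a)" using 1 t s by linarith
    then have "norm t / 2 / (a + s) \<le> norm (b t)" unfolding nb using sa by (intro divide_right_mono) auto
    then have "(norm t / 2 / (a + s))\<^sup>2 \<le> norm (b t) ^ 2" using sa by (intro power_mono) auto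
    then have "A * (norm t / 2 / (a + s))\<^sup>2 \<le> A * norm (b t) ^ m" using A 2 by (intro mult_left_mono) auto
    moreover have "A * (norm t / 2 / (a + s))\<^sup>2 = c * (norm t)\<^sup>2" by (simp add: c_def power_mult_distrib power_divide)
    ultimately show ?thesis by (simp add: ng)
  qed
  show ?thesis using g1 g2 g3 g4 c by (intro exI[of _ g]) blast
qed

text \<open>The Gram-Schmidt remainder of \<open>u\<close> modulo \<open>w\<close> works, since
  pairing it with \<open>u\<close> is pairing it with itself.\<close>

lemma exists_orthogonal_nonorthogonal:
  assumes "w \<noteq> 0" "\<And>c. u \<noteq> c *s w"
  shows "\<exists>v. hdot v w = 0 \<and> hdot v u \<noteq> 0"
proof -
  define c where "c = hdot u w / hdot w w"
  define v where "v = u - c *s w"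
  have "hdot w w \<noteq> 0" using assms(1) by (simp add: hdot_self)
  then have vw: "hdot v w = 0" by (simp add: v_def c_def hdot_diff hdot_scale)
  have "hdot v u = hdot v v + cnj c * hdot v w"
    by (simp add: hdot_def v_def sum_distrib_left algebra_simps flip: sum.distrib)
  moreover have "v \<noteq> 0" using assms(2)[of c] by (simp add: v_def)
  ultimately show ?thesis using vw by (intro exI[of _ v]) (simp add: hdot_self)
qed

text \<open>The invariant of the iteration. The vector \<open>u\<close> stands for the hyperplane on
  which the leading form of coordinate \<open>i\<close> may vanish, which is all that the next shear
  has to know about \<open>F\<close>.\<close>

definition admissible :: "'n::finite \<Rightarrow> (complex ^ 'n \<Rightarrow> complex ^ 'n) \<Rightarrow> complex ^ 'n \<Rightarrow> bool" where
  "admissible i F u \<longleftrightarrow> automorphism F \<and> u \<noteq> 0 \<and> grows_off u (\<lambda>z. F z $ i)"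

text \<open>The shear is applied before \<open>F\<close>: where it is nearly the identity, uniform
  continuity of \<open>F\<close> keeps the change small, and in the half-space it sends points so
  far along \<open>v\<close> that coordinate \<open>i\<close> of \<open>F\<close> is large.\<close>

lemma push_half_space_independent:
  assumes F: "admissible i F u" and w: "norm w = 1" and uw: "\<And>c. u \<noteq> c *s w"
    and s: "s > 0" and \<epsilon>: "\<epsilon> > 0" and \<delta>: "\<delta> > 0"
  shows "\<exists>F'. admissible i F' w \<and>
    (\<forall>z. norm z \<le> 1 \<and> z \<bullet> w \<le> s - \<epsilon> \<longrightarrow> dist (F' z) (F z) < \<delta>) \<and>
    (\<forall>z. norm z \<le> 1 \<and> s \<le> z \<bullet> w \<longrightarrow> N < norm (F' z $ i))"
proof -
  have w0: "w \<noteq> 0" using w by auto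
  obtain v where vw: "hdot v w = 0" and vu: "hdot v u \<noteq> 0"
    using exists_orthogonal_nonorthogonal[OF w0 uw] by blast
  have v0: "norm v > 0" using vu by auto
  have aut: "automorphism F" and gr: "grows_off u (\<lambda>z. F z $ i)" using F by (auto simp: admissible_def)
  obtain A0 where A0: "\<forall>z t. norm z \<le> 1 \<and> A0 \<le> norm t \<longrightarrow> N < norm (F (z + t *s v) $ i)"
    using grows_off_translates[OF gr vu] by blast
  define A where "A = max A0 1"
  have A: "A > 0" "A0 \<le> A" by (auto simp: A_def)
  \<comment> \<open>Radius 2 suffices because \<open>\<eta> * norm v \<le> 1\<close>, so the
    slightly moved points of the unit ball stay there.\<close>
  have "continuous_on (cball 0 2) F"
    using aut holomorphic_map_continuous continuous_on_subset unfolding biholomorphic_map_def by blast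
  then have "uniformly_continuous_on (cball 0 2) F" by (rule compact_uniformly_continuous) simp
  then obtain d where d: "d > 0" "\<And>x y. x \<in> cball 0 2 \<Longrightarrow> y \<in> cball 0 2 \<Longrightarrow> dist y x < d \<Longrightarrow> dist (F y) (F x) < \<delta>"
    unfolding uniformly_continuous_on_def using \<delta> by metis
  define \<eta> where "\<eta> = min d 1 / norm v"
  have \<eta>: "\<eta> > 0" using d(1) v0 by (simp add: \<eta>_def)
  obtain g :: "complex \<Rightarrow> complex" and c T where g: "\<And>t. \<exists>D. (g has_field_derivative D) (at t)"
      "c > 0" "\<And>t. T \<le> norm t \<Longrightarrow> c * (norm t)\<^sup>2 \<le> norm (g t)"
      "\<And>t. s \<le> Re t \<Longrightarrow> A \<le> norm (g t)" "\<And>t. norm t \<le> 1 \<Longrightarrow> Re t \<le> s - \<epsilon> \<Longrightarrow> norm (g t) < \<eta>"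
    using half_plane_peak_polynomial[OF s \<epsilon> A(1) \<eta>] by blast
  let ?F = "F \<circ> shear g w v"
  show ?thesis
  proof (intro exI[of _ ?F] conjI allI impI)
    show "admissible i ?F w"
      unfolding admissible_def o_def
      using automorphism_comp[OF aut automorphism_shear[OF g(1) vw]] w0
        grows_off_shear[OF gr vu g(2,3)] by (simp add: o_def)
  next
    fix z assume z: "norm z \<le> 1 \<and> z \<bullet> w \<le> s - \<epsilon>"
    have "norm (hdot z w) \<le> 1" using norm_hdot_le[of z w] w z by simp
    then have "norm (g (hdot z w)) < \<eta>" using g(5) z by (simp add: Re_hdot)
    then have "norm (g (hdot z w) *s v) < min d 1"
      using v0 by (simp only: \<eta>_def norm_scale pos_less_divide_eq)
    then have "dist (shear g w v z) z < d" "norm (shear g w v z) \<le> 2"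
      using z norm_triangle_ineq[of z "g (hdot z w) *s v"] by (auto simp: shear_def dist_norm)
    then show "dist (?F z) (F z) < \<delta>" using d(2)[of z "shear g w v z"] z by simp
  next
    fix z assume z: "norm z \<le> 1 \<and> s \<le> z \<bullet> w"
    then have "A0 \<le> norm (g (hdot z w))" using g(4)[of "hdot z w"] A by (simp add: Re_hdot)
    then show "N < norm (?F z $ i)" using A0 z by (simp add: shear_def)
  qed
qed

text \<open>If \<open>u\<close> is a multiple of \<open>w\<close>, every \<open>v\<close> orthogonal
  to \<open>w\<close> is also orthogonal to \<open>u\<close>. A preliminary shear replaces
  \<open>u\<close> by a coordinate vector that is not a multiple of \<open>w\<close>.\<close>

lemma push_half_space:
  fixes w :: "complex ^ 'n::finite"
  assumes F: "admissible i F u" and w: "norm w = 1" and n: "CARD('n) > 1"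
    and s: "s > 0" and \<epsilon>: "\<epsilon> > 0" and \<delta>: "\<delta> > 0"
  shows "\<exists>F'. admissible i F' w \<and>
    (\<forall>z. norm z \<le> 1 \<and> z \<bullet> w \<le> s - \<epsilon> \<longrightarrow> dist (F' z) (F z) < \<delta>) \<and>
    (\<forall>z. norm z \<le> 1 \<and> s \<le> z \<bullet> w \<longrightarrow> N < norm (F' z $ i))"
proof (cases "\<exists>c. u = c *s w")
  case False
  then show ?thesis using push_half_space_independent[OF F w _ s \<epsilon> \<delta>] by blast
next
  case True
  then obtain c where c: "u = c *s w" by blast
  have "u \<noteq> 0" using F by (simp add: admissible_def)
  then have c0: "c \<noteq> 0" using c by auto
  have "\<exists>k. \<forall>d. axis k 1 \<noteq> d *s w"
  proof (rule ccontr)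
    assume "\<not> ?thesis"
    then have ax: "\<And>k. \<exists>d. axis k 1 = d *s w" by blast
    obtain p q :: 'n where pq: "p \<noteq> q"
      using n card_le_Suc0_iff_eq[of "UNIV :: 'n set"] by auto
    obtain d e where "axis p 1 = d *s w" "axis q 1 = e *s w" using ax by blast
    then have "axis p 1 $ p = d * w $ p" "axis p 1 $ q = d * w $ q" "axis q 1 $ q = e * w $ q"
      by (simp_all only: vector_smult_component)
    then have "(1::complex) = d * w $ p" "0 = d * w $ q" "1 = e * w $ q"
      using pq by (simp_all add: axis_def)
    then show False by auto
  qed
  then obtain k where k: "\<And>d. axis k 1 \<noteq> d *s w" by blast
  let ?w = "axis k 1 :: complex ^ 'n"
  have kn: "norm ?w = 1" by simp
  have "u \<noteq> d *s ?w" for d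
  proof
    assume *: "u = d *s ?w"
    then have "d \<noteq> 0" using \<open>u \<noteq> 0\<close> by auto
    have "?w = inverse d *s u" using \<open>d \<noteq> 0\<close> by (simp add: *)
    then have "?w = (inverse d * c) *s w" by (simp add: c)
    then show False using k by blast
  qed
  \<comment> \<open>With threshold 2 and margin 1 the whole unit ball lies on the quiet side, so
    this step only exchanges the leading vector.\<close>
  from push_half_space_independent[OF F kn this, of 2 1 "\<delta>/2" 0]
  have "\<exists>F'. admissible i F' ?w \<and> (\<forall>z. norm z \<le> 1 \<and> z \<bullet> ?w \<le> 2 - 1 \<longrightarrow> dist (F' z) (F z) < \<delta>/2)"
    using \<delta> by force
  then obtain G where G: "admissible i G ?w" and
      "\<forall>z. norm z \<le> 1 \<and> z \<bullet> ?w \<le> 2 - 1 \<longrightarrow> dist (G z) (F z) < \<delta>/2" by blast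
  then have GF: "dist (G z) (F z) < \<delta>/2" if "norm z \<le> 1" for z
    using that norm_cauchy_schwarz[of z ?w] kn by simp
  obtain F' where F': "admissible i F' w" 
      "\<forall>z. norm z \<le> 1 \<and> z \<bullet> w \<le> s - \<epsilon> \<longrightarrow> dist (F' z) (G z) < \<delta>/2"
      "\<forall>z. norm z \<le> 1 \<and> s \<le> z \<bullet> w \<longrightarrow> N < norm (F' z $ i)"
    using push_half_space_independent[OF G w k s \<epsilon> half_gt_zero[OF \<delta>], of N] by blast
  have "dist (F' z) (F z) < \<delta>" if "norm z \<le> 1" "z \<bullet> w \<le> s - \<epsilon>" for z
    using F'(2)[rule_format, of z] GF[of z] that dist_triangle[of "F' z" "F z" "G z"] by auto
  then show ?thesis using F' by blast
qed

text \<open>Caps are pushed one at a time. By \<open>sep\<close>, the caps treated earlier lie on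
  the quiet side of the new half-space, so their large values survive up to an error of 1.\<close>

lemma push_layer:
  fixes X :: "(complex ^ 'n::finite) set"
  assumes n: "CARD('n) > 1" and X: "finite X" "\<And>x. x \<in> X \<Longrightarrow> norm x = 1"
    and s: "\<rho> < s" "0 < s" and r: "r \<le> 1" "\<rho> \<le> 1" and \<epsilon>: "\<epsilon> > 0"
    and sep: "\<And>x y z. x \<in> X \<Longrightarrow> y \<in> X \<Longrightarrow> x \<noteq> y \<Longrightarrow> norm z \<le> r \<Longrightarrow> s \<le> z \<bullet> y \<Longrightarrow> z \<bullet> x \<le> s - \<epsilon>"
    and F: "admissible i F u" and \<delta>: "\<delta> > 0"
  shows "\<exists>F' u'. admissible i F' u' \<and> (\<forall>z. norm z \<le> \<rho> \<longrightarrow> dist (F' z) (F z) < \<delta>) \<and>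
    (\<forall>x\<in>X. \<forall>z. norm z \<le> r \<and> s \<le> z \<bullet> x \<longrightarrow> N < norm (F' z $ i))"
  using X sep \<delta>
proof (induction X arbitrary: \<delta> N rule: finite_induct)
  case empty
  then show ?case using F by auto
next
  case (insert x X)
  have x1: "norm x = 1" using insert.prems by simp
  \<comment> \<open>One margin for two purposes: both the ball of radius \<rho> and the other caps
    of the layer must lie on the quiet side.\<close>
  define \<epsilon>' where "\<epsilon>' = min \<epsilon> (s - \<rho>)"
  have \<epsilon>': "\<epsilon>' > 0" "\<epsilon>' \<le> \<epsilon>" "\<epsilon>' \<le> s - \<rho>" using \<epsilon> s by (auto simp: \<epsilon>'_def)
  \<comment> \<open>The earlier caps are pushed beyond \<open>N + 1\<close>, in reserve for the
    error below 1 of the last push.\<close>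
  have "\<exists>F' u'. admissible i F' u' \<and> (\<forall>z. norm z \<le> \<rho> \<longrightarrow> dist (F' z) (F z) < \<delta>/2) \<and>
    (\<forall>x\<in>X. \<forall>z. norm z \<le> r \<and> s \<le> z \<bullet> x \<longrightarrow> N + 1 < norm (F' z $ i))"
    by (rule insert.IH) (use insert.prems in auto)
  then obtain G u' where G: "admissible i G u'" "\<forall>z. norm z \<le> \<rho> \<longrightarrow> dist (G z) (F z) < \<delta>/2"
    "\<forall>x\<in>X. \<forall>z. norm z \<le> r \<and> s \<le> z \<bullet> x \<longrightarrow> N + 1 < norm (G z $ i)" by blast
  have "min 1 (\<delta>/2) > 0" using insert.prems by simp
  from push_half_space[OF G(1) x1 n s(2) \<epsilon>'(1) this, of N]
  obtain F' where F': "admissible i F' x"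
     "\<forall>z. norm z \<le> 1 \<and> z \<bullet> x \<le> s - \<epsilon>' \<longrightarrow> dist (F' z) (G z) < min 1 (\<delta>/2)"
     "\<forall>z. norm z \<le> 1 \<and> s \<le> z \<bullet> x \<longrightarrow> N < norm (F' z $ i)" by blast
  have "dist (F' z) (F z) < \<delta>" if z: "norm z \<le> \<rho>" for z
  proof -
    have "z \<bullet> x \<le> s - \<epsilon>'" using norm_cauchy_schwarz[of z x] x1 z \<epsilon>'(3) by simp
    then have "dist (F' z) (G z) < \<delta>/2" using F'(2)[rule_format, of z] z r by simp
    moreover have "dist (G z) (F z) < \<delta>/2" using G(2) z by blast
    ultimately show ?thesis using dist_triangle[of "F' z" "F z" "G z"] by linarith
  qed
  moreover have "N < norm (F' z $ i)" if y: "y \<in> insert x X" and z: "norm z \<le> r" "s \<le> z \<bullet> y" for y z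
  proof (cases "y = x")
    case True
    then show ?thesis using F'(3) z r by auto
  next
    case False
    then have yX: "y \<in> X" using y by simp
    have "z \<bullet> x \<le> s - \<epsilon>" using insert.prems(2)[of x y z] yX False z by simp
    then have "dist (F' z) (G z) < 1" using F'(2)[rule_format, of z] z r \<epsilon>' by simp
    then have "norm (F' z $ i - G z $ i) < 1"
      using Finite_Cartesian_Product.norm_nth_le[of "F' z - G z" i] by (simp add: dist_norm)
    moreover have "N + 1 < norm (G z $ i)" using G(3) yX z by blast
    ultimately show ?thesis using norm_triangle_ineq3[of "G z $ i" "F' z $ i"] by (simp add: norm_minus_commute)
  qed
  ultimately show ?case using F'(1) by blast
qed

section \<open>Limits of automorphisms\<close>

lemma eventually_half_power_less:
  fixes c e :: real assumes "e > 0" shows "\<forall>\<^sub>F n in sequentially. c * (1/2) ^ n < e"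
proof -
  have "(\<lambda>n. c * (1/2::real) ^ n) \<longlonglongrightarrow> c * 0"
    by (intro tendsto_intros LIMSEQ_power_zero) simp
  then show ?thesis using assms by (intro order_tendstoD(2)[where y = "c * 0"]) simp_all
qed

lemma geometric_convergence:
  fixes a :: "nat \<Rightarrow> 'a::complete_space"
  assumes a: "\<And>n. m \<le> n \<Longrightarrow> dist (a (Suc n)) (a n) \<le> C * (1/2) ^ n"
  shows "\<exists>l. a \<longlonglongrightarrow> l \<and> (\<forall>n\<ge>m. dist (a n) l \<le> 2 * C * (1/2) ^ n)"
proof -
  \<comment> \<open>The subtracted \<open>(1/2) ^ p\<close> lets the induction close; it is dropped
    afterwards.\<close>
  have step: "dist (a p) (a n) \<le> 2 * C * ((1/2) ^ n - (1/2) ^ p)" if "m \<le> n" "n \<le> p" for n p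
    using that(2)
  proof (induction p rule: dec_induct)
    case (step p)
    have "dist (a (Suc p)) (a n) \<le> dist (a (Suc p)) (a p) + dist (a p) (a n)" by (rule dist_triangle)
    also have "\<dots> \<le> C * (1/2) ^ p + 2 * C * ((1/2) ^ n - (1/2) ^ p)"
      using a[of p] step that(1) by (intro add_mono) auto
    also have "\<dots> = 2 * C * ((1/2) ^ n - (1/2) ^ Suc p)" by (simp add: algebra_simps)
    finally show ?case .
  qed simp
  have "0 \<le> C * (1/2) ^ m" using order_trans[OF zero_le_dist a[of m]] by simp
  then have C: "C \<ge> 0" using zero_less_power[of "1/2::real" m] by (simp add: zero_le_mult_iff not_le[symmetric])
  have le: "dist (a p) (a n) \<le> 2 * C * (1/2) ^ n" if "m \<le> n" "n \<le> p" for n p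
  proof -
    have "2 * C * ((1/2) ^ n - (1/2) ^ p) \<le> 2 * C * (1/2) ^ n" using C by (intro mult_left_mono) auto
    then show ?thesis using step[OF that] by linarith
  qed
  have "Cauchy a"
  proof (rule metric_CauchyI)
    fix e :: real assume "e > 0"
    then have "\<forall>\<^sub>F n in sequentially. 4 * C * (1/2::real) ^ n < e \<and> m \<le> n"
      using eventually_half_power_less eventually_ge_at_top by (intro eventually_conj)
    then obtain n where n: "4 * C * (1/2::real) ^ n < e" "m \<le> n"
      using eventually_happens'[OF sequentially_bot] by blast
    have "dist (a p) (a q) < e" if "n \<le> p" "n \<le> q" for p q
      using le[OF n(2) that(1)] le[OF n(2) that(2)] dist_triangle2[of "a p" "a q" "a n"] n(1) by linarith
    then show "\<exists>M. \<forall>p\<ge>M. \<forall>q\<ge>M. dist (a p) (a q) < e" by blast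
  qed
  then obtain l where l: "a \<longlonglongrightarrow> l" using convergent_eq_Cauchy by blast
  have "dist (a n) l \<le> 2 * C * (1/2) ^ n" if "m \<le> n" for n
  proof (rule tendsto_upperbound)
    show "(\<lambda>p. dist (a n) (a p)) \<longlonglongrightarrow> dist (a n) l" by (intro tendsto_intros l)
    show "\<forall>\<^sub>F p in sequentially. dist (a n) (a p) \<le> 2 * C * (1/2) ^ n"
      using le[OF that] by (auto simp: eventually_sequentially dist_commute)
  qed simp
  with l show ?thesis by blast
qed

text \<open>Cauchy's estimate in the margin \<open>R' - R\<close> transfers the geometric decay from
  the maps to their derivatives. These converge uniformly on the smaller ball, and complex linearity
  passes to the limit.\<close>

lemma holo_geometric_limit:
  fixes F :: "nat \<Rightarrow> complex ^ 'n::finite \<Rightarrow> complex ^ 'n"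
  assumes F: "\<And>n. holo (F n) UNIV" and R: "0 < R" "R < R'"
    and E: "\<And>n z. m \<le> n \<Longrightarrow> norm z \<le> R' \<Longrightarrow> dist (F (Suc n) z) (F n z) \<le> (1/2) ^ n"
    and lim: "\<And>z. norm z < R \<Longrightarrow> (\<lambda>n. F n z) \<longlonglongrightarrow> \<Phi> z"
  shows "holo \<Phi> (ball 0 R)"
proof -
  have "\<forall>n z. \<exists>F'. Vector_Spaces.linear (*s) (*s) F' \<and> (F n has_derivative F') (at z)"
    using F unfolding holomorphic_map_def by blast
  then obtain D where D: "\<And>n z. Vector_Spaces.linear (*s) (*s) (D n z)" "\<And>n z. (F n has_derivative D n z) (at z)"
    by metis
  have DE: "norm (D (Suc n) z h - D n z h) \<le> (1 / (R' - R) * norm h) * (1/2) ^ n"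
    if "m \<le> n" "norm z < R" for n z h
  proof -
    have "norm (D (Suc n) z h - D n z h) \<le> (1/2) ^ n / (R' - R) * norm h"
    proof (rule holo_derivative_bound)
      show "holo (\<lambda>z. F (Suc n) z - F n z) UNIV" by (intro holo_diff F)
      show "((\<lambda>z. F (Suc n) z - F n z) has_derivative (\<lambda>h. D (Suc n) z h - D n z h)) (at z)"
        by (intro has_derivative_diff D)
      fix x assume "x \<in> cball z (R' - R)"
      then have "norm x \<le> R'" using that norm_triangle_ineq2[of x z] by (simp add: dist_norm norm_minus_commute)
      then show "norm (F (Suc n) x - F n x) \<le> (1/2) ^ n" using E that by (simp add: dist_norm)
    qed (use R in auto)
    then show ?thesis by (simp add: mult.commute)
  qed
  have "\<exists>l. (\<lambda>n. D n z h) \<longlonglongrightarrow> l \<and> (\<forall>n\<ge>m. dist (D n z h) l \<le> 2 * (1 / (R' - R) * norm h) * (1/2) ^ n)"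
    if "norm z < R" for z h
    by (rule geometric_convergence) (use DE that in \<open>simp add: dist_norm\<close>)
  then obtain L where L: "\<And>z h. norm z < R \<Longrightarrow> (\<lambda>n. D n z h) \<longlonglongrightarrow> L z h"
      "\<And>z h n. norm z < R \<Longrightarrow> m \<le> n \<Longrightarrow> dist (D n z h) (L z h) \<le> 2 * (1 / (R' - R) * norm h) * (1/2) ^ n"
    by metis
  have "\<exists>g. \<forall>z\<in>ball 0 R. (\<lambda>n. F n z) \<longlonglongrightarrow> g z \<and> (g has_derivative L z) (at z within ball 0 R)"
  proof (rule has_derivative_sequence)
    show "(F n has_derivative D n z) (at z within ball 0 R)" for n z
      using D(2) has_derivative_at_withinI by blast
    fix e :: real assume e: "e > 0"
    then have "\<forall>\<^sub>F n in sequentially. 2 / (R' - R) * (1/2::real) ^ n < e \<and> m \<le> n"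
      using eventually_half_power_less eventually_ge_at_top by (intro eventually_conj)
    then show "\<forall>\<^sub>F n in sequentially. \<forall>z\<in>ball 0 R. \<forall>h. norm (D n z h - L z h) \<le> e * norm h"
    proof (rule eventually_mono, intro ballI allI)
      fix n z h assume n: "2 / (R' - R) * (1/2::real) ^ n < e \<and> m \<le> n" and z: "z \<in> ball (0 :: complex ^ 'n) R"
      have "norm (D n z h - L z h) \<le> 2 * (1 / (R' - R) * norm h) * (1/2) ^ n"
        using L(2)[of z n h] n z by (simp add: dist_norm)
      also have "\<dots> = (2 / (R' - R) * (1/2) ^ n) * norm h" by simp
      also have "\<dots> \<le> e * norm h" using n by (intro mult_right_mono) auto
      finally show "norm (D n z h - L z h) \<le> e * norm h" .
    qed
  next
    show "(0 :: complex ^ 'n) \<in> ball 0 R" using R by simp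
    show "(\<lambda>n. F n 0) \<longlonglongrightarrow> \<Phi> 0" using lim R by simp
  qed simp
  then obtain g where g: "\<And>z. z \<in> ball 0 R \<Longrightarrow> (\<lambda>n. F n z) \<longlonglongrightarrow> g z"
      "\<And>z. z \<in> ball 0 R \<Longrightarrow> (g has_derivative L z) (at z within ball 0 R)" by blast
  have eq: "\<Phi> z = g z" if "z \<in> ball 0 R" for z
    using lim[of z] g(1)[OF that] that LIMSEQ_unique by auto
  show ?thesis
    unfolding holomorphic_map_def
  proof
    fix z :: "complex ^ 'n" assume z: "z \<in> ball 0 R"
    then have "(\<Phi> has_derivative L z) (at z within ball 0 R)"
      using has_derivative_transform[OF z eq g(2)[OF z]] by simp
    then have "(\<Phi> has_derivative L z) (at z)" using at_within_open[OF z open_ball] by simp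
    moreover have "Vector_Spaces.linear (*s) (*s) (L z)"
      unfolding clinear_iff
    proof (intro conjI allI)
      have zR: "norm z < R" using z by simp
      fix x y c
      have "(\<lambda>n. D n z (x + y)) = (\<lambda>n. D n z x + D n z y)" using D(1) unfolding clinear_iff by blast
      then show "L z (x + y) = L z x + L z y"
        using L(1)[OF zR, of "x + y"] tendsto_add[OF L(1)[OF zR, of x] L(1)[OF zR, of y]] LIMSEQ_unique by simp
      have "(\<lambda>n. D n z (c *s x)) = (\<lambda>n. c *s D n z x)" using D(1) unfolding clinear_iff by blast
      moreover have "(\<lambda>n. c *s D n z x) \<longlonglongrightarrow> c *s L z x"
        by (rule vec_tendstoI) (auto intro!: tendsto_intros tendsto_vec_nth L(1)[OF zR])
      ultimately show "L z (c *s x) = c *s L z x"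
        using L(1)[OF zR, of "c *s x"] LIMSEQ_unique by simp
    qed
    ultimately show "\<exists>f'. Vector_Spaces.linear (*s) (*s) f' \<and> (\<Phi> has_derivative f') (at z)" by blast
  qed
qed

text \<open>A lower bound for \<open>F\<close> is an upper Lipschitz bound for its inverse. The
  latter follows from boundedness of the inverse on a ball exceeding the image of the unit ball by
  1.\<close>

lemma automorphism_lower_Lipschitz:
  assumes F: "automorphism F"
  shows "\<exists>m>0. \<forall>x\<in>cball 0 1. \<forall>y\<in>cball 0 1. m * dist x y \<le> dist (F x) (F y)"
proof -
  have hF: "holo F UNIV" and hG: "holo (inv F) UNIV" and inj: "inj F"
    using F by (auto simp: biholomorphic_map_def bij_is_inj)
  have "compact (F ` cball 0 1)"
    using holomorphic_map_continuous[OF hF] continuous_on_subset by (intro compact_continuous_image) auto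
  then obtain R where R: "\<And>x. x \<in> cball 0 1 \<Longrightarrow> norm (F x) \<le> R"
    using compact_imp_bounded bounded_iff by (metis imageI)
  have "compact (inv F ` cball 0 (R + 1))"
    using holomorphic_map_continuous[OF hG] continuous_on_subset by (intro compact_continuous_image) auto
  then obtain M where M: "M > 0" "\<And>x. x \<in> cball 0 (R + 1) \<Longrightarrow> norm (inv F x) \<le> M"
    using compact_imp_bounded bounded_pos by (metis imageI)
  have "(1 / M) * dist x y \<le> dist (F x) (F y)" if "x \<in> cball 0 1" "y \<in> cball 0 1" for x y
  proof -
    have "norm (inv F (F x) - inv F (F y)) \<le> M / (R + 1 - R) * norm (F x - F y)"
      by (rule holo_Lipschitz[OF hG]) (use M R that in auto)
    then show ?thesis using M(1) inj by (simp add: dist_norm pos_divide_le_eq mult.commute)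
  qed
  then show ?thesis using M(1) by (intro exI[of _ "1 / M"]) auto
qed

text \<open>The frontier of the open image of \<open>ball y r\<close> lies in the image of the
  sphere, hence outside \<open>ball (F y) \<mu>\<close>. A connected set that meets the image but
  not its frontier is contained in it.\<close>

lemma automorphism_covers_ball:
  fixes F :: "complex ^ 'n::finite \<Rightarrow> complex ^ 'n"
  assumes F: "automorphism F" and r: "r > 0"
    and low: "\<And>x. dist y x = r \<Longrightarrow> \<mu> \<le> dist (F y) (F x)"
  shows "ball (F y) \<mu> \<subseteq> F ` ball y r"
proof (cases "\<mu> > 0")
  case True
  have cont: "continuous_on UNIV F" and inj: "inj F"
    using F by (auto simp: biholomorphic_map_def bij_is_inj holomorphic_map_continuous)
  have op: "open (F ` ball y r)"
    using invariance_of_domain[of "ball y r" F] cont inj continuous_on_subset inj_on_subset by blast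
  show ?thesis
  proof (rule ccontr)
    assume "\<not> ?thesis"
    then have "ball (F y) \<mu> - F ` ball y r \<noteq> {}" by blast
    moreover have "F y \<in> ball (F y) \<mu> \<inter> F ` ball y r" using True r by simp
    then have "ball (F y) \<mu> \<inter> F ` ball y r \<noteq> {}" by blast
    ultimately have "ball (F y) \<mu> \<inter> frontier (F ` ball y r) \<noteq> {}"
      by (intro connected_Int_frontier) auto
    then obtain p where p: "p \<in> ball (F y) \<mu>" "p \<in> closure (F ` ball y r)" "p \<notin> F ` ball y r"
      using op by (auto simp: frontier_def interior_open)
    have "closed (F ` cball y r)"
      using cont continuous_on_subset by (intro compact_imp_closed compact_continuous_image) auto
    then have "closure (F ` ball y r) \<subseteq> F ` cball y r" by (intro closure_minimal image_mono) auto
    then obtain x where "x \<in> cball y r" "p = F x" using p(2) by blast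
    moreover from this have "x \<notin> ball y r" using p(3) by blast
    ultimately show False using low[of x] p(1) by simp
  qed
qed (auto dest: order.strict_trans1[OF zero_le_dist])


text \<open>In the tolerance, the gap absorbs the denominator of Cauchy's estimate,
  \<open>m k\<close> makes the change of increments small against the lower Lipschitz constant, and
  the cap at 1 with the powers of 1/2 gives convergence. As \<open>m k\<close> must be known before
  the next map is chosen, the choice is of pairs.\<close>

lemma exists_automorphism_sequence:
  fixes i :: "'n::finite" and X :: "nat \<Rightarrow> (complex ^ 'n) set"
  assumes n: "CARD('n) > 1"
    and L: "\<forall>k. finite (X k) \<and> X k \<subseteq> sphere 0 1 \<and> layer_radius k < s k \<and> 0 < \<epsilon> k \<and>
       (\<forall>x\<in>X k. \<forall>y\<in>X k. \<forall>z. x \<noteq> y \<and> norm z \<le> layer_radius (Suc k) \<and> s k \<le> z \<bullet> y \<longrightarrow>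
          z \<bullet> x \<le> s k - \<epsilon> k)"
  shows "\<exists>F m. \<forall>k. automorphism (F k) \<and> 0 < m k \<and>
    (\<forall>x\<in>cball 0 1. \<forall>y\<in>cball 0 1. m k * dist x y \<le> dist (F k x) (F k y)) \<and> m (Suc k) \<le> m k \<and>
    (\<forall>z. norm z \<le> layer_radius k \<longrightarrow>
       dist (F (Suc k) z) (F k z) \<le> (1/2) ^ (k + 2) * (min 1 (m k) * (layer_radius (Suc k) - layer_radius k))) \<and>
    (\<forall>x\<in>X k. \<forall>z. norm z \<le> layer_radius (Suc k) \<and> s k \<le> z \<bullet> x \<longrightarrow> real k < norm (F (Suc k) z $ i))"
proof -
  have X: "\<And>k. finite (X k)" "\<And>k x. x \<in> X k \<Longrightarrow> norm x = 1"
    and s: "\<And>k. layer_radius k < s k" and \<epsilon>: "\<And>k. \<epsilon> k > 0"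
    and sep: "\<And>k x y z. x \<in> X k \<Longrightarrow> y \<in> X k \<Longrightarrow> x \<noteq> y \<Longrightarrow> norm z \<le> layer_radius (Suc k) \<Longrightarrow> s k \<le> z \<bullet> y \<Longrightarrow>
       z \<bullet> x \<le> s k - \<epsilon> k"
    using L by (auto simp: subset_iff)
  let ?low = "\<lambda>F m. \<forall>x\<in>cball 0 1. \<forall>y\<in>cball 0 1. m * dist x y \<le> dist (F x) (F y)"
  define P where "P t \<longleftrightarrow> (\<exists>u. admissible i (fst t) u) \<and> 0 < snd t \<and> ?low (fst t) (snd t)"
    for t :: "(complex ^ 'n \<Rightarrow> complex ^ 'n) \<times> real"
  define Q where "Q k t t' \<longleftrightarrow> snd t' \<le> snd t \<and>
    (\<forall>z. norm z \<le> layer_radius k \<longrightarrow>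
       dist (fst t' z) (fst t z) \<le> (1/2) ^ (k + 2) * (min 1 (snd t) * (layer_radius (Suc k) - layer_radius k))) \<and>
    (\<forall>x\<in>X k. \<forall>z. norm z \<le> layer_radius (Suc k) \<and> s k \<le> z \<bullet> x \<longrightarrow> real k < norm (fst t' z $ i))"
    for k and t t' :: "(complex ^ 'n \<Rightarrow> complex ^ 'n) \<times> real"
  have "\<exists>f. \<forall>k. P (f k) \<and> Q k (f k) (f (Suc k))"
  proof (rule dependent_nat_choice)
    have id: "automorphism (\<lambda>z :: complex ^ 'n. z)"
    proof -
      \<comment> \<open>The sequence starts at the identity, seen as a trivial shear, with Lipschitz
        constant 1.\<close>
      have "automorphism (shear (\<lambda>t. 0) 0 (0 :: complex ^ 'n))"
        by (rule automorphism_shear) (auto intro!: exI[of _ 0])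
      then show ?thesis by (simp add: shear_def[abs_def])
    qed
    have "admissible i (\<lambda>z. z) (axis i 1)"
      using id grows_off_coordinate by (simp add: admissible_def axis_eq_0_iff)
    then have "P (\<lambda>z. z, 1)" by (auto simp: P_def)
    then show "\<exists>t. P t" by blast
  next
    fix t k assume "P t"
    then obtain u where u: "admissible i (fst t) u" and m: "0 < snd t" by (auto simp: P_def)
    let ?\<delta> = "(1/2) ^ (k + 2) * (min 1 (snd t) * (layer_radius (Suc k) - layer_radius k))"
    have gap: "layer_radius k < layer_radius (Suc k)" by (simp add: layer_radius_less_iff)
    have \<delta>: "?\<delta> > 0" using m gap by simp
    have s0: "0 < s k" using s[of k] layer_radius_bounds(1)[of k] by linarith
    have "\<exists>F' u'. admissible i F' u' \<and> (\<forall>z. norm z \<le> layer_radius k \<longrightarrow> dist (F' z) (fst t z) < ?\<delta>) \<and>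
      (\<forall>x\<in>X k. \<forall>z. norm z \<le> layer_radius (Suc k) \<and> s k \<le> z \<bullet> x \<longrightarrow> real k < norm (F' z $ i))"
      by (rule push_layer[OF n X(1) X(2) s s0 _ _ \<epsilon> _ u \<delta>])
        (use layer_radius_bounds(2) sep in \<open>auto simp: less_imp_le\<close>)
    then obtain F' u' where F': "admissible i F' u'"
      "\<forall>z. norm z \<le> layer_radius k \<longrightarrow> dist (F' z) (fst t z) < ?\<delta>"
      "\<forall>x\<in>X k. \<forall>z. norm z \<le> layer_radius (Suc k) \<and> s k \<le> z \<bullet> x \<longrightarrow> real k < norm (F' z $ i)" by blast
    obtain m' where m': "m' > 0" "?low F' m'"
      using automorphism_lower_Lipschitz F'(1) unfolding admissible_def by blast
    \<comment> \<open>The minimum keeps the constants decreasing.\<close>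
    have "min m' (snd t) * dist x y \<le> dist (F' x) (F' y)" if "x \<in> cball 0 1" "y \<in> cball 0 1" for x y
    proof -
      have "min m' (snd t) * dist x y \<le> m' * dist x y" by (intro mult_right_mono) auto
      also have "\<dots> \<le> dist (F' x) (F' y)" using m'(2) that by blast
      finally show ?thesis .
    qed
    then have "P (F', min m' (snd t))" using m m'(1) F'(1) by (auto simp: P_def)
    moreover have "Q k t (F', min m' (snd t))"
      using F'(2,3) by (auto simp: Q_def less_imp_le)
    ultimately show "\<exists>t'. P t' \<and> Q k t t'" by blast
  qed
  then obtain f where f: "\<And>k. P (f k)" "\<And>k. Q k (f k) (f (Suc k))" by blast
  show ?thesis
    by (intro exI[of _ "fst \<circ> f"] exI[of _ "snd \<circ> f"] allI)
      (use f in \<open>auto simp: P_def Q_def admissible_def\<close>)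
qed

text \<open>The correction of step \<open>Suc k\<close> is proportional to the gap beyond its
  sphere, but Cauchy's estimate divides by the gap before it.\<close>

lemma layer_gap_antimono: "layer_radius (Suc (Suc k)) - layer_radius (Suc k) \<le> layer_radius (Suc k) - layer_radius k"
proof -
  have "1 / ((real k + 3) * (real k + 4)) \<le> 1 / ((real k + 2) * (real k + 3))"
    by (intro divide_left_mono mult_mono mult_pos_pos) auto
  moreover have "layer_radius (Suc j) - layer_radius j = 1 / ((real j + 2) * (real j + 3))" for j
    by (simp add: layer_radius_def field_simps)
  ultimately show ?thesis by (simp add: add.commute)
qed

text \<open>The last conclusion is a Runge property of the image; it is what makes the leaves simply
  connected.\<close>

theorem exists_labyrinthine_map:
  fixes i :: "'n::finite"
  assumes n: "CARD('n) > 1"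
  shows "\<exists>\<Phi> :: complex ^ 'n \<Rightarrow> complex ^ 'n.
    biholomorphic_map (*s) (*s) \<Phi> (ball 0 1) (\<Phi> ` ball 0 1) \<and> open (\<Phi> ` ball 0 1) \<and>
    (\<forall>N K z. (\<forall>k\<ge>K. norm (z k) = layer_radius k \<and> norm (\<Phi> (z k) $ i) \<le> N) \<longrightarrow>
       \<not> summable (\<lambda>k. dist (z k) (z (Suc k)))) \<and>
    (\<forall>U b d. bounded U \<and> open U \<and> (\<forall>t\<in>frontier U. b + t *s d \<in> \<Phi> ` ball 0 1) \<longrightarrow>
       (\<forall>t\<in>U. b + t *s d \<in> \<Phi> ` ball 0 1))"
proof -
  let ?\<rho> = layer_radius
  obtain X :: "nat \<Rightarrow> (complex ^ 'n) set" and s \<epsilon> :: "nat \<Rightarrow> real" where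
    L: "\<forall>k. finite (X k) \<and> X k \<subseteq> sphere 0 1 \<and> ?\<rho> k < s k \<and> 0 < \<epsilon> k \<and>
       (\<forall>x\<in>X k. \<forall>y\<in>X k. \<forall>z. x \<noteq> y \<and> norm z \<le> ?\<rho> (Suc k) \<and> s k \<le> z \<bullet> y \<longrightarrow>
          z \<bullet> x \<le> s k - \<epsilon> k)"
    and lab: "\<forall>K z. (\<forall>k\<ge>K. norm (z k) = ?\<rho> k \<and> (\<forall>x\<in>X k. z (Suc k) \<bullet> x < s k)) \<longrightarrow>
       \<not> summable (\<lambda>k. dist (z k) (z (Suc k)))"
    using labyrinth[where 'a = "complex ^ 'n"] by (elim exE conjE) (rule that)
  obtain F :: "nat \<Rightarrow> complex ^ 'n \<Rightarrow> complex ^ 'n" and m :: "nat \<Rightarrow> real" where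
    aut: "\<And>k. automorphism (F k)" and m0: "\<And>k. 0 < m k"
    and low: "\<And>k x y. x \<in> cball 0 1 \<Longrightarrow> y \<in> cball 0 1 \<Longrightarrow> m k * dist x y \<le> dist (F k x) (F k y)"
    and mdec: "\<And>k. m (Suc k) \<le> m k"
    and close: "\<And>k z. norm z \<le> ?\<rho> k \<Longrightarrow>
       dist (F (Suc k) z) (F k z) \<le> (1/2) ^ (k + 2) * (min 1 (m k) * (?\<rho> (Suc k) - ?\<rho> k))"
    and big: "\<And>k x z. x \<in> X k \<Longrightarrow> norm z \<le> ?\<rho> (Suc k) \<Longrightarrow> s k \<le> z \<bullet> x \<Longrightarrow> real k < norm (F (Suc k) z $ i)"
  proof -
    from exists_automorphism_sequence[where i = i, OF n L] obtain F m where
      *: "\<forall>k. automorphism (F k) \<and> 0 < m k \<and>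
    (\<forall>x\<in>cball 0 1. \<forall>y\<in>cball 0 1. m k * dist x y \<le> dist (F k x) (F k y)) \<and> m (Suc k) \<le> m k \<and>
    (\<forall>z. norm z \<le> layer_radius k \<longrightarrow>
       dist (F (Suc k) z) (F k z) \<le> (1/2) ^ (k + 2) * (min 1 (m k) * (layer_radius (Suc k) - layer_radius k))) \<and>
    (\<forall>x\<in>X k. \<forall>z. norm z \<le> layer_radius (Suc k) \<and> s k \<le> z \<bullet> x \<longrightarrow> real k < norm (F (Suc k) z $ i))"
      by (elim exE) (rule that)
    show ?thesis by (rule that[of F m]) (use * in blast)+
  qed
  have hF: "holo (F k) UNIV" for k using aut by (simp add: biholomorphic_map_def)
  have gap: "0 < ?\<rho> (Suc k) - ?\<rho> k" "?\<rho> (Suc k) - ?\<rho> k \<le> 1" for k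
    using layer_radius_less_iff[of k "Suc k"] layer_radius_bounds[of k] layer_radius_bounds[of "Suc k"] by auto
  have \<rho>mono: "?\<rho> j \<le> ?\<rho> k" if "j \<le> k" for j k using that by (simp add: layer_radius_le_iff)
  have close1: "dist (F (Suc k) z) (F k z) \<le> 1/4 * (1/2) ^ k" if "norm z \<le> ?\<rho> k" for k z
  proof -
    have "min 1 (m k) * (?\<rho> (Suc k) - ?\<rho> k) \<le> 1 * 1" using gap[of k] m0[of k] by (intro mult_mono) auto
    then have "(1/2) ^ (k + 2) * (min 1 (m k) * (?\<rho> (Suc k) - ?\<rho> k)) \<le> (1/2) ^ (k + 2) * 1"
      by (intro mult_left_mono) auto
    then have "dist (F (Suc k) z) (F k z) \<le> (1/2) ^ (k + 2)" using close[OF that] by linarith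
    then show ?thesis by (simp add: power_add)
  qed
  have "\<exists>l. (\<lambda>k. F k z) \<longlonglongrightarrow> l \<and> (\<forall>k. norm z \<le> ?\<rho> k \<longrightarrow> dist (F k z) l \<le> 1/2 * (1/2) ^ k)"
    if z: "norm z < 1" for z
  proof -
    obtain k0 where k0: "norm z < ?\<rho> k0" using layer_radius_eventually_greater[OF z] by blast
    have 1: "\<exists>l. (\<lambda>k. F k z) \<longlonglongrightarrow> l \<and> (\<forall>n\<ge>k. dist (F n z) l \<le> 2 * (1/4) * (1/2) ^ n)" if "norm z \<le> ?\<rho> k" for k
    proof (rule geometric_convergence)
      fix n assume "k \<le> n"
      then show "dist (F (Suc n) z) (F n z) \<le> 1/4 * (1/2) ^ n"
        using close1[of z n] \<rho>mono[of k n] that by linarith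
    qed
    obtain l where l: "(\<lambda>k. F k z) \<longlonglongrightarrow> l" using 1[OF less_imp_le[OF k0]] by blast
    have "dist (F k z) l \<le> 1/2 * (1/2) ^ k" if "norm z \<le> ?\<rho> k" for k
    proof -
      from 1[OF that] obtain l' where "(\<lambda>k. F k z) \<longlonglongrightarrow> l'" "dist (F k z) l' \<le> 2 * (1/4) * (1/2) ^ k"
        by blast
      then show ?thesis using LIMSEQ_unique[OF l] by simp
    qed
    with l show ?thesis by blast
  qed
  then obtain \<Phi> where lim: "\<And>z. norm z < 1 \<Longrightarrow> (\<lambda>k. F k z) \<longlonglongrightarrow> \<Phi> z"
    and err: "\<And>z k. norm z < 1 \<Longrightarrow> norm z \<le> ?\<rho> k \<Longrightarrow> dist (F k z) (\<Phi> z) \<le> 1/2 * (1/2) ^ k" by metis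
  have \<rho>1: "norm z < 1" if "norm z \<le> ?\<rho> k" for z :: "complex ^ 'n" and k
    using that layer_radius_bounds(2)[of k] by linarith
  have holo: "holo \<Phi> (ball 0 1)"
    unfolding holomorphic_map_def
  proof
    fix z :: "complex ^ 'n" assume "z \<in> ball 0 1"
    then have "norm z < 1" by simp
    then obtain j where j: "norm z < ?\<rho> j" using layer_radius_eventually_greater by blast
    have "holo \<Phi> (ball 0 (?\<rho> j))"
    proof (rule holo_geometric_limit[OF hF])
      show "0 < ?\<rho> j" using layer_radius_bounds(1)[of j] by linarith
      show "?\<rho> j < ?\<rho> (Suc j)" by (simp add: layer_radius_less_iff)
      fix n and z :: "complex ^ 'n" assume "Suc j \<le> n" "norm z \<le> ?\<rho> (Suc j)"
      then have "dist (F (Suc n) z) (F n z) \<le> 1/4 * (1/2) ^ n"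
        using close1[of z n] \<rho>mono[of "Suc j" n] by linarith
      then show "dist (F (Suc n) z) (F n z) \<le> (1/2) ^ n" by (rule order_trans) simp
    next
      fix z :: "complex ^ 'n" assume "norm z < ?\<rho> j"
      then show "(\<lambda>n. F n z) \<longlonglongrightarrow> \<Phi> z" using lim \<rho>1[of z j] by simp
    qed
    then show "\<exists>f'. Vector_Spaces.linear (*s) (*s) f' \<and> (\<Phi> has_derivative f') (at z)"
      using j unfolding holomorphic_map_def by simp
  qed
  \<comment> \<open>The correction is controlled on the sphere of radius \<open>?\<rho> k\<close>,
    its increments one sphere further in; the gaps cancel.\<close>
  have lipE: "dist x y * (m k * (1/2) ^ (k + 2)) \<ge> norm ((F (Suc k) x - F k x) - (F (Suc k) y - F k y))"
    if x: "norm x \<le> ?\<rho> j" and y: "norm y \<le> ?\<rho> j" and j: "j < k" for j k x y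
  proof -
    obtain k' where k': "k = Suc k'" using j by (cases k) auto
    let ?\<delta> = "(1/2) ^ (k + 2) * (m k * (?\<rho> k - ?\<rho> k'))"
    have "norm ((F (Suc k) x - F k x) - (F (Suc k) y - F k y)) \<le> ?\<delta> / (?\<rho> k - ?\<rho> k') * norm (x - y)"
    proof (rule holo_Lipschitz[where F = "\<lambda>z. F (Suc k) z - F k z" and S = UNIV])
      show "holo (\<lambda>z. F (Suc k) z - F k z) UNIV" by (intro holo_diff hF)
      show "?\<rho> k' < ?\<rho> k" using gap[of k'] k' by simp
      show "x \<in> cball 0 (?\<rho> k')" "y \<in> cball 0 (?\<rho> k')" using x y \<rho>mono[of j k'] j k' by auto
      fix z :: "complex ^ 'n" assume "z \<in> cball 0 (?\<rho> k)"
      then have "dist (F (Suc k) z) (F k z) \<le> (1/2) ^ (k + 2) * (min 1 (m k) * (?\<rho> (Suc k) - ?\<rho> k))"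
        using close by simp
      also have "\<dots> \<le> ?\<delta>"
        using layer_gap_antimono[of k'] gap[of k] m0[of k] k' by (intro mult_left_mono mult_mono) auto
      finally show "norm (F (Suc k) z - F k z) \<le> ?\<delta>" by (simp add: dist_norm)
    qed simp
    also have "?\<delta> / (?\<rho> k - ?\<rho> k') = m k * (1/2) ^ (k + 2)"
    proof -
      have eq: "c * (a * g) / g = a * c" if "g \<noteq> 0" for a c g :: real using that by simp
      show ?thesis by (rule eq) (use gap(1)[of k'] k' in simp)
    qed
    finally show ?thesis by (simp add: dist_norm mult.commute)
  qed
  \<comment> \<open>On the ball of radius \<open>?\<rho> j\<close>, corrections with index above
    \<open>j\<close> have controlled increments. They consume at most half of the constant of
    \<open>F (Suc j)\<close>.\<close>
  define \<mu> where "\<mu> j = m (Suc j) / 2" for j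
  have \<mu>0: "\<mu> j > 0" for j by (simp add: \<mu>_def m0)
  have lowF: "\<mu> j * dist x y \<le> dist (F k x) (F k y)"
    if x: "norm x \<le> ?\<rho> j" and y: "norm y \<le> ?\<rho> j" and k: "j < k" for j k x y
  proof -
    let ?M = "m (Suc j)"
    \<comment> \<open>The surplus \<open>(1/2) ^ (k + 1)\<close> is the reserve still available:
      each step spends half of it, so the factor never falls below 1/2.\<close>
    have "(1/2 + (1/2) ^ (k + 1)) * (?M * dist x y) \<le> dist (F k x) (F k y)"
      using k[THEN Suc_leI]
    proof (induction k rule: dec_induct)
      case base
      have "(1/2 :: real) ^ (Suc j + 1) \<le> (1/2) ^ 1" by (intro power_decreasing) auto
      then have "(1/2 + (1/2) ^ (Suc j + 1)) * (?M * dist x y) \<le> 1 * (?M * dist x y)"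
        using m0[of "Suc j"] by (intro mult_right_mono) auto
      also have "\<dots> \<le> dist (F (Suc j) x) (F (Suc j) y)"
        using low[of x y "Suc j"] \<rho>1[OF x] \<rho>1[OF y] by simp
      finally show ?case .
    next
      case (step k)
      have mk: "m k \<le> ?M" using step(1) by (rule lift_Suc_antimono_le[of m, OF mdec])
      have "norm ((F (Suc k) x - F k x) - (F (Suc k) y - F k y)) \<le> dist x y * (m k * (1/2) ^ (k + 2))"
        using lipE[OF x y] step(1) by simp
      also have "\<dots> \<le> dist x y * (?M * (1/2) ^ (k + 2))" using mk by (intro mult_left_mono mult_right_mono) auto
      finally have 1: "norm ((F (Suc k) x - F k x) - (F (Suc k) y - F k y)) \<le> (1/2) ^ (k + 2) * (?M * dist x y)"
        by (simp add: mult_ac)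
      have "F k x - F k y = (F (Suc k) x - F (Suc k) y) - ((F (Suc k) x - F k x) - (F (Suc k) y - F k y))" by simp
      then have "dist (F k x) (F k y) \<le> dist (F (Suc k) x) (F (Suc k) y) + norm ((F (Suc k) x - F k x) - (F (Suc k) y - F k y))"
        unfolding dist_norm by (metis norm_triangle_ineq4)
      moreover have "(1/2 + (1/2) ^ (Suc k + 1)) * (?M * dist x y) =
          (1/2 + (1/2) ^ (k + 1)) * (?M * dist x y) - (1/2) ^ (k + 2) * (?M * dist x y)"
        by (simp add: algebra_simps)
      ultimately show ?case using step.IH 1 by linarith
    qed
    moreover have "\<mu> j * dist x y \<le> (1/2 + (1/2) ^ (k + 1)) * (?M * dist x y)"
      using m0[of "Suc j"] by (simp add: \<mu>_def distrib_right)
    ultimately show ?thesis by linarith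
  qed
  have low\<Phi>: "\<mu> j * dist x y \<le> dist (\<Phi> x) (\<Phi> y)" if "norm x \<le> ?\<rho> j" "norm y \<le> ?\<rho> j" for j x y
  proof (rule tendsto_lowerbound)
    show "(\<lambda>k. dist (F k x) (F k y)) \<longlonglongrightarrow> dist (\<Phi> x) (\<Phi> y)"
      using lim \<rho>1 that by (intro tendsto_intros) auto
    show "\<forall>\<^sub>F k in sequentially. \<mu> j * dist x y \<le> dist (F k x) (F k y)"
      using eventually_gt_at_top[of j] by (rule eventually_mono) (rule lowF[OF that])
  qed simp
  have inj: "inj_on \<Phi> (ball 0 1)"
  proof (rule inj_onI)
    fix x y assume xy: "x \<in> ball 0 1" "y \<in> ball 0 1" "\<Phi> x = \<Phi> y"
    then have "max (norm x) (norm y) < 1" by simp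
    then obtain j where j: "max (norm x) (norm y) < ?\<rho> j" using layer_radius_eventually_greater by blast
    then have "\<mu> j * dist x y \<le> 0" using low\<Phi>[of x j y] xy(3) by simp
    then show "x = y" using \<mu>0[of j] by (simp add: mult_le_0_iff)
  qed
  \<comment> \<open>If the derivative annihilated \<open>h\<close>, then \<Phi> would move points
    along \<open>h\<close> by less, to first order, than \<open>low\<Phi>\<close> demands.\<close>
  have imm: "inj F'" if z: "z \<in> ball 0 1" and F': "(\<Phi> has_derivative F') (at z)" for z F'
  proof -
    have lin: "linear F'" by (rule has_derivative_linear[OF F'])
    have "norm z < 1" using z by simp
    then obtain j where j: "norm z < ?\<rho> j" using layer_radius_eventually_greater by blast
    have "h = 0" if h: "F' h = 0" for h
    proof (rule ccontr)
      assume h0: "h \<noteq> 0"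
      obtain d where d: "d > 0" "\<And>y. norm (y - z) < d \<Longrightarrow> norm (\<Phi> y - \<Phi> z - F' (y - z)) \<le> \<mu> j / 2 * norm (y - z)"
        using F' \<mu>0[of j] unfolding has_derivative_at_alt by (meson half_gt_zero)
      define t where "t = min d (?\<rho> j - norm z) / 2 / norm h"
      have t: "t > 0" using d(1) j h0 by (simp add: t_def)
      have nt: "norm (t *\<^sub>R h) = min d (?\<rho> j - norm z) / 2" using t h0 d(1) j by (simp add: t_def)
      let ?y = "z + t *\<^sub>R h"
      have th: "F' (t *\<^sub>R h) = 0" using linear_scale[OF lin] h by simp
      have "norm (\<Phi> ?y - \<Phi> z) \<le> \<mu> j / 2 * norm (t *\<^sub>R h)" using d(2)[of ?y] nt d(1) j th by simp
      moreover have "norm (t *\<^sub>R h) \<le> (?\<rho> j - norm z) / 2" unfolding nt by (rule divide_right_mono) auto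
      then have "norm ?y \<le> norm z + (?\<rho> j - norm z) / 2" using norm_triangle_ineq[of z "t *\<^sub>R h"] by linarith
      then have "norm ?y \<le> ?\<rho> j" using j by (simp add: field_simps)
      then have "\<mu> j * dist ?y z \<le> dist (\<Phi> ?y) (\<Phi> z)" using low\<Phi> j by simp
      then have "\<mu> j * norm (t *\<^sub>R h) \<le> norm (\<Phi> ?y - \<Phi> z)" by (simp add: dist_norm)
      ultimately have "\<mu> j * norm (t *\<^sub>R h) \<le> \<mu> j / 2 * norm (t *\<^sub>R h)" by linarith
      moreover have "\<mu> j * norm (t *\<^sub>R h) > 0" using \<mu>0[of j] t h0 by simp
      moreover have "\<mu> j / 2 * norm (t *\<^sub>R h) = (\<mu> j * norm (t *\<^sub>R h)) / 2" by simp
      ultimately show False by linarith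
    qed
    then show ?thesis using linear_injective_0[OF lin] by blast
  qed
  have bih: "open (\<Phi> ` ball 0 1)" "biholomorphic_map (*s) (*s) \<Phi> (ball 0 1) (\<Phi> ` ball 0 1)"
    using holo_injective_biholomorphic[OF holo open_ball inj] imm by blast+
  \<comment> \<open>On the caps of layer \<open>k\<close>, coordinate \<open>i\<close> of
    \<open>F (Suc k)\<close> exceeds \<open>k\<close> and \<Phi> differs from
    \<open>F (Suc k)\<close> by at most 1. A bound \<open>N\<close> on that coordinate thus forces
    all caps with \<open>k \<ge> N + 1\<close> to be avoided.\<close>
  have long: "\<not> summable (\<lambda>k. dist (z k) (z (Suc k)))"
    if z: "\<forall>k\<ge>K. norm (z k) = ?\<rho> k \<and> norm (\<Phi> (z k) $ i) \<le> N" for N K z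
  proof -
    obtain L where L: "N + 1 \<le> real L" using real_arch_simple by blast
    have "z (Suc k) \<bullet> x < s k" if k: "max K L \<le> k" and x: "x \<in> X k" for k x
    proof (rule ccontr)
      assume "\<not> ?thesis"
      then have "real k < norm (F (Suc k) (z (Suc k)) $ i)" using big[OF x] z k by simp
      moreover have "dist (F (Suc k) (z (Suc k))) (\<Phi> (z (Suc k))) \<le> 1/2 * (1/2) ^ Suc k"
        using z k by (intro err \<rho>1[of _ "Suc k"]) auto
      then have "dist (F (Suc k) (z (Suc k))) (\<Phi> (z (Suc k))) \<le> 1"
        using power_le_one[of "1/2 :: real" "Suc k"] by linarith
      then have "norm (F (Suc k) (z (Suc k)) $ i - \<Phi> (z (Suc k)) $ i) \<le> 1"
        using Finite_Cartesian_Product.norm_nth_le[of "F (Suc k) (z (Suc k)) - \<Phi> (z (Suc k))" i]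
        by (simp add: dist_norm)
      ultimately have "real k < norm (\<Phi> (z (Suc k)) $ i) + 1"
        using norm_triangle_ineq2[of "F (Suc k) (z (Suc k)) $ i" "\<Phi> (z (Suc k)) $ i"] by linarith
      moreover have "norm (\<Phi> (z (Suc k)) $ i) \<le> N" using z k by simp
      ultimately show False using L k by simp
    qed
    then show ?thesis using lab[rule_format, of "max K L" z] z by auto
  qed
  \<comment> \<open>The line is pulled back by the automorphisms \<open>F k\<close>, whose inverses
    are defined everywhere. The pulled-back frontier lies in a fixed ball inside the unit ball, the
    maximum principle carries this bound to \<open>U\<close>, and the limit in \<open>k\<close>
    yields preimages under \<Phi>.\<close>
  have Runge: "b + t0 *s d \<in> \<Phi> ` ball 0 1"
    if U: "bounded U" "open U" and bd: "\<forall>t\<in>frontier U. b + t *s d \<in> \<Phi> ` ball 0 1" and t0: "t0 \<in> U"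
    for U b d t0
  proof -
    let ?G = "\<lambda>t. b + t *s d"
    let ?\<Psi> = "inv_into (ball 0 1) \<Phi>"
    have contG: "continuous_on UNIV ?G"
      by (intro continuous_intros linear_continuous_on bounded_linear_scale_left)
    have comp: "compact (?G ` frontier U)"
      using contG continuous_on_subset by (intro compact_continuous_image compact_frontier_bounded U) auto
    have sub: "?G ` frontier U \<subseteq> \<Phi> ` ball 0 1" using bd by blast
    have "continuous_on (\<Phi> ` ball 0 1) ?\<Psi>"
      using bih(2) holomorphic_map_continuous unfolding biholomorphic_map_def by blast
    then have comp2: "compact (?\<Psi> ` ?G ` frontier U)"
      by (intro compact_continuous_image[OF _ comp]) (rule continuous_on_subset[OF _ sub])
    have sub2: "?\<Psi> ` ?G ` frontier U \<subseteq> ball 0 1"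
    proof -
      have "?\<Psi> y \<in> ball 0 1" if "y \<in> ?G ` frontier U" for y using subsetD[OF sub that] by (rule inv_into_into)
      then show ?thesis by blast
    qed
    have "\<exists>r<1. \<forall>p\<in>?\<Psi> ` ?G ` frontier U. norm p \<le> r"
    proof (cases "frontier U = {}")
      case False
      then have "?\<Psi> ` ?G ` frontier U \<noteq> {}" by simp
      from continuous_attains_sup[OF comp2 this continuous_on_norm_id]
      obtain p where p: "p \<in> ?\<Psi> ` ?G ` frontier U" "\<forall>q\<in>?\<Psi> ` ?G ` frontier U. norm q \<le> norm p"
        by (elim bexE) (rule that)
      have "p \<in> ball 0 1" by (rule subsetD[OF sub2 p(1)])
      then have "norm p < 1" by simp
      with p(2) show ?thesis by (intro exI[of _ "norm p"] conjI)
    next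
      case True
      then show ?thesis by (intro exI[of _ 0]) simp
    qed
    then obtain r where r0: "r < 1" "\<forall>p\<in>?\<Psi> ` ?G ` frontier U. norm p \<le> r" by (elim exE conjE) (rule that)
    then have r: "r < 1" "\<And>t. t \<in> frontier U \<Longrightarrow> norm (?\<Psi> (?G t)) \<le> r" by simp_all
    obtain j where j: "r < ?\<rho> j" using layer_radius_eventually_greater[OF r(1)] by blast
    define \<delta> where "\<delta> = ?\<rho> (Suc j) - ?\<rho> j"
    have \<delta>: "\<delta> > 0" using gap by (simp add: \<delta>_def)
    have ev: "\<forall>\<^sub>F k in sequentially. 1/2 * (1/2::real) ^ k < \<mu> (Suc j) * \<delta>"
      using \<delta> \<mu>0[of "Suc j"] by (intro eventually_half_power_less) simp
    have pk: "norm (inv (F k) (?G t0)) \<le> ?\<rho> (Suc j)"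
      if k: "1/2 * (1/2::real) ^ k < \<mu> (Suc j) * \<delta>" "Suc j < k" for k
    proof -
      let ?H = "\<lambda>t. inv (F k) (?G t)"
      have inv: "holo (inv (F k)) UNIV" "inj (F k)" using aut[of k] by (auto simp: biholomorphic_map_def bij_is_inj)
      have front: "norm (?H t) \<le> ?\<rho> (Suc j)" if t: "t \<in> frontier U" for t
      proof -
        let ?y = "?\<Psi> (?G t)"
        have y: "norm ?y \<le> ?\<rho> j" "\<Phi> ?y = ?G t"
          using r(2)[OF t] j sub t by (auto intro!: f_inv_into_f)
        \<comment> \<open>The point \<open>?G t\<close> is the value of \<Phi> at \<open>?y\<close>,
          so it is close to \<open>F k ?y\<close>; the covered ball contains it, which puts its
          preimage within \<delta> of \<open>?y\<close>.\<close>
        have "ball (F k ?y) (\<mu> (Suc j) * \<delta>) \<subseteq> F k ` ball ?y \<delta>"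
        proof (rule automorphism_covers_ball[OF aut \<delta>])
          fix x assume x: "dist ?y x = \<delta>"
          then have "norm x \<le> ?\<rho> (Suc j)"
            using y(1) norm_triangle_ineq2[of x ?y] by (simp add: dist_norm norm_minus_commute \<delta>_def)
          moreover have "norm ?y \<le> ?\<rho> (Suc j)" using y(1) \<rho>mono[of j "Suc j"] by simp
          ultimately show "\<mu> (Suc j) * \<delta> \<le> dist (F k ?y) (F k x)" using lowF[of ?y "Suc j" x k] k(2) x by simp
        qed
        moreover have "dist (F k ?y) (?G t) < \<mu> (Suc j) * \<delta>"
          using err[of ?y k] \<rho>1[OF y(1)] y \<rho>mono[of j k] k by simp
        ultimately obtain x where x: "x \<in> ball ?y \<delta>" "?G t = F k x" by auto
        then have "?H t = x" using inv(2) by simp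
        moreover have "norm x \<le> ?\<rho> (Suc j)"
          using x(1) y(1) norm_triangle_ineq2[of x ?y] by (simp add: dist_norm norm_minus_commute \<delta>_def)
        ultimately show ?thesis by simp
      qed
      \<comment> \<open>Pairing with the value at \<open>t0\<close> itself turns the scalar maximum
        principle into a bound for the norm.\<close>
      let ?e = "?H t0"
      have hol: "(\<lambda>t. hdot (?H t) ?e) holomorphic_on UNIV" by (rule holo_line_holomorphic[OF inv(1)]) simp
      have "norm (hdot (?H t0) ?e) \<le> ?\<rho> (Suc j) * norm ?e"
      proof (rule maximum_modulus_frontier[of "\<lambda>t. hdot (?H t) ?e" U])
        show "(\<lambda>t. hdot (?H t) ?e) holomorphic_on interior U" using hol holomorphic_on_subset by blast
        show "continuous_on (closure U) (\<lambda>t. hdot (?H t) ?e)"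
          using hol holomorphic_on_imp_continuous_on continuous_on_subset by blast
        fix t assume "t \<in> frontier U"
        then have "norm (?H t) * norm ?e \<le> ?\<rho> (Suc j) * norm ?e" by (intro mult_right_mono front) auto
        then show "norm (hdot (?H t) ?e) \<le> ?\<rho> (Suc j) * norm ?e" using norm_hdot_le order_trans by blast
      qed (use U t0 in auto)
      moreover have "norm (hdot ?e ?e) = norm ?e * norm ?e"
        by (simp only: hdot_self norm_of_real) (simp add: power2_eq_square)
      ultimately have "norm ?e * norm ?e \<le> ?\<rho> (Suc j) * norm ?e" by simp
      then show ?thesis using layer_radius_bounds(1)[of "Suc j"] by (cases "?e = 0") auto
    qed
    \<comment> \<open>The preimages under \<open>F k\<close> remain in this compact ball, where
      \<Phi> is close to \<open>F k\<close>; their images under \<Phi> therefore tend to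
      \<open>?G t0\<close>, and closedness suffices without a convergent subsequence.\<close>
    have "compact (\<Phi> ` cball 0 (?\<rho> (Suc j)))"
      using layer_radius_bounds(2)[of "Suc j"] holomorphic_map_continuous[OF holo]
      by (intro compact_continuous_image) (auto intro: continuous_on_subset)
    then have closed: "closed (\<Phi> ` cball 0 (?\<rho> (Suc j)))" by (rule compact_imp_closed)
    have ev2: "\<forall>\<^sub>F k in sequentially. 1/2 * (1/2::real) ^ k < \<mu> (Suc j) * \<delta> \<and> Suc j < k"
      using ev eventually_gt_at_top by (rule eventually_conj)
    have "?G t0 \<in> \<Phi> ` cball 0 (?\<rho> (Suc j))"
    proof (rule Lim_in_closed_set[OF closed _ sequentially_bot])
      show "\<forall>\<^sub>F k in sequentially. \<Phi> (inv (F k) (?G t0)) \<in> \<Phi> ` cball 0 (?\<rho> (Suc j))"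
        using ev2 by (rule eventually_mono) (use pk in auto)
      show "(\<lambda>k. \<Phi> (inv (F k) (?G t0))) \<longlonglongrightarrow> ?G t0"
      proof (rule tendstoI)
        fix e :: real assume e: "e > 0"
        from eventually_half_power_less[OF e] ev2 show "\<forall>\<^sub>F k in sequentially. dist (\<Phi> (inv (F k) (?G t0))) (?G t0) < e"
        proof eventually_elim
          fix k assume elim: "1/2 * (1/2) ^ k < e" "1/2 * (1/2) ^ k < \<mu> (Suc j) * \<delta> \<and> Suc j < k"
          have "surj (F k)" using aut[of k] by (auto simp: biholomorphic_map_def bij_is_surj)
          then have "F k (inv (F k) (?G t0)) = ?G t0" by (rule surj_f_inv_f)
          moreover have q: "norm (inv (F k) (?G t0)) \<le> ?\<rho> k"
            using pk[of k] elim \<rho>mono[of "Suc j" k] by linarith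
          moreover have "dist (F k (inv (F k) (?G t0))) (\<Phi> (inv (F k) (?G t0))) \<le> 1/2 * (1/2) ^ k"
            by (rule err[OF \<rho>1[OF q] q])
          ultimately show "dist (\<Phi> (inv (F k) (?G t0))) (?G t0) < e" using elim(1) by (simp add: dist_commute)
        qed
      qed
    qed
    moreover have "cball 0 (?\<rho> (Suc j)) \<subseteq> ball (0 :: complex ^ 'n) 1" using \<rho>1 by auto
    ultimately show ?thesis by blast
  qed
  show ?thesis
  proof (intro exI[of _ \<Phi>] conjI allI impI ballI)
    show "b + t *s d \<in> \<Phi> ` ball 0 1"
      if "bounded U \<and> open U \<and> (\<forall>t\<in>frontier U. b + t *s d \<in> \<Phi> ` ball 0 1)" "t \<in> U" for U b d t
      using Runge[of U b d t] that by blast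
  qed (use bih long in blast)+
qed

section \<open>The foliation by the slices of a chart\<close>

abbreviation prod_scale :: "complex \<Rightarrow> (complex ^ 'm) \<times> complex \<Rightarrow> (complex ^ 'm) \<times> complex" where
  "prod_scale \<equiv> module_prod.scale (*s) (*)"

lemma vector_space_prod_scale: "vector_space (prod_scale :: complex \<Rightarrow> (complex ^ 'm) \<times> complex \<Rightarrow> _)"
  and prod_scale_eq: "prod_scale c (p :: (complex ^ 'm) \<times> complex) = (c *s fst p, c * snd p)"
proof -
  interpret vector_space_prod "(*s) :: complex \<Rightarrow> complex ^ 'm \<Rightarrow> _" "(*) :: complex \<Rightarrow> complex \<Rightarrow> complex"
    by unfold_locales (auto simp: algebra_simps)
  show "vector_space (prod_scale :: complex \<Rightarrow> (complex ^ 'm) \<times> complex \<Rightarrow> _)" by (rule p.vector_space_axioms)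
  show "prod_scale c p = (c *s fst p, c * snd p)" by (rule scale_def)
qed

lemma clinear_to_prod_iff:
  "Vector_Spaces.linear (*s) prod_scale (f :: complex ^ 'n \<Rightarrow> (complex ^ 'm) \<times> complex) \<longleftrightarrow>
     (\<forall>x y. f (x + y) = f x + f y) \<and> (\<forall>c x. f (c *s x) = prod_scale c (f x))"
  by (simp add: Vector_Spaces.linear_iff vec.vector_space_axioms vector_space_prod_scale)

lemma clinear_from_prod_iff:
  "Vector_Spaces.linear prod_scale (*s) (f :: (complex ^ 'm) \<times> complex \<Rightarrow> complex ^ 'n) \<longleftrightarrow>
     (\<forall>x y. f (x + y) = f x + f y) \<and> (\<forall>c x. f (prod_scale c x) = c *s f x)"
  by (simp add: Vector_Spaces.linear_iff vec.vector_space_axioms vector_space_prod_scale)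

lemma clinear_from_complex_iff:
  "Vector_Spaces.linear (*) (*s) (f :: complex \<Rightarrow> complex ^ 'n) \<longleftrightarrow>
     (\<forall>x y. f (x + y) = f x + f y) \<and> (\<forall>c x. f (c * x) = c *s f x)"
proof -
  have "vector_space ((*) :: complex \<Rightarrow> complex \<Rightarrow> complex)" by unfold_locales (auto simp: algebra_simps)
  then show ?thesis by (simp add: Vector_Spaces.linear_iff vec.vector_space_axioms)
qed

text \<open>For a loop in \<open>W\<close>, the filling property puts the inside of its image into
  \<open>S\<close>. Image and inside together are connected, hence in \<open>W\<close>; so a point
  off \<open>W\<close> is outside the loop and has winding number zero.\<close>

lemma component_simply_connected:
  fixes S :: "complex set"
  assumes S: "open S" and fill: "\<And>U. bounded U \<Longrightarrow> open U \<Longrightarrow> frontier U \<subseteq> S \<Longrightarrow> U \<subseteq> S"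
    and W: "W \<in> components S"
  shows "simply_connected W"
proof -
  have "open W" using open_components[OF S W] .
  moreover have "connected W" using in_components_connected[OF W] .
  moreover have "winding_number g z = 0"
    if g: "path g" "path_image g \<subseteq> W" "pathfinish g = pathstart g" and z: "z \<notin> W" for g z
  proof -
    let ?P = "path_image g"
    have cl: "closed ?P" using closed_path_image[OF g(1)] .
    have WS: "W \<subseteq> S" using in_components_subset[OF W] .
    have "frontier (inside ?P) \<subseteq> ?P" using frontier_inside_subset[OF cl] .
    then have "frontier (inside ?P) \<subseteq> S" using g(2) WS by blast
    then have "inside ?P \<subseteq> S"
      using fill[OF bounded_inside[OF bounded_path_image[OF g(1)]] open_inside[OF cl]] by blast
    then have "?P \<union> inside ?P \<subseteq> S" using g(2) WS by blast
    moreover have "connected (?P \<union> inside ?P)"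
      by (rule connected_with_inside[OF cl connected_path_image[OF g(1)]])
    moreover have "W \<inter> (?P \<union> inside ?P) \<noteq> {}" using g(2) path_image_nonempty[of g] by blast
    ultimately have "?P \<union> inside ?P \<subseteq> W" by (intro components_maximal[OF W])
    then have "z \<notin> ?P" "z \<notin> inside ?P" using z by blast+
    then have "z \<in> outside ?P" using inside_Un_outside[of ?P] by blast
    then show ?thesis by (rule winding_number_zero_in_outside[OF g(1,3)])
  qed
  ultimately show ?thesis by (subst simply_connected_eq_winding_number_zero) blast+
qed

section \<open>Subspace topologies, path length and divergent paths\<close>

lemma second_countable_top_of_set: "second_countable (top_of_set (S :: 'a::second_countable_topology set))"
proof (rule second_countable_subtopology)
  obtain B :: "'a set set" where B: "countable B" "topological_basis B"
    using ex_countable_basis by blast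
  show "second_countable (euclidean :: 'a topology)"
    unfolding second_countable_def
  proof (intro exI[of _ B] conjI ballI allI impI B(1))
    fix V assume "V \<in> B"
    then show "openin euclidean V" using topological_basis_open[OF B(2)] by simp
  next
    fix U and x :: 'a assume "openin euclidean U \<and> x \<in> U"
    then have "open U" "x \<in> U" by auto
    then obtain V where "V \<in> B" "x \<in> V" "V \<subseteq> U" by (rule topological_basisE[OF B(2)])
    then show "\<exists>V\<in>B. x \<in> V \<and> V \<subseteq> U" by blast
  qed
qed

lemma homeomorphism_imp_homeomorphic_map:
  assumes "homeomorphism S T f g"
  shows "homeomorphic_map (top_of_set S) (top_of_set T) f"
proof -
  have "homeomorphic_maps (top_of_set S) (top_of_set T) f g"
    using assms unfolding homeomorphic_maps_def homeomorphism_def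
    by (auto simp: continuous_map_in_subtopology)
  then show ?thesis by (simp add: homeomorphic_maps_map)
qed

text \<open>Each partial sum is the length of an inscribed polygon, so finite path length would
  bound them all.\<close>

lemma half_open_path_length_infinite:
  fixes \<gamma> :: "real \<Rightarrow> 'a::metric_space"
  assumes t: "\<And>k. 0 \<le> t k" "\<And>k. t k < 1" "\<And>k. t k \<le> t (Suc k)"
    and ns: "\<not> summable (\<lambda>k. dist (\<gamma> (t k)) (\<gamma> (t (Suc k))))"
  shows "half_open_path_length \<gamma> = \<infinity>"
proof (rule ccontr)
  assume "half_open_path_length \<gamma> \<noteq> \<infinity>"
  then obtain r where r: "r \<ge> 0" "half_open_path_length \<gamma> = ennreal r"
    by (metis ennreal_cases infinity_ennreal_def)
  have mono: "incseq t" by (rule incseq_SucI) (rule t(3))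
  have "(\<Sum>k<n. dist (\<gamma> (t k)) (\<gamma> (t (Suc k)))) \<le> r" for n
  proof -
    let ?ts = "map t [0..<Suc n]"
    have "sorted ?ts" by (rule sorted_map_mono[OF sorted_upt]) (use mono in \<open>simp add: mono_on_def incseq_def\<close>)
    moreover have "set ?ts \<subseteq> {0..<1}" using t by auto
    ultimately have mem: "?ts \<in> {ts. sorted ts \<and> set ts \<subseteq> {0..<1}}" by blast
    have "(\<Sum>i<length ?ts - 1. ennreal (dist (\<gamma> (?ts ! i)) (\<gamma> (?ts ! Suc i)))) \<le> half_open_path_length \<gamma>"
      unfolding half_open_path_length_def by (rule SUP_upper[OF mem])
    moreover have "(\<Sum>i<length ?ts - 1. ennreal (dist (\<gamma> (?ts ! i)) (\<gamma> (?ts ! Suc i)))) =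
        (\<Sum>i<n. ennreal (dist (\<gamma> (t i)) (\<gamma> (t (Suc i)))))"
      by (rule sum.cong) (auto simp del: upt_Suc)
    ultimately have "ennreal (\<Sum>i<n. dist (\<gamma> (t i)) (\<gamma> (t (Suc i)))) \<le> ennreal r"
      using r(2) by (simp add: sum_ennreal)
    then show ?thesis using r(1) by simp
  qed
  then have "summable (\<lambda>k. dist (\<gamma> (t k)) (\<gamma> (t (Suc k))))"
    by (intro summableI_nonneg_bounded) auto
  with ns show False by blast
qed

text \<open>Since \<open>L\<close> is closed in the ball, its part in each closed layer ball is
  compact and the path must leave it; the intermediate value theorem then gives a crossing of the
  sphere. \<open>K\<close> is the index of a sphere that encloses the starting point.\<close>

lemma divergent_path_crossing_times:
  fixes \<gamma> :: "real \<Rightarrow> 'a::euclidean_space"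
  assumes \<gamma>: "divergent_path L \<gamma>" and L: "closedin (top_of_set (ball 0 1)) L"
  shows "\<exists>K t. \<forall>k. 0 \<le> t k \<and> t k < 1 \<and> t k \<le> t (Suc k) \<and> norm (\<gamma> (t k)) = layer_radius (K + k)"
proof -
  have cont: "continuous_on {0..<1} \<gamma>" and im: "\<gamma> ` {0..<1} \<subseteq> L" using \<gamma> by (auto simp: divergent_path_def)
  obtain T where T: "closed T" "L = ball 0 1 \<inter> T" using L unfolding closedin_closed by blast
  have crossing: "\<exists>u. t \<le> u \<and> u < 1 \<and> norm (\<gamma> u) = layer_radius k"
    if t: "0 \<le> t" "t < 1" "norm (\<gamma> t) \<le> layer_radius k" for t k
  proof -
    have eq: "L \<inter> cball 0 (layer_radius k) = T \<inter> cball 0 (layer_radius k)"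
      using T(2) layer_radius_bounds(2)[of k] by auto
    have "compact (L \<inter> cball 0 (layer_radius k))" unfolding eq by (rule closed_Int_compact[OF T(1) compact_cball])
    then have "\<forall>\<^sub>F u in at_left 1. \<gamma> u \<notin> L \<inter> cball 0 (layer_radius k)"
      using \<gamma> unfolding divergent_path_def by blast
    moreover have "\<forall>\<^sub>F u in at_left 1. u \<in> {t<..<1}" using t(2) by (rule eventually_at_left_real)
    ultimately have "\<forall>\<^sub>F u in at_left 1. \<gamma> u \<notin> L \<inter> cball 0 (layer_radius k) \<and> u \<in> {t<..<1}" by (rule eventually_conj)
    then have "\<exists>u. \<gamma> u \<notin> L \<inter> cball 0 (layer_radius k) \<and> u \<in> {t<..<1}"
      by (rule eventually_happens'[OF trivial_limit_at_left_real])
    then obtain u where u: "\<gamma> u \<notin> L \<inter> cball 0 (layer_radius k)" "t < u" "u < 1" by auto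
    have "\<gamma> u \<in> L" using im u t by auto
    then have "layer_radius k \<le> norm (\<gamma> u)" using u(1) by auto
    moreover have "continuous_on {t..u} (\<lambda>s. norm (\<gamma> s))"
      using u t by (intro continuous_on_norm continuous_on_subset[OF cont]) auto
    ultimately obtain v where "t \<le> v" "v \<le> u" "norm (\<gamma> v) = layer_radius k"
      using IVT'[of "\<lambda>s. norm (\<gamma> s)" t "layer_radius k" u] t(3) u(2) by auto
    then show ?thesis using u(3) by (intro exI[of _ v]) auto
  qed
  have "\<gamma> 0 \<in> L" using im by auto
  then have "norm (\<gamma> 0) < 1" using T(2) by auto
  then obtain K where K: "norm (\<gamma> 0) < layer_radius K" using layer_radius_eventually_greater by blast
  have "\<exists>t. \<forall>k. (0 \<le> t k \<and> t k < 1 \<and> norm (\<gamma> (t k)) = layer_radius (K + k)) \<and> t k \<le> t (Suc k)"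
  proof (rule dependent_nat_choice)
    show "\<exists>t. 0 \<le> t \<and> t < 1 \<and> norm (\<gamma> t) = layer_radius (K + 0)"
      using crossing[of 0 K] K by auto
    fix t k assume t: "0 \<le> t \<and> t < 1 \<and> norm (\<gamma> t) = layer_radius (K + k)"
    then have "norm (\<gamma> t) \<le> layer_radius (K + Suc k)" by (simp add: layer_radius_le_iff)
    then obtain u where "t \<le> u" "u < 1" "norm (\<gamma> u) = layer_radius (K + Suc k)"
      using crossing[of t "K + Suc k"] t by blast
    then show "\<exists>u. (0 \<le> u \<and> u < 1 \<and> norm (\<gamma> u) = layer_radius (K + Suc k)) \<and> t \<le> u"
      using t by (intro exI[of _ u]) auto
  qed
  then show ?thesis by (elim exE, intro exI[of _ K]) blast
qed

text \<open>The leaves depend on the map only through these four properties. The first factor of the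
  target labels the slices, and \<open>long\<close> asks only that this label be constant.\<close>

locale labyrinthine_chart =
  fixes \<Theta> :: "complex ^ 'n::finite \<Rightarrow> (complex ^ 'm::finite) \<times> complex"
  assumes biholomorphic: "biholomorphic_map (*s) prod_scale \<Theta> (ball 0 1) (\<Theta> ` ball 0 1)"
    and open_image: "open (\<Theta> ` ball 0 1)"
    and Runge: "\<And>U c. bounded U \<Longrightarrow> open U \<Longrightarrow> {c} \<times> frontier U \<subseteq> \<Theta> ` ball 0 1 \<Longrightarrow> {c} \<times> U \<subseteq> \<Theta> ` ball 0 1"
    and long: "\<And>K z c. \<forall>k\<ge>K. norm (z k) = layer_radius k \<and> fst (\<Theta> (z k)) = c \<Longrightarrow>
      \<not> summable (\<lambda>k. dist (z k) (z (Suc k)))"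
begin

abbreviation B :: "(complex ^ 'n) set" where "B \<equiv> ball 0 1"

definition \<Xi> where "\<Xi> = inv_into B \<Theta>"

definition slice where "slice c = {w. (c, w) \<in> \<Theta> ` B}"

definition leaf where "leaf c W = (\<lambda>w. \<Xi> (c, w)) ` W"

text \<open>Components are taken because the image of the ball may meet a vertical line in a
  disconnected set.\<close>

definition leaves where "leaves = {leaf c W | c W. W \<in> components (slice c)}"

lemma inj: "inj_on \<Theta> B"
  using biholomorphic by (simp add: biholomorphic_map_def bij_betw_def)

lemma \<Xi>_\<Theta>: "z \<in> B \<Longrightarrow> \<Xi> (\<Theta> z) = z"
  unfolding \<Xi>_def by (rule inv_into_f_f[OF inj])

lemma \<Theta>_\<Xi>: "p \<in> \<Theta> ` B \<Longrightarrow> \<Theta> (\<Xi> p) = p" "p \<in> \<Theta> ` B \<Longrightarrow> \<Xi> p \<in> B"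
  unfolding \<Xi>_def by (rule f_inv_into_f, assumption) (rule inv_into_into)

lemma holo_\<Theta>: "holomorphic_map (*s) prod_scale \<Theta> B"
  and holo_\<Xi>: "holomorphic_map prod_scale (*s) \<Xi> (\<Theta> ` B)"
  using biholomorphic by (simp_all add: biholomorphic_map_def \<Xi>_def)

lemma cont_\<Theta>: "continuous_on B \<Theta>"
  using holo_\<Theta> by (rule holomorphic_map_continuous)

lemma open_slice: "open (slice c)"
proof -
  have "slice c = (\<lambda>w. (c, w)) -` (\<Theta> ` B)" by (auto simp: slice_def)
  then show ?thesis by (simp only:) (intro open_vimage[OF open_image] continuous_intros)
qed

text \<open>The chain rule for \<Theta> after \<Xi> gives the derivative of \<Xi> a left inverse, so
  its restriction to the second factor is injective.\<close>

lemma immersion_slice: "holomorphic_immersion (*) (*s) (\<lambda>w. \<Xi> (c, w)) (slice c)"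
  unfolding holomorphic_immersion_def
proof
  fix w assume "w \<in> slice c"
  then have cw: "(c, w) \<in> \<Theta> ` B" by (simp add: slice_def)
  obtain D where D: "Vector_Spaces.linear prod_scale (*s) D" "(\<Xi> has_derivative D) (at (c, w))"
    using holo_\<Xi> cw unfolding holomorphic_map_def by blast
  obtain E where E: "(\<Theta> has_derivative E) (at (\<Xi> (c, w)))"
    using holo_\<Theta> \<Theta>_\<Xi>(2)[OF cw] unfolding holomorphic_map_def by blast
  have "((\<Theta> \<circ> \<Xi>) has_derivative (E \<circ> D)) (at (c, w))" by (rule diff_chain_at[OF D(2) E])
  then have "((\<lambda>p. p) has_derivative (E \<circ> D)) (at (c, w))"
    by (rule has_derivative_transform_within_open[OF _ open_image cw]) (simp add: \<Theta>_\<Xi>)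
  then have ED: "E \<circ> D = (\<lambda>h. h)" using has_derivative_unique has_derivative_ident by blast
  have "((\<lambda>w. (c, w)) has_derivative (\<lambda>h. (0, h))) (at w)" by (auto intro!: derivative_eq_intros)
  from diff_chain_at[OF this D(2)]
  have "((\<lambda>w. \<Xi> (c, w)) has_derivative (\<lambda>h. D (0, h))) (at w)" by (simp add: o_def)
  moreover have "inj (\<lambda>h. D (0, h))"
    by (rule injI) (use ED in \<open>metis comp_apply snd_conv\<close>)
  moreover have "Vector_Spaces.linear (*) (*s) (\<lambda>h. D (0, h))"
    unfolding clinear_from_complex_iff
  proof (intro conjI allI)
    fix x y a :: complex
    have l: "D (p + q) = D p + D q" "D (prod_scale a p) = a *s D p" for p q
      using D(1) unfolding clinear_from_prod_iff by blast+
    show "D (0, x + y) = D (0, x) + D (0, y)" using l(1)[of "(0, x)" "(0, y)"] by simp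
    show "D (0, a * x) = a *s D (0, x)" using l(2)[of "(0, x)"] by (simp add: prod_scale_eq)
  qed
  ultimately show "\<exists>f'. Vector_Spaces.linear (*) (*s) f' \<and> inj f' \<and> ((\<lambda>w. \<Xi> (c, w)) has_derivative f') (at w)"
    by blast
qed

lemma cont_slice: "continuous_on (slice c) (\<lambda>w. \<Xi> (c, w))"
  using immersion_slice[of c] unfolding holomorphic_immersion_def
  by (meson continuous_at_imp_continuous_on has_derivative_continuous)

lemma leaf_subset: "W \<subseteq> slice c \<Longrightarrow> leaf c W \<subseteq> B"
  using \<Theta>_\<Xi>(2) unfolding leaf_def slice_def by blast

lemma mem_leaf_iff:
  assumes "W \<subseteq> slice c"
  shows "z \<in> leaf c W \<longleftrightarrow> z \<in> B \<and> fst (\<Theta> z) = c \<and> snd (\<Theta> z) \<in> W"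
proof
  assume "z \<in> leaf c W"
  then obtain w where w: "w \<in> W" "z = \<Xi> (c, w)" by (auto simp: leaf_def)
  then have "(c, w) \<in> \<Theta> ` B" using assms by (auto simp: slice_def)
  then show "z \<in> B \<and> fst (\<Theta> z) = c \<and> snd (\<Theta> z) \<in> W" using w \<Theta>_\<Xi> by simp
next
  assume z: "z \<in> B \<and> fst (\<Theta> z) = c \<and> snd (\<Theta> z) \<in> W"
  then have "z = \<Xi> (c, snd (\<Theta> z))" using \<Xi>_\<Theta> by (metis prod.collapse)
  then show "z \<in> leaf c W" using z by (auto simp: leaf_def)
qed

lemma homeomorphism_leaf:
  assumes "W \<subseteq> slice c"
  shows "homeomorphism W (leaf c W) (\<lambda>w. \<Xi> (c, w)) (\<lambda>z. snd (\<Theta> z))"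
proof (rule homeomorphismI)
  show "continuous_on W (\<lambda>w. \<Xi> (c, w))" by (rule continuous_on_subset[OF cont_slice assms])
  show "continuous_on (leaf c W) (\<lambda>z. snd (\<Theta> z))"
    by (intro continuous_intros continuous_on_subset[OF cont_\<Theta> leaf_subset[OF assms]])
  show "(\<lambda>w. \<Xi> (c, w)) ` W \<subseteq> leaf c W" by (simp add: leaf_def)
  show "(\<lambda>z. snd (\<Theta> z)) ` leaf c W \<subseteq> W" using mem_leaf_iff[OF assms] by auto
  show "snd (\<Theta> (\<Xi> (c, w))) = w" if "w \<in> W" for w
  proof -
    have "(c, w) \<in> \<Theta> ` B" using that assms by (auto simp: slice_def)
    then show ?thesis using \<Theta>_\<Xi> by simp
  qed
  show "\<Xi> (c, snd (\<Theta> z)) = z" if "z \<in> leaf c W" for z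
    using that mem_leaf_iff[OF assms] \<Xi>_\<Theta> by (metis prod.collapse)
qed


lemma components_subset: "W \<in> components (slice c) \<Longrightarrow> W \<subseteq> slice c"
  by (rule in_components_subset)

text \<open>A component is relatively closed in its slice, so the leaf is the preimage under
  \<Theta> of a closed product. Both properness of the discs and the crossing times of divergent
  paths rest on this.\<close>

lemma closedin_leaf:
  assumes W: "W \<in> components (slice c)"
  shows "closedin (top_of_set B) (leaf c W)"
proof -
  obtain T where T: "closed T" "W = slice c \<inter> T"
    using closedin_component[OF W] unfolding closedin_closed by blast
  have "leaf c W = B \<inter> \<Theta> -` ({c} \<times> T)"
  proof (rule set_eqI)
    fix z
    have "snd (\<Theta> z) \<in> slice c" if "z \<in> B" "fst (\<Theta> z) = c"
    proof -
      have "(c, snd (\<Theta> z)) = \<Theta> z" using that(2) by (metis prod.collapse)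
      then show ?thesis using that(1) by (simp add: slice_def)
    qed
    then show "z \<in> leaf c W \<longleftrightarrow> z \<in> B \<inter> \<Theta> -` ({c} \<times> T)"
      unfolding mem_leaf_iff[OF components_subset[OF W]] using T(2) by (auto simp: mem_Times_iff)
  qed
  then show ?thesis
    using continuous_closedin_preimage[OF cont_\<Theta> closed_Times[OF closed_singleton T(1)]] by simp
qed

lemma partition_leaves: "partition_on B leaves"
proof (rule partition_onI)
  show "\<Union> leaves = B"
  proof
    have "leaf c W \<subseteq> B" if "W \<in> components (slice c)" for c W
      by (rule leaf_subset[OF components_subset[OF that]])
    then show "\<Union> leaves \<subseteq> B" unfolding leaves_def by blast
    show "B \<subseteq> \<Union> leaves"
    proof
      fix z assume z: "z \<in> B"
      define c w where "c = fst (\<Theta> z)" and "w = snd (\<Theta> z)"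
      have "(c, w) = \<Theta> z" by (simp add: c_def w_def)
      then have "w \<in> slice c" using z by (simp add: slice_def)
      then obtain W where W: "W \<in> components (slice c)" "w \<in> W" using Union_components[of "slice c"] by blast
      then have "z \<in> leaf c W" using z mem_leaf_iff[OF components_subset[OF W(1)]] by (simp add: c_def w_def)
      then show "z \<in> \<Union> leaves" using W(1) by (auto simp: leaves_def)
    qed
  qed
  have "leaf c W \<noteq> {}" if "W \<in> components (slice c)" for c W
    using in_components_nonempty[OF that] by (simp add: leaf_def)
  then show "{} \<notin> leaves" unfolding leaves_def by blast
  show "disjnt L L'" if "L \<in> leaves" "L' \<in> leaves" "L \<noteq> L'" for L L'
  proof (rule ccontr)
    assume nd: "\<not> disjnt L L'"
    from that(1,2) obtain c W c' W'
      where L: "L = leaf c W" "W \<in> components (slice c)" "L' = leaf c' W'" "W' \<in> components (slice c')"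
      by (auto simp: leaves_def)
    from nd obtain z where z: "z \<in> L" "z \<in> L'" by (auto simp: disjnt_iff)
    then have "c = c'" "snd (\<Theta> z) \<in> W \<inter> W'"
      using L mem_leaf_iff[OF components_subset[OF L(2)]] mem_leaf_iff[OF components_subset[OF L(4)]] by auto
    then have "W = W'" using components_nonoverlap[of W "slice c" W'] L by blast
    then show False using L \<open>c = c'\<close> that(3) by simp
  qed
qed

text \<open>Leaves are embedded: the subspace topology serves as leaf topology, and one global
  parametrisation is the chart at every point.\<close>

lemma connected_immersed_leaf:
  assumes W: "W \<in> components (slice c)"
  shows "connected_immersed_curve (top_of_set (leaf c W))"
proof -
  have Ws: "W \<subseteq> slice c" by (rule components_subset[OF W])
  have "connected (leaf c W)"
    unfolding leaf_def
    by (rule connected_continuous_image[OF continuous_on_subset[OF cont_slice Ws] in_components_connected[OF W]])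
  moreover have "leaf c W \<noteq> {}" using in_components_nonempty[OF W] by (simp add: leaf_def)
  moreover have "\<exists>N V g. openin (top_of_set (leaf c W)) N \<and> p \<in> N \<and> open V \<and> holomorphic_immersion (*) (*s) g V \<and>
      homeomorphic_map (top_of_set V) (subtopology (top_of_set (leaf c W)) N) g" if p: "p \<in> leaf c W" for p
  proof (intro exI[of _ "leaf c W"] exI[of _ W] exI[of _ "\<lambda>w. \<Xi> (c, w)"] conjI p)
    show "open W" by (rule open_components[OF open_slice W])
    show "holomorphic_immersion (*) (*s) (\<lambda>w. \<Xi> (c, w)) W"
      using immersion_slice[of c] Ws unfolding holomorphic_immersion_def by blast
    show "homeomorphic_map (top_of_set W) (subtopology (top_of_set (leaf c W)) (leaf c W)) (\<lambda>w. \<Xi> (c, w))"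
      using homeomorphism_imp_homeomorphic_map[OF homeomorphism_leaf[OF Ws]] by (simp add: subtopology_subtopology)
  qed simp
  ultimately show ?thesis
    by (simp add: connected_immersed_curve_def second_countable_top_of_set connected_space_subtopology connectedin_iff_connected)
qed

lemma foliation_leaves: "nonsingular_holomorphic_foliation TYPE('m) B leaves"
  unfolding nonsingular_holomorphic_foliation_def
proof (intro conjI partition_leaves exI[of _ top_of_set] ballI)
  fix L assume "L \<in> leaves"
  then show "topspace (top_of_set L) = L" "connected_immersed_curve (top_of_set L)"
    using connected_immersed_leaf by (auto simp: leaves_def)
next
  fix p assume p: "p \<in> B"
  obtain S T where ST: "open S" "open T" "\<Theta> p \<in> S \<times> T" "S \<times> T \<subseteq> \<Theta> ` B"
    using open_image p open_prod_elim[of "\<Theta> ` B" "\<Theta> p"] by blast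
  then have "fst (\<Theta> p) \<in> S" "snd (\<Theta> p) \<in> T" by (auto simp: mem_Times_iff)
  then obtain r r' where r: "r > 0" "ball (fst (\<Theta> p)) r \<subseteq> S" "r' > 0" "ball (snd (\<Theta> p)) r' \<subseteq> T"
    using ST(1,2) by (meson open_contains_ball)
  define V W where "V = ball (fst (\<Theta> p)) r" and "W = ball (snd (\<Theta> p)) r'"
  have VW: "open V" "connected V" "open W" "connected W" "W \<noteq> {}" "V \<times> W \<subseteq> \<Theta> ` B" "\<Theta> p \<in> V \<times> W"
    using r ST(4) by (auto simp: V_def W_def mem_Times_iff)
  define U where "U = B \<inter> \<Theta> -` (V \<times> W)"
  have U: "open U" "p \<in> U" "U \<subseteq> B"
    using continuous_open_preimage[OF cont_\<Theta> open_ball open_Times[OF VW(1,3)]] p VW(7) by (auto simp: U_def)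
  have \<Xi>U: "\<Xi> q \<in> U" "\<Theta> (\<Xi> q) = q" if "q \<in> V \<times> W" for q
  proof -
    have q: "q \<in> \<Theta> ` B" using that VW(6) by blast
    show "\<Theta> (\<Xi> q) = q" by (rule \<Theta>_\<Xi>(1)[OF q])
    with that show "\<Xi> q \<in> U" unfolding U_def using \<Theta>_\<Xi>(2)[OF q] by simp
  qed
  have im: "\<Theta> ` U = V \<times> W" using \<Xi>U by (force simp: U_def)
  have injU: "inj_on \<Theta> U" using inj U(3) inj_on_subset by blast
  have "biholomorphic_map (*s) prod_scale \<Theta> U (V \<times> W)"
    unfolding biholomorphic_map_def
  proof (intro conjI)
    show "bij_betw \<Theta> U (V \<times> W)" using injU im by (simp add: bij_betw_def)
    show "holomorphic_map (*s) prod_scale \<Theta> U" by (rule holomorphic_map_subset[OF holo_\<Theta> U(3)])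
    show "holomorphic_map prod_scale (*s) (inv_into U \<Theta>) (V \<times> W)"
      unfolding holomorphic_map_def
    proof
      fix q assume q: "q \<in> V \<times> W"
      then obtain D where D: "Vector_Spaces.linear prod_scale (*s) D" "(\<Xi> has_derivative D) (at q)"
        using holo_\<Xi> VW(6) unfolding holomorphic_map_def by blast
      have "(inv_into U \<Theta> has_derivative D) (at q)"
      proof (rule has_derivative_transform_within_open[OF D(2) open_Times[OF VW(1,3)] q])
        fix q' assume "q' \<in> V \<times> W"
        then show "\<Xi> q' = inv_into U \<Theta> q'" using inv_into_f_f[OF injU \<Xi>U(1)] \<Xi>U(2) by metis
      qed
      then show "\<exists>f'. Vector_Spaces.linear prod_scale (*s) f' \<and> (inv_into U \<Theta> has_derivative f') (at q)"
        using D(1) by blast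
    qed
  qed
  moreover have "{\<Theta> ` C | C L. L \<in> leaves \<and> C \<in> connected_components_of (subtopology (top_of_set L) U)} =
      {{c} \<times> W | c. c \<in> V}"
  proof -
    \<comment> \<open>Over a label in \<open>V\<close> the connected set \<open>W\<close> lies in
      the slice, so a component of that slice contains all of \<open>W\<close> or misses it. A leaf
      thus meets the box in one whole plaque or not at all.\<close>
    have plaque: "connected_components_of (subtopology (top_of_set (leaf c Q)) U) =
        (if c \<in> V \<and> W \<subseteq> Q then {(\<lambda>w. \<Xi> (c, w)) ` W} else {})"
      if Q: "Q \<in> components (slice c)" for c Q
    proof -
      have Qs: "Q \<subseteq> slice c" by (rule components_subset[OF Q])
      have mem: "z \<in> leaf c Q \<inter> U \<longleftrightarrow> z \<in> B \<and> fst (\<Theta> z) = c \<and> c \<in> V \<and> snd (\<Theta> z) \<in> Q \<inter> W" for z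
        unfolding U_def by (auto simp: mem_leaf_iff[OF Qs] mem_Times_iff)
      show ?thesis
      proof (cases "c \<in> V \<and> W \<subseteq> Q")
        case True
        have "leaf c Q \<inter> U = (\<lambda>w. \<Xi> (c, w)) ` W"
        proof (rule set_eqI)
          fix z
          have "z \<in> leaf c Q \<inter> U" if "z = \<Xi> (c, w)" "w \<in> W" for w
          proof
            show "z \<in> leaf c Q" unfolding leaf_def using that True by blast
            show "z \<in> U" using \<Xi>U(1)[of "(c, w)"] that True by blast
          qed
          moreover have "\<exists>w\<in>W. z = \<Xi> (c, w)" if "z \<in> leaf c Q \<inter> U"
            using that \<Xi>_\<Theta>[of z] by (metis mem IntD2 prod.collapse)
          ultimately show "z \<in> leaf c Q \<inter> U \<longleftrightarrow> z \<in> (\<lambda>w. \<Xi> (c, w)) ` W" by blast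
        qed
        moreover have "connected ((\<lambda>w. \<Xi> (c, w)) ` W)"
          using True Qs by (intro connected_continuous_image continuous_on_subset[OF cont_slice] VW(4)) auto
        ultimately have sub: "subtopology (top_of_set (leaf c Q)) U = top_of_set ((\<lambda>w. \<Xi> (c, w)) ` W)"
            and con: "connected_space (top_of_set ((\<lambda>w. \<Xi> (c, w)) ` W))"
          by (simp_all add: subtopology_subtopology connected_space_subtopology connectedin_iff_connected)
        let ?X = "top_of_set ((\<lambda>w. \<Xi> (c, w)) ` W)"
        have "connected_components_of ?X \<subseteq> {(\<lambda>w. \<Xi> (c, w)) ` W}"
          using con by (simp add: connected_components_of_subset_sing)
        moreover have "connected_components_of ?X \<noteq> {}"
        proof
          assume "connected_components_of ?X = {}"
          then have "topspace ?X = {}" using Union_connected_components_of[of ?X] by simp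
          then show False using VW(5) by simp
        qed
        ultimately show ?thesis using True sub by auto
      next
        case False
        have "leaf c Q \<inter> U = {}"
        proof (rule ccontr)
          assume "leaf c Q \<inter> U \<noteq> {}"
          then obtain z where "c \<in> V" "snd (\<Theta> z) \<in> Q \<inter> W" using mem by blast
          moreover have "W \<subseteq> slice c" using \<open>c \<in> V\<close> VW(6) by (auto simp: slice_def)
          ultimately have "W \<subseteq> Q" by (intro components_maximal[OF Q VW(4)]) auto
          then show False using False \<open>c \<in> V\<close> by blast
        qed
        then have "topspace (subtopology (top_of_set (leaf c Q)) U) = {}" by simp
        then have "\<Union> (connected_components_of (subtopology (top_of_set (leaf c Q)) U)) = {}"
          by (simp only: Union_connected_components_of)
        then have "connected_components_of (subtopology (top_of_set (leaf c Q)) U) = {}"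
          using nonempty_connected_components_of by (metis Union_empty_conv all_not_in_conv)
        then show ?thesis using False by auto
      qed
    qed
    have \<Theta>im: "\<Theta> ` (\<lambda>w. \<Xi> (c, w)) ` W = {c} \<times> W" if "c \<in> V" for c
      using that \<Xi>U(2) by (force simp: image_image)
    show ?thesis
    proof (intro set_eqI iffI)
      fix P assume "P \<in> {\<Theta> ` C | C L. L \<in> leaves \<and> C \<in> connected_components_of (subtopology (top_of_set L) U)}"
      then obtain C c Q where Q: "P = \<Theta> ` C" "Q \<in> components (slice c)"
          "C \<in> connected_components_of (subtopology (top_of_set (leaf c Q)) U)"
        by (auto simp: leaves_def)
      then have "c \<in> V" "C = (\<lambda>w. \<Xi> (c, w)) ` W" by (auto simp: plaque split: if_splits)
      then show "P \<in> {{c} \<times> W | c. c \<in> V}" using Q(1) \<Theta>im by blast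
    next
      fix P assume "P \<in> {{c} \<times> W | c. c \<in> V}"
      then obtain c where c: "c \<in> V" "P = {c} \<times> W" by blast
      have "W \<subseteq> slice c" using c(1) VW(6) by (auto simp: slice_def)
      then obtain Q where Q: "Q \<in> components (slice c)" "W \<subseteq> Q"
        using exists_component_superset[of W "slice c"] VW(4,5) by blast
      then have "(\<lambda>w. \<Xi> (c, w)) ` W \<in> connected_components_of (subtopology (top_of_set (leaf c Q)) U)"
        using c(1) by (simp add: plaque)
      moreover have "leaf c Q \<in> leaves" using Q(1) by (auto simp: leaves_def)
      ultimately show "P \<in> {\<Theta> ` C | C L. L \<in> leaves \<and> C \<in> connected_components_of (subtopology (top_of_set L) U)}"
        using \<Theta>im[OF c(1)] c(2) by blast
    qed
  qed
  ultimately show "\<exists>U V W \<phi>. open U \<and> p \<in> U \<and> U \<subseteq> B \<and> open V \<and> connected V \<and> open W \<and> connected W \<and>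
      biholomorphic_map (*s) prod_scale \<phi> U ((V :: (complex ^ 'm) set) \<times> W) \<and>
      {\<phi> ` C | C L. L \<in> leaves \<and> C \<in> connected_components_of (subtopology (top_of_set L) U)} = {{c} \<times> W | c. c \<in> V}"
    using U VW(1-4) by blast
qed

lemma slice_component_simply_connected:
  assumes W: "W \<in> components (slice c)"
  shows "simply_connected W"
proof (rule component_simply_connected[OF open_slice _ W])
  fix U assume U: "bounded U" "open U" "frontier U \<subseteq> slice c"
  have "{c} \<times> frontier U \<subseteq> \<Theta> ` B" using U(3) by (auto simp: slice_def)
  from Runge[OF U(1,2) this] show "U \<subseteq> slice c" by (auto simp: slice_def)
qed

lemma slice_neq_UNIV: "slice c \<noteq> UNIV"
proof
  assume UN: "slice c = UNIV"
  have cw: "(c, w) \<in> \<Theta> ` B" for w using UN by (auto simp: slice_def)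
  \<comment> \<open>Pairing with the difference of two values makes Liouville's theorem decisive:
    constancy forces \<open>hdot e e = 0\<close>, contradicting injectivity.\<close>
  define e where "e = \<Xi> (c, 1) - \<Xi> (c, 0)"
  let ?f = "\<lambda>w. hdot (\<Xi> (c, w)) e"
  have "?f field_differentiable at w" for w
  proof -
    obtain D where D: "Vector_Spaces.linear (*) (*s) D" "((\<lambda>w. \<Xi> (c, w)) has_derivative D) (at w)"
      using immersion_slice[of c, unfolded UN] unfolding holomorphic_immersion_def by blast
    have "(?f has_derivative (\<lambda>h. hdot (D h) e)) (at w)"
      using diff_chain_at[OF D(2) bounded_linear_imp_has_derivative[OF bounded_linear_hdot]] by (simp add: o_def)
    moreover have "(\<lambda>h. hdot (D h) e) = (*) (hdot (D 1) e)"
    proof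
      fix h
      have "D (h * 1) = h *s D 1" using D(1) unfolding clinear_from_complex_iff by blast
      then show "hdot (D h) e = hdot (D 1) e * h" by (simp add: hdot_scale mult.commute)
    qed
    ultimately have "(?f has_field_derivative hdot (D 1) e) (at w)" by (simp add: has_field_derivative_def)
    then show ?thesis unfolding field_differentiable_def by blast
  qed
  then have "?f holomorphic_on UNIV"
    by (simp add: holomorphic_on_def field_differentiable_at_within)
  moreover have "bounded (range ?f)"
  proof (rule boundedI)
    fix y assume "y \<in> range ?f"
    then obtain w where y: "y = ?f w" by blast
    have "norm (\<Xi> (c, w)) * norm e \<le> 1 * norm e" using \<Theta>_\<Xi>(2)[OF cw[of w]] by (intro mult_right_mono) auto
    then show "norm y \<le> norm e" using norm_hdot_le[of "\<Xi> (c, w)" e] y by simp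
  qed
  ultimately have "?f constant_on UNIV" by (rule Liouville_theorem)
  then obtain k where "\<forall>w\<in>UNIV. ?f w = k" unfolding constant_on_def by (elim exE) (rule that)
  then have "?f 1 = ?f 0" by simp
  then have "hdot e e = 0" by (simp add: e_def hdot_diff)
  then have "\<Xi> (c, 1) = \<Xi> (c, 0)" by (simp add: hdot_self e_def)
  then have "\<Theta> (\<Xi> (c, 1)) = \<Theta> (\<Xi> (c, 0))" by simp
  then have "(c, 1 :: complex) = (c, 0)" unfolding \<Theta>_\<Xi>(1)[OF cw] .
  then show False by simp
qed

text \<open>The Riemann map of the planar component is composed with the slice parametrisation.
  Properness holds because a compact subset of the ball meets the closed leaf in a compact set,
  which the continuous inverse carries back to the disc.\<close>

lemma disc_leaf:
  assumes W: "W \<in> components (slice c)"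
  shows "properly_embedded_holomorphic_disc B (leaf c W)"
proof -
  have Ws: "W \<subseteq> slice c" by (rule components_subset[OF W])
  have oW: "open W" by (rule open_components[OF open_slice W])
  have "W \<noteq> UNIV" using slice_neq_UNIV Ws by blast
  then obtain \<phi> h where \<phi>: "\<phi> holomorphic_on W" and h: "h holomorphic_on ball 0 1"
      and \<phi>h: "\<forall>z\<in>W. \<phi> z \<in> ball 0 1 \<and> h (\<phi> z) = z" "\<forall>z\<in>ball 0 1. h z \<in> W \<and> \<phi> (h z) = z"
    using Riemann_mapping_theorem[of W] oW slice_component_simply_connected[OF W] in_components_nonempty[OF W] by blast
  have hom: "homeomorphism (ball 0 1) W h \<phi>"
  proof (rule homeomorphismI)
    show "continuous_on (ball 0 1) h" "continuous_on W \<phi>"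
      using h \<phi> holomorphic_on_imp_continuous_on by blast+
  qed (use \<phi>h in auto)
  let ?f = "\<lambda>z. \<Xi> (c, h z)" and ?g = "\<lambda>z. \<phi> (snd (\<Theta> z))"
  have homL: "homeomorphism (ball 0 1) (leaf c W) ?f ?g"
    using homeomorphism_compose[OF hom homeomorphism_leaf[OF Ws]] by (simp add: o_def)
  then have im: "?f ` ball 0 1 = leaf c W" by (simp add: homeomorphism_def)
  have "holomorphic_immersion (*) (*s) ?f (ball 0 1)"
    unfolding holomorphic_immersion_def
  proof
    fix z :: complex assume z: "z \<in> ball 0 1"
    have hz: "h z \<in> W" using \<phi>h z by blast
    obtain D where D: "Vector_Spaces.linear (*) (*s) D" "inj D" "((\<lambda>w. \<Xi> (c, w)) has_derivative D) (at (h z))"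
      using immersion_slice[of c] hz Ws unfolding holomorphic_immersion_def by blast
    have dh: "(h has_field_derivative deriv h z) (at z)" by (rule holomorphic_derivI[OF h open_ball z])
    have d\<phi>: "(\<phi> has_field_derivative deriv \<phi> (h z)) (at (h z))" by (rule holomorphic_derivI[OF \<phi> oW hz])
    have "((\<phi> \<circ> h) has_field_derivative deriv \<phi> (h z) * deriv h z) (at z)" by (rule DERIV_chain[OF d\<phi> dh])
    then have "((\<lambda>z. z) has_field_derivative deriv \<phi> (h z) * deriv h z) (at z)"
      by (rule has_field_derivative_transform_within_open[OF _ open_ball z]) (use \<phi>h in simp)
    then have "deriv \<phi> (h z) * deriv h z = 1" using DERIV_unique DERIV_ident by blast
    then have nz: "deriv h z \<noteq> 0" by auto
    have "((\<lambda>w. \<Xi> (c, w)) \<circ> h has_derivative D \<circ> (*) (deriv h z)) (at z)"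
      by (rule diff_chain_at[OF dh[unfolded has_field_derivative_def] D(3)])
    then have "(?f has_derivative (\<lambda>t. D (deriv h z * t))) (at z)" by (simp add: o_def)
    moreover have "inj (\<lambda>t. D (deriv h z * t))"
    proof (rule injI)
      fix x y assume "D (deriv h z * x) = D (deriv h z * y)"
      then have "deriv h z * x = deriv h z * y" by (rule injD[OF D(2)])
      then show "x = y" using nz by simp
    qed
    moreover have "Vector_Spaces.linear (*) (*s) (\<lambda>t. D (deriv h z * t))"
      using D(1) unfolding clinear_from_complex_iff by (simp add: distrib_left mult.left_commute)
    ultimately show "\<exists>f'. Vector_Spaces.linear (*) (*s) f' \<and> inj f' \<and> (?f has_derivative f') (at z)" by blast
  qed
  moreover have "compact {z \<in> ball 0 1. ?f z \<in> K}" if K: "compact K" "K \<subseteq> B" for K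
  proof -
    obtain T where T: "closed T" "leaf c W = B \<inter> T" using closedin_leaf[OF W] unfolding closedin_closed by blast
    have "K \<inter> leaf c W = K \<inter> T" using K(2) T(2) by blast
    then have "compact (K \<inter> leaf c W)" using compact_Int_closed[OF K(1) T(1)] by simp
    moreover have "continuous_on (K \<inter> leaf c W) ?g"
      by (rule continuous_on_subset[OF homeomorphism_cont2[OF homL]]) blast
    ultimately have "compact (?g ` (K \<inter> leaf c W))" by (intro compact_continuous_image)
    moreover have "?g ` (K \<inter> leaf c W) = {z \<in> ball 0 1. ?f z \<in> K}"
    proof (intro set_eqI iffI)
      fix z assume "z \<in> ?g ` (K \<inter> leaf c W)"
      then obtain x where x: "x \<in> K" "x \<in> leaf c W" "z = ?g x" by blast
      then show "z \<in> {z \<in> ball 0 1. ?f z \<in> K}"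
        using homeomorphism_apply2[OF homL x(2)] homeomorphism_image2[OF homL] by auto
    next
      fix z assume z: "z \<in> {z \<in> ball 0 1. ?f z \<in> K}"
      then have "z = ?g (?f z)" using homeomorphism_apply1[OF homL] by simp
      then show "z \<in> ?g ` (K \<inter> leaf c W)" using z im by blast
    qed
    ultimately show ?thesis by simp
  qed
  ultimately have "proper_holomorphic_embedding_of_disc B ?f"
    unfolding proper_holomorphic_embedding_of_disc_def im
    using homeomorphism_imp_homeomorphic_map[OF homL] leaf_subset[OF Ws] by (intro conjI allI impI) (simp_all only:)
  then show ?thesis unfolding properly_embedded_holomorphic_disc_def using im by blast
qed

lemma complete_leaf:
  assumes W: "W \<in> components (slice c)"
  shows "complete_submanifold (leaf c W)"
  unfolding complete_submanifold_def
proof (intro allI impI)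
  fix \<gamma> assume \<gamma>: "divergent_path (leaf c W) \<gamma>"
  obtain K t where t: "\<forall>k. 0 \<le> t k \<and> t k < 1 \<and> t k \<le> t (Suc k) \<and> norm (\<gamma> (t k)) = layer_radius (K + k)"
    using divergent_path_crossing_times[OF \<gamma> closedin_leaf[OF W]] by (elim exE) (rule that)
  \<comment> \<open>The shift puts \<open>z k\<close> on the sphere with index \<open>k\<close>. For
    \<open>k < K\<close> truncated subtraction gives \<open>\<gamma> (t 0)\<close>, outside the
    range that \<open>long\<close> looks at.\<close>
  define z where "z k = \<gamma> (t (k - K))" for k
  have fst_c: "fst (\<Theta> (\<gamma> s)) = c" if "0 \<le> s" "s < 1" for s
  proof -
    have "\<gamma> s \<in> leaf c W" using \<gamma> that unfolding divergent_path_def by auto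
    then show ?thesis using mem_leaf_iff[OF components_subset[OF W]] by blast
  qed
  have "norm (z k) = layer_radius k" if "K \<le> k" for k
    using t[rule_format, of "k - K"] that by (simp add: z_def)
  then have "\<not> summable (\<lambda>k. dist (z k) (z (Suc k)))"
    using fst_c t by (intro long[of K z c]) (simp add: z_def)
  then have "\<not> summable (\<lambda>k. dist (z (k + K)) (z (Suc (k + K))))"
    using summable_iff_shift[of "\<lambda>k. dist (z k) (z (Suc k))" K] by simp
  then have "\<not> summable (\<lambda>k. dist (\<gamma> (t k)) (\<gamma> (t (Suc k))))" by (simp add: z_def Suc_diff_le)
  then show "half_open_path_length \<gamma> = \<infinity>"
    using t by (intro half_open_path_length_infinite[of t]) auto
qed

end

section \<open>Splitting off one coordinate\<close>

definition split_coords :: "('m \<Rightarrow> 'n) \<Rightarrow> 'n \<Rightarrow> complex ^ 'n \<Rightarrow> (complex ^ 'm) \<times> complex" where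
  "split_coords e k z = ((\<chi> i. z $ e i), z $ k)"

definition join_coords :: "('m \<Rightarrow> 'n) \<Rightarrow> 'n \<Rightarrow> (complex ^ 'm) \<times> complex \<Rightarrow> complex ^ 'n" where
  "join_coords e k p = (\<chi> j. if j = k then snd p else fst p $ inv e j)"

lemma join_split_coords:
  assumes "inj e" "range e = - {k}"
  shows "join_coords e k (split_coords e k z) = z" "split_coords e k (join_coords e k p) = p"
proof -
  have "e (inv e j) = j" if "j \<noteq> k" for j using assms(2) that by (intro f_inv_into_f) auto
  then show "join_coords e k (split_coords e k z) = z"
    by (simp add: vec_eq_iff join_coords_def split_coords_def)
  have "e i \<noteq> k" for i using assms(2) by (metis ComplD insertI1 rangeI)
  then show "split_coords e k (join_coords e k p) = p"
    using assms(1) by (simp add: join_coords_def split_coords_def prod_eq_iff vec_eq_iff)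
qed

lemma holo_split_coords: "holomorphic_map (*s) prod_scale (split_coords (e :: 'm::finite \<Rightarrow> 'n::finite) k) S"
  unfolding holomorphic_map_def
proof
  fix z
  have lin: "linear (split_coords e k)"
    by (rule linearI) (simp_all add: split_coords_def vec_eq_iff)
  have "Vector_Spaces.linear (*s) prod_scale (split_coords e k)"
    unfolding clinear_to_prod_iff by (simp add: split_coords_def vec_eq_iff prod_scale_eq)
  then show "\<exists>f'. Vector_Spaces.linear (*s) prod_scale f' \<and> (split_coords e k has_derivative f') (at z)"
    using linear_imp_has_derivative[OF lin] by blast
qed

lemma holo_join_coords: "holomorphic_map prod_scale (*s) (join_coords (e :: 'm::finite \<Rightarrow> 'n::finite) k) S"
  unfolding holomorphic_map_def
proof
  fix p
  have lin: "linear (join_coords e k)"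
    by (rule linearI) (simp_all add: join_coords_def vec_eq_iff)
  have "Vector_Spaces.linear prod_scale (*s) (join_coords e k)"
    unfolding clinear_from_prod_iff by (simp add: join_coords_def vec_eq_iff prod_scale_eq)
  then show "\<exists>f'. Vector_Spaces.linear prod_scale (*s) f' \<and> (join_coords e k has_derivative f') (at p)"
    using linear_imp_has_derivative[OF lin] by blast
qed

lemma exists_labyrinthine_chart:
  assumes n: "CARD('n::finite) > 1" and nm: "CARD('n) = CARD('m::finite) + 1"
  shows "\<exists>\<Theta> :: complex ^ 'n \<Rightarrow> (complex ^ 'm) \<times> complex. labyrinthine_chart \<Theta>"
proof -
  obtain k :: 'n where True by blast
  have "card (- {k}) = CARD('m)" using nm by (simp add: Compl_eq_Diff_UNIV card_Diff_singleton)
  then obtain e :: "'m \<Rightarrow> 'n" where "bij_betw e UNIV (- {k})"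
    using finite_same_card_bij[of "UNIV :: 'm set" "- {k}"] by auto
  then have e: "inj e" "range e = - {k}" by (auto simp: bij_betw_def)
  \<comment> \<open>Any index coming from the transverse factor will do: then coordinate
    \<open>i\<close> is constant wherever the first component is.\<close>
  define i where "i = e undefined"
  obtain \<Phi> :: "complex ^ 'n \<Rightarrow> complex ^ 'n" where
    \<Phi>: "biholomorphic_map (*s) (*s) \<Phi> (ball 0 1) (\<Phi> ` ball 0 1)" "open (\<Phi> ` ball 0 1)"
    and long: "\<forall>N K z. (\<forall>k\<ge>K. norm (z k) = layer_radius k \<and> norm (\<Phi> (z k) $ i) \<le> N) \<longrightarrow>
       \<not> summable (\<lambda>k. dist (z k) (z (Suc k)))"
    and Runge: "\<forall>U b d. bounded U \<and> open U \<and> (\<forall>t\<in>frontier U. b + t *s d \<in> \<Phi> ` ball 0 1) \<longrightarrow>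
       (\<forall>t\<in>U. b + t *s d \<in> \<Phi> ` ball 0 1)"
    using exists_labyrinthine_map[OF n, of i] by (elim exE conjE) (rule that)
  let ?\<Theta> = "split_coords e k \<circ> \<Phi>" and ?\<Xi> = "inv_into (ball 0 1) \<Phi> \<circ> join_coords e k"
  note js = join_split_coords[OF e]
  have inj\<Phi>: "inj_on \<Phi> (ball 0 1)" using \<Phi>(1) by (simp add: biholomorphic_map_def bij_betw_def)
  have mem: "p \<in> ?\<Theta> ` ball 0 1 \<longleftrightarrow> join_coords e k p \<in> \<Phi> ` ball 0 1" for p
  proof
    assume "p \<in> ?\<Theta> ` ball 0 1"
    then show "join_coords e k p \<in> \<Phi> ` ball 0 1" by (auto simp: js)
  next
    assume "join_coords e k p \<in> \<Phi> ` ball 0 1"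
    then obtain z where "z \<in> ball 0 1" "join_coords e k p = \<Phi> z" by blast
    then have "p = ?\<Theta> z" using js(2)[of p] by simp
    then show "p \<in> ?\<Theta> ` ball 0 1" using \<open>z \<in> ball 0 1\<close> by blast
  qed
  have op: "open (?\<Theta> ` ball 0 1)"
  proof -
    have "?\<Theta> ` ball 0 1 = join_coords e k -` (\<Phi> ` ball 0 1)" using mem by blast
    then show ?thesis
      using open_vimage[OF \<Phi>(2) holomorphic_map_continuous[OF holo_join_coords]] by simp
  qed
  have inj\<Theta>: "inj_on ?\<Theta> (ball 0 1)"
    by (rule comp_inj_on[OF inj\<Phi>]) (rule inj_on_inverseI, rule js(1))
  show ?thesis
  proof (rule exI[of _ ?\<Theta>], rule labyrinthine_chart.intro)
    show "biholomorphic_map (*s) prod_scale ?\<Theta> (ball 0 1) (?\<Theta> ` ball 0 1)"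
      unfolding biholomorphic_map_def
    proof (intro conjI)
      show "bij_betw ?\<Theta> (ball 0 1) (?\<Theta> ` ball 0 1)" using inj\<Theta> by (simp add: bij_betw_def)
      show "holomorphic_map (*s) prod_scale ?\<Theta> (ball 0 1)"
        using holomorphic_map_comp[OF _ holo_split_coords[of e k UNIV]] \<Phi>(1)
        unfolding biholomorphic_map_def by blast
      have h: "holomorphic_map prod_scale (*s) ?\<Xi> (?\<Theta> ` ball 0 1)"
        using \<Phi>(1) mem unfolding biholomorphic_map_def
        by (intro holomorphic_map_comp[OF holo_join_coords]) auto
      show "holomorphic_map prod_scale (*s) (inv_into (ball 0 1) ?\<Theta>) (?\<Theta> ` ball 0 1)"
        unfolding holomorphic_map_def
      proof
        fix p assume p: "p \<in> ?\<Theta> ` ball 0 1"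
        then obtain D where D: "Vector_Spaces.linear prod_scale (*s) D" "(?\<Xi> has_derivative D) (at p)"
          using h unfolding holomorphic_map_def by blast
        have "(inv_into (ball 0 1) ?\<Theta> has_derivative D) (at p)"
        proof (rule has_derivative_transform_within_open[OF D(2) op p])
          fix q assume "q \<in> ?\<Theta> ` ball 0 1"
          then obtain z where z: "z \<in> ball 0 1" "q = ?\<Theta> z" by blast
          then show "?\<Xi> q = inv_into (ball 0 1) ?\<Theta> q"
            using inv_into_f_f[OF inj\<Theta> z(1)] inv_into_f_f[OF inj\<Phi> z(1)] js(1) by simp
        qed
        then show "\<exists>f'. Vector_Spaces.linear prod_scale (*s) f' \<and> (inv_into (ball 0 1) ?\<Theta> has_derivative f') (at p)"
          using D(1) by blast
      qed
    qed
    show "open (?\<Theta> ` ball 0 1)" by (rule op)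
  next
    fix U c assume U: "bounded U" "open U" "{c} \<times> frontier U \<subseteq> ?\<Theta> ` ball 0 1"
    \<comment> \<open>A vertical line of the product is an affine complex line in direction
      \<open>axis k 1\<close>, the form in which the Runge property was proved.\<close>
    have line: "join_coords e k (c, t) = join_coords e k (c, 0) + t *s axis k 1" for t
      by (simp add: vec_eq_iff join_coords_def axis_def)
    have "\<forall>t\<in>frontier U. join_coords e k (c, 0) + t *s axis k 1 \<in> \<Phi> ` ball 0 1"
    proof
      fix t assume "t \<in> frontier U"
      then have "(c, t) \<in> ?\<Theta> ` ball 0 1" using U(3) by blast
      then show "join_coords e k (c, 0) + t *s axis k 1 \<in> \<Phi> ` ball 0 1" unfolding mem line[symmetric] .
    qed
    then have "\<forall>t\<in>U. join_coords e k (c, 0) + t *s axis k 1 \<in> \<Phi> ` ball 0 1" using Runge U(1,2) by blast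
    then have "(c, t) \<in> ?\<Theta> ` ball 0 1" if "t \<in> U" for t unfolding mem line[of t] using that by blast
    then show "{c} \<times> U \<subseteq> ?\<Theta> ` ball 0 1" by blast
  next
    fix K z c assume z: "\<forall>j\<ge>K. norm (z j) = layer_radius j \<and> fst (?\<Theta> (z j)) = c"
    have "\<Phi> (z j) $ i = c $ undefined" if "j \<ge> K" for j
      using z that by (auto simp: split_coords_def i_def)
    then show "\<not> summable (\<lambda>j. dist (z j) (z (Suc j)))"
      using long[rule_format, of K z "norm (c $ undefined)"] z by simp
  qed
qed

theorem theorem1:
  assumes "CARD('n::finite) > 1"
    and "CARD('n) = CARD('m::finite) + 1"
  shows "\<exists>\<F> :: (complex ^ 'n) set set.
    nonsingular_holomorphic_foliation TYPE('m) (ball 0 1) \<F> \<and>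
    (\<forall>L\<in>\<F>. properly_embedded_holomorphic_disc (ball 0 1) L \<and> complete_submanifold L)"
proof -
  obtain \<Theta> :: "complex ^ 'n \<Rightarrow> (complex ^ 'm) \<times> complex" where "labyrinthine_chart \<Theta>"
    using exists_labyrinthine_chart[OF assms] by blast
  then interpret labyrinthine_chart \<Theta> .
  show ?thesis
    using foliation_leaves disc_leaf complete_leaf
    by (intro exI[of _ leaves]) (auto simp: leaves_def)
qed

end
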